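(* Assume (Z). For each $x\in\mathcal I$, $\operatorname{argmin}_{h\in\mathcal H}V(x,h)\subseteq(P'(a),P'(b))$ (the interior of $\mathcal H$), and every minimiser $h^*\in\operatorname{argmin}_{h\in\mathcal H}V(x,h)$ satisfies $h^*=\widehat\Gamma_{h^*}(x)$.
   Context: Let $(\Omega,\mathcal F,\mathsf P)$ carry a standard Brownian motion $W$ with natural filtration $\mathbb F$ satisfying the usual conditions. Fix $r>0$, $\sigma>0$, $K>0$. For $x>0$ let $S^x$ solve $\mathrm dS_t=rS_t\,\mathrm dt+\sigma S_t\,\mathrm dW_t$, $S_0=x$; $\mathsf E_x$ denotes expectation when $S_0=x$. Put $d=2r/\sigma^2$, $\hat a=K/(1+1/d)$, $P(x)=\frac1d\hat a^{1+d}x^{-d}$ for $x\ge\hat a$ and $P(x)=K-x$ for $0\le x\le\hat a$, so $P'(x)=\max\{-(\hat a/x)^{1+d},-1\}$. Fix $\hat a\le a<b<\infty$, $\mathcal I=(a,b)$, $\tau^x_{\mathcal I}=\inf\{t\ge0:S^x_t\notin\mathcal I\}$ (written $\tau_{\mathcal I}$ under $\mathsf E_x$), $\mathcal T_x$ the set of $\mathbb F$-stopping times $\tau\le\tau^x_{\mathcal I}$ a.s., $\mathcal H=[P'(a),P'(b)]$, $f(x,\theta)=(\theta-P'(x))^2\sigma^2x^2$. For $x\in[a,b]$ let $\gamma_1(x)=\mathsf E_x[\int_0^{\tau_{\mathcal I}}e^{-2ru}\sigma^2S_u^2\,\mathrm du]$, $\gamma_2(x)=\mathsf E_x[\int_0^{\tau_{\mathcal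 I}}e^{-2ru}P'(S_u)\sigma^2S_u^2\,\mathrm du]$, $\gamma_3(x)=\mathsf E_x[\int_0^{\tau_{\mathcal I}}e^{-2ru}(P'(S_u))^2\sigma^2S_u^2\,\mathrm du]$; for $x\in\mathcal I$ set $M(x)=\gamma_3(x)-\gamma_2(x)^2/\gamma_1(x)$, and set $M(a)=M(b)=0$. For $(x,h)\in[a,b]\times\mathcal H$ define $V(x,h)=\inf_{\tau\in\mathcal T_x}\mathsf E_x\big[\int_0^\tau e^{-2ru}f(S_u,h)\,\mathrm du+e^{-2r\tau}M(S_\tau)\big]$ (this is the minimal variance of the discounted hedging error when the initial stock holding is $h$ and one optimal rebalancing is allowed before $\tau_{\mathcal I}$), $\mathcal C_h=\{x\in[a,b]:V(x,h)<M(x)\}$, $\mathcal D_h=\{x\in[a,b]:V(x,h)=M(x)\}$, and $\tau^*_{x,h}=\inf\{t\ge0:S^x_t\in\mathcal D_h\}$ (written $\tau^*_h$ under $\mathsf E_x$). Let $\mathcal Lv(x)=\frac{\sigma^2}{2}x^2v''(x)+rxv'(x)$ and $G(x,h)=(\mathcal L-2r)M(x)+f(x,h)$ for $x\in\mathcal I$. Assumption (Z): for each $h\in\mathcal H$, the equation $G(x,h)=0$ has at most two roots $x\in\mathcal I$. Under (Z), for each $h\in\mathcal H$ the set $\mathcal C_h$ is an open interval $(x^*_{1,h},x^*_{2,h})$ with $a\le x^*_{1,h}<x^*_{2,h}\le b$. For $h\in\mathcal H$ and $x\in[a,b]$ let $\hat\gamma_{h,1}(x)=\mathsf E_x[\int_0^{\tau^*_h}e^{-2ru}\sigma^2S_u^2\,\mathrm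 du]$, $\hat\gamma_{h,2}(x)=\mathsf E_x[\int_0^{\tau^*_h}e^{-2ru}P'(S_u)\sigma^2S_u^2\,\mathrm du]$, and for $x\in(x^*_{1,h},x^*_{2,h})$ let $\widehat\Gamma_h(x)=\hat\gamma_{h,2}(x)/\hat\gamma_{h,1}(x)$. *)

theory Defs
  imports "HOL-Probability.Probability"
begin

definition brownian_motion :: "'a measure \<Rightarrow> (real \<Rightarrow> 'a \<Rightarrow> real) \<Rightarrow> bool" where
  "brownian_motion M W \<longleftrightarrow>
     prob_space M \<and>
     (\<forall>t. W t \<in> borel_measurable M) \<and>
     (\<forall>\<omega>\<in>space M. W 0 \<omega> = 0 \<and> continuous_on {0..} (\<lambda>t. W t \<omega>)) \<and>
     (\<forall>s t. 0 \<le> s \<and> s < t \<longrightarrow>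
        distributed M lborel (\<lambda>\<omega>. W t \<omega> - W s \<omega>) (normal_density 0 (sqrt (t - s)))) \<and>
     (\<forall>ts :: real list. sorted ts \<and> (\<forall>t\<in>set ts. 0 \<le> t) \<longrightarrow>
        prob_space.indep_vars M (\<lambda>_. borel)
          (\<lambda>i \<omega>. W (ts ! Suc i) \<omega> - W (ts ! i) \<omega>) {..<length ts - 1})"

definition bm_filt_aug :: "'a measure \<Rightarrow> (real \<Rightarrow> 'a \<Rightarrow> real) \<Rightarrow> real \<Rightarrow> 'a measure" where
  "bm_filt_aug M W t = sigma (space M)
     ({W s -` B \<inter> space M | s B. 0 \<le> s \<and> s \<le> t \<and> B \<in> sets borel} \<union> null_sets M)"

definition bm_filtration :: "'a measure \<Rightarrow> (real \<Rightarrow> 'a \<Rightarrow> real) \<Rightarrow> real \<Rightarrow> 'a measure" where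
  "bm_filtration M W t = sigma (space M) {A. \<forall>u>t. A \<in> sets (bm_filt_aug M W u)}"

text \<open>Geometric Brownian motion started at x: the (unique strong) solution of
dS = r S dt + sigma S dW, S_0 = x.\<close>
definition gbm :: "(real \<Rightarrow> 'a \<Rightarrow> real) \<Rightarrow> real \<Rightarrow> real \<Rightarrow> real \<Rightarrow> real \<Rightarrow> 'a \<Rightarrow> real" where
  "gbm W r \<sigma> x t \<omega> = x * exp ((r - \<sigma>\<^sup>2 / 2) * t + \<sigma> * W t \<omega>)"

definition dpar :: "real \<Rightarrow> real \<Rightarrow> real" where
  "dpar r \<sigma> = 2 * r / \<sigma>\<^sup>2"

definition ahat :: "real \<Rightarrow> real \<Rightarrow> real \<Rightarrow> real" where
  "ahat r \<sigma> K = K / (1 + 1 / dpar r \<sigma>)"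

definition Pput :: "real \<Rightarrow> real \<Rightarrow> real \<Rightarrow> real \<Rightarrow> real" where
  "Pput r \<sigma> K x = (if ahat r \<sigma> K \<le> x
      then (1 / dpar r \<sigma>) * ahat r \<sigma> K powr (1 + dpar r \<sigma>) * x powr (- dpar r \<sigma>)
      else K - x)"

definition Pd :: "real \<Rightarrow> real \<Rightarrow> real \<Rightarrow> real \<Rightarrow> real" where
  "Pd r \<sigma> K x = max (- ((ahat r \<sigma> K / x) powr (1 + dpar r \<sigma>))) (-1)"

definition ffun :: "real \<Rightarrow> real \<Rightarrow> real \<Rightarrow> real \<Rightarrow> real \<Rightarrow> real" where
  "ffun r \<sigma> K x h = (h - Pd r \<sigma> K x)\<^sup>2 * \<sigma>\<^sup>2 * x\<^sup>2"

definition exit_time :: "(real \<Rightarrow> 'a \<Rightarrow> real) \<Rightarrow> real \<Rightarrow> real \<Rightarrow> real \<Rightarrow> real \<Rightarrow> real \<Rightarrow> 'a \<Rightarrow> real" where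
  "exit_time W r \<sigma> a b x \<omega> = Inf {t. 0 \<le> t \<and> gbm W r \<sigma> x t \<omega> \<notin> {a<..<b}}"

definition disc_run :: "'a measure \<Rightarrow> (real \<Rightarrow> 'a \<Rightarrow> real) \<Rightarrow> real \<Rightarrow> real \<Rightarrow> real
    \<Rightarrow> (real \<Rightarrow> real) \<Rightarrow> ('a \<Rightarrow> real) \<Rightarrow> real" where
  "disc_run M W r \<sigma> x g T = integral\<^sup>L M (\<lambda>\<omega>.
     set_lebesgue_integral lborel {0..T \<omega>} (\<lambda>u. exp (- 2 * r * u) * g (gbm W r \<sigma> x u \<omega>)))"

definition gam1 where
  "gam1 M W r \<sigma> K a b x = disc_run M W r \<sigma> x (\<lambda>s. \<sigma>\<^sup>2 * s\<^sup>2) (exit_time W r \<sigma> a b x)"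
definition gam2 where
  "gam2 M W r \<sigma> K a b x = disc_run M W r \<sigma> x (\<lambda>s. Pd r \<sigma> K s * \<sigma>\<^sup>2 * s\<^sup>2) (exit_time W r \<sigma> a b x)"
definition gam3 where
  "gam3 M W r \<sigma> K a b x = disc_run M W r \<sigma> x (\<lambda>s. (Pd r \<sigma> K s)\<^sup>2 * \<sigma>\<^sup>2 * s\<^sup>2) (exit_time W r \<sigma> a b x)"

definition Mvar :: "'a measure \<Rightarrow> (real \<Rightarrow> 'a \<Rightarrow> real) \<Rightarrow> real \<Rightarrow> real \<Rightarrow> real \<Rightarrow> real \<Rightarrow> real \<Rightarrow> real \<Rightarrow> real" where
  "Mvar M W r \<sigma> K a b x = (if a < x \<and> x < b
     then gam3 M W r \<sigma> K a b x - (gam2 M W r \<sigma> K a b x)\<^sup>2 / gam1 M W r \<sigma> K a b x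
     else 0)"

definition adm_stops :: "'a measure \<Rightarrow> (real \<Rightarrow> 'a \<Rightarrow> real) \<Rightarrow> real \<Rightarrow> real \<Rightarrow> real \<Rightarrow> real \<Rightarrow> real \<Rightarrow> ('a \<Rightarrow> real) set" where
  "adm_stops M W r \<sigma> a b x = {\<tau>. stopping_time (bm_filtration M W) \<tau> \<and>
      (\<forall>\<omega>\<in>space M. 0 \<le> \<tau> \<omega>) \<and>
      (AE \<omega> in M. \<tau> \<omega> \<le> exit_time W r \<sigma> a b x \<omega>)}"

definition Vfun :: "'a measure \<Rightarrow> (real \<Rightarrow> 'a \<Rightarrow> real) \<Rightarrow> real \<Rightarrow> real \<Rightarrow> real \<Rightarrow> real \<Rightarrow> real \<Rightarrow> real \<Rightarrow> real \<Rightarrow> real" where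
  "Vfun M W r \<sigma> K a b x h = (INF \<tau> \<in> adm_stops M W r \<sigma> a b x.
      disc_run M W r \<sigma> x (\<lambda>s. ffun r \<sigma> K s h) \<tau>
      + integral\<^sup>L M (\<lambda>\<omega>. exp (- 2 * r * \<tau> \<omega>) * Mvar M W r \<sigma> K a b (gbm W r \<sigma> x (\<tau> \<omega>) \<omega>)))"

definition Cset where
  "Cset M W r \<sigma> K a b h = {y \<in> {a..b}. Vfun M W r \<sigma> K a b y h < Mvar M W r \<sigma> K a b y}"
definition Dset where
  "Dset M W r \<sigma> K a b h = {y \<in> {a..b}. Vfun M W r \<sigma> K a b y h = Mvar M W r \<sigma> K a b y}"

definition opt_stop :: "'a measure \<Rightarrow> (real \<Rightarrow> 'a \<Rightarrow> real) \<Rightarrow> real \<Rightarrow> real \<Rightarrow> real \<Rightarrow> real \<Rightarrow> real \<Rightarrow> real \<Rightarrow> real \<Rightarrow> 'a \<Rightarrow> real" where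
  "opt_stop M W r \<sigma> K a b x h \<omega> = Inf {t. 0 \<le> t \<and> gbm W r \<sigma> x t \<omega> \<in> Dset M W r \<sigma> K a b h}"

definition gamhat1 where
  "gamhat1 M W r \<sigma> K a b h x = disc_run M W r \<sigma> x (\<lambda>s. \<sigma>\<^sup>2 * s\<^sup>2) (opt_stop M W r \<sigma> K a b x h)"
definition gamhat2 where
  "gamhat2 M W r \<sigma> K a b h x = disc_run M W r \<sigma> x (\<lambda>s. Pd r \<sigma> K s * \<sigma>\<^sup>2 * s\<^sup>2) (opt_stop M W r \<sigma> K a b x h)"

definition Gamhat where
  "Gamhat M W r \<sigma> K a b h x = gamhat2 M W r \<sigma> K a b h x / gamhat1 M W r \<sigma> K a b h x"

text \<open>G(x,h) = (L - 2r) M(x) + f(x,h).\<close>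
definition Gfun where
  "Gfun M W r \<sigma> K a b x h =
     \<sigma>\<^sup>2 / 2 * x\<^sup>2 * deriv (deriv (Mvar M W r \<sigma> K a b)) x
     + r * x * deriv (Mvar M W r \<sigma> K a b) x
     - 2 * r * Mvar M W r \<sigma> K a b x + ffun r \<sigma> K x h"

definition assmZ where
  "assmZ M W r \<sigma> K a b \<longleftrightarrow>
     (\<forall>h \<in> {Pd r \<sigma> K a..Pd r \<sigma> K b}.
        finite {x \<in> {a<..<b}. Gfun M W r \<sigma> K a b x h = 0} \<and>
        card {x \<in> {a<..<b}. Gfun M W r \<sigma> K a b x h = 0} \<le> 2)"

end

theory Submission
  imports Defs
begin

text \<open>
  For a fixed stopping time \<open>\<tau>\<close> the cost is a quadratic polynomial in \<open>h\<close>, with leading coefficient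
  \<open>A = E \<integral> e^{-2ru} \<sigma>\<^sup>2 S\<^sup>2 du\<close> and vertex \<open>B / A\<close>, where \<open>B\<close> is the same integral weighted with \<open>P'(S)\<close>.
  If \<open>\<tau>\<close> is optimal for a minimiser \<open>h*\<close>, then \<open>V x h \<le> J x \<tau> h\<close> for all \<open>h\<close>, with equality at \<open>h*\<close>,
  so \<open>h*\<close> minimises this polynomial over \<open>H\<close>; its vertex is an average of values of \<open>P'\<close> in the
  interior of \<open>H\<close>, and therefore \<open>h* = B / A\<close>. No differentiability
  of \<open>V\<close> in \<open>h\<close> enters.

  That the hitting time of \<open>D_h\<close> is optimal is shown by writing \<open>J x \<tau> h = F x - E e^{-2r\<tau>} G(S_\<tau>)\<close>
  and choosing a function \<open>c s\<^sup>p + d s\<^sup>q\<close>, where \<open>p\<close> and \<open>q\<close> are the roots of \<open>(L - 2r) s\<^sup>k = 0\<close>, that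
  dominates \<open>G\<close> and touches it on both sides of \<open>x\<close>. After division by \<open>s\<^sup>q\<close>, in the variable
  \<open>s^{p-q}\<close>, this is the supporting line of a concave envelope. All costs are combinations of
  powers of \<open>S\<close>, so the only stochastic calculus needed is optional stopping for the exponential
  martingales of \<open>W\<close>.
\<close>

section \<open>Concave envelopes\<close>

text \<open>The polynomial in \<open>h\<close> determines its minimiser only if \<open>A\<close> is
  positive, so the optimal time must not be \<open>0\<close>: a minimiser has to satisfy
  \<open>V x h < mv x\<close>. As \<open>mv x\<close> does not depend on \<open>h\<close>, it
  suffices to exhibit one \<open>h\<close> in \<open>H\<close> with this property. The function
  \<open>G\<close> is the penalty \<open>(\<gamma>2 - h * \<gamma>1)^2 / \<gamma>1\<close> for
  holding \<open>h\<close> until the exit from \<open>(a, b)\<close> instead of the best constant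
  \<open>\<gamma>2 / \<gamma>1\<close>; it is nonnegative and vanishes at \<open>a\<close> and
  \<open>b\<close>. The majorant is built for one \<open>x\<close> at a time, but it bounds the cost
  from below for every starting point, and the exit from an interval between two contact points
  attains this bound for every start in that interval. So no point strictly between the contacts
  nearest to \<open>x\<close> belongs to \<open>D_h\<close>, while the contacts themselves do; this
  is what identifies the exit time with the hitting time of \<open>D_h\<close>.\<close>

lemma concave_envelope_chord:
  fixes G :: "real \<Rightarrow> real"
  assumes cont: "continuous_on {A..B} G" and x: "A < x" "x < B"
  obtains c s l m where "A \<le> l" "l \<le> x" "x \<le> m" "m \<le> B"
    and "\<And>z. z \<in> {A..B} \<Longrightarrow> G z \<le> c + s * z"
    and "G l = c + s * l" "G m = c + s * m" "l < x \<and> x < m \<or> l = x \<and> m = x"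
proof -
  \<comment> \<open>\<open>S\<close> lists the ways of writing \<open>x\<close> as a convex
    combination of a point on its left and a point on its right. The maximal chord height
    \<open>C\<close> over this compact set is the value at \<open>x\<close> of the concave envelope
    of \<open>G\<close>.\<close>
  define S where "S = ({A..x} \<times> {x..B} \<times> {0..1}) \<inter>
    {(l,m,t). t * l + (1 - t) * m = (x::real)}"
  define H where "H = (\<lambda>(l,m,t). t * G l + (1 - t) * G m :: real)"
  have "closed {(l,m,t). t * l + (1 - t) * m = (x::real)}"
    unfolding case_prod_beta by (intro closed_Collect_eq continuous_intros)
  hence "compact S"
    unfolding S_def by (intro compact_Int_closed compact_Times) auto
  moreover have "S \<noteq> {}" using x unfolding S_def by (force intro!: exI[of _ x] exI[of _ 0])
  moreover have "continuous_on S H"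
    unfolding H_def case_prod_beta
    by (intro continuous_intros continuous_on_compose2[OF cont]) (use x in \<open>auto simp: S_def\<close>)
  ultimately obtain w where w: "w \<in> S" and wmax: "\<And>y. y \<in> S \<Longrightarrow> H y \<le> H w"
    using continuous_attains_sup[of S H] by blast
  obtain l m t where lmt: "w = (l,m,t)" by (cases w)
  define C where "C = H w"
  have lm: "A \<le> l" "l \<le> x" "x \<le> m" "m \<le> B" "0 \<le> t" "t \<le> 1" "t * l + (1 - t) * m = x"
    using w lmt by (auto simp: S_def)
  have Ceq: "C = t * G l + (1 - t) * G m" using lmt by (simp add: C_def H_def)
  have chord: "t' * G z + (1 - t') * G y \<le> C"
    if "A \<le> z" "z \<le> x" "x \<le> y" "y \<le> B" "0 \<le> t'" "t' \<le> 1" "t' * z + (1 - t') * y = x" for z y t'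
    using wmax[of "(z,y,t')"] that by (auto simp: S_def H_def C_def)
  have slope: "(G y - C) / (y - x) \<le> (C - G z) / (x - z)"
    if "A \<le> z" "z < x" "x < y" "y \<le> B" for z y
  proof -
    define t' where "t' = (y - x) / (y - z)"
    have t1: "1 - t' = (x - z) / (y - z)" using that by (simp add: t'_def field_simps)
    have "t' * z + (1 - t') * y = ((y - x) * z + (x - z) * y) / (y - z)"
      unfolding t1 by (simp add: t'_def add_divide_distrib)
    also have "\<dots> = x" using that by (simp add: field_simps)
    finally have "t' * G z + (1 - t') * G y \<le> C"
      using that by (intro chord) (auto simp: t'_def)
    hence "((y - x) * G z + (x - z) * G y) / (y - z) \<le> C"
      unfolding t1 by (simp add: t'_def add_divide_distrib)
    hence "(y - x) * G z + (x - z) * G y \<le> C * (y - z)" using that by (simp add: field_simps)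
    hence "(G y - C) * (x - z) \<le> (C - G z) * (y - x)" by (simp add: algebra_simps)
    thus ?thesis using that by (simp add: divide_le_eq le_divide_eq mult.commute)
  qed
  \<comment> \<open>Since no chord passes above \<open>(x, C)\<close>, every slope from this point
    to the right is at most every slope to the left. The supremum of the right-hand slopes therefore
    belongs to a line above \<open>G\<close> on both sides.\<close>
  define s where "s = (SUP y\<in>{x<..B}. (G y - C) / (y - x))"
  have bdd: "bdd_above ((\<lambda>y. (G y - C) / (y - x)) ` {x<..B})"
    using slope[of A] x by (intro bdd_aboveI[where M="(C - G A) / (x - A)"]) auto
  have right: "G y \<le> C + s * (y - x)" if "x < y" "y \<le> B" for y
  proof -
    have "(G y - C) / (y - x) \<le> s" unfolding s_def using that by (intro cSUP_upper bdd) auto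
    thus ?thesis using that by (simp add: field_simps)
  qed
  have left: "G z \<le> C + s * (z - x)" if "A \<le> z" "z < x" for z
  proof -
    have "s \<le> (C - G z) / (x - z)" unfolding s_def using that x
      by (intro cSUP_least) (auto intro!: slope)
    thus ?thesis using that by (simp add: field_simps)
  qed
  have mid: "G x \<le> C" using chord[of x x 1] x by auto
  have dom: "G z \<le> (C - s * x) + s * z" if "z \<in> {A..B}" for z
    using left[of z] right[of z] mid that by (cases z x rule: linorder_cases) (auto simp: algebra_simps)
  show thesis
  proof (cases "C = G x")
    case True
    show thesis by (rule that[of x x "C - s * x" s]) (use True x dom in auto)
  next
    case False
    have ne: "l \<noteq> x" "m \<noteq> x"
    proof -
      show "l \<noteq> x"
      proof
        assume "l = x"
        hence "(1 - t) * (m - x) = 0" using lm(7) by (simp add: algebra_simps)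
        hence "t = 1 \<or> m = x" by auto
        thus False using Ceq \<open>l = x\<close> False by (auto simp: algebra_simps)
      qed
      show "m \<noteq> x"
      proof
        assume "m = x"
        hence "t * (l - x) = 0" using lm(7) by (simp add: algebra_simps)
        hence "t = 0 \<or> l = x" by auto
        thus False using Ceq \<open>m = x\<close> False by (auto simp: algebra_simps)
      qed
    qed
    have t: "0 < t" "t < 1" using lm ne by (auto simp: less_le)
    \<comment> \<open>The gaps between the line and \<open>G\<close> at \<open>l\<close> and
      \<open>m\<close> are nonnegative, and their weighted sum is the gap between the line and the
      chord at \<open>x\<close>, which is zero. So both vanish.\<close>
    have dl: "G l \<le> (C - s * x) + s * l" and dm: "G m \<le> (C - s * x) + s * m"
      using lm(1-4) x by (intro dom; simp)+
    have "t * ((C - s * x) + s * l - G l) + (1 - t) * ((C - s * x) + s * m - G m)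
        = C - s * x + s * (t * l + (1 - t) * m) - C"
      unfolding Ceq by (simp add: algebra_simps)
    also have "\<dots> = 0" using lm(7) by simp
    finally have sum0: "t * ((C - s * x) + s * l - G l) + (1 - t) * ((C - s * x) + s * m - G m) = 0" .
    have "0 \<le> t * ((C - s * x) + s * l - G l)" "0 \<le> (1 - t) * ((C - s * x) + s * m - G m)"
      using t dl dm by auto
    hence "t * ((C - s * x) + s * l - G l) = 0" "(1 - t) * ((C - s * x) + s * m - G m) = 0"
      using sum0 by linarith+
    hence "G l = (C - s * x) + s * l" "G m = (C - s * x) + s * m"
      using t by auto
    thus thesis using lm ne dom by (intro that[of l m "C - s * x" s]) auto
  qed
qed

lemma power_envelope:
  fixes g :: "real \<Rightarrow> real"
  assumes cont: "continuous_on {a..b} g" and ab: "0 < a" "a < x" "x < b" and pq: "q < p"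
  obtains c d l m where "a \<le> l" "l \<le> x" "x \<le> m" "m \<le> b"
    and "\<And>z. z \<in> {a..b} \<Longrightarrow> g z \<le> c * z powr p + d * z powr q"
    and "g l = c * l powr p + d * l powr q" "g m = c * m powr p + d * m powr q"
    and "l < x \<and> x < m \<or> l = x \<and> m = x"
proof -
  define e where "e = p - q"
  define F where "F = (\<lambda>z::real. z powr e)"
  define R where "R = (\<lambda>z::real. z powr (1 / e))"
  have e: "e > 0" using pq by (simp add: e_def)
  have Fmono: "F u \<le> F v" if "0 < u" "u \<le> v" for u v
    unfolding F_def using that e by (intro powr_mono2) auto
  have Fless: "F u < F v" if "0 < u" "u < v" for u v
    unfolding F_def using that e by (intro powr_less_mono2) auto
  have RF: "R (F z) = z" if "0 < z" for z
    using that e by (simp add: R_def F_def powr_powr)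
  have FR: "F (R z) = z" if "0 < z" for z
    using that e by (simp add: R_def F_def powr_powr)
  have Rrange: "R z \<in> {a..b}" if "z \<in> {F a..F b}" for z
  proof -
    have z: "z > 0" using that ab by (auto simp: F_def intro: less_le_trans[of 0 "a powr e"])
    have "R (F a) \<le> R z" "R z \<le> R (F b)" using that e z unfolding R_def
      by (auto intro!: powr_mono2 simp: F_def)
    thus ?thesis using RF ab by auto
  qed
  have Rpos: "R z > 0" if "z \<in> {F a..F b}" for z using Rrange[OF that] ab by auto
  have zpos: "z > 0" if "z \<in> {F a..F b}" for z
    using that ab by (auto simp: F_def intro: less_le_trans[of 0 "a powr e"])
  define G where "G = (\<lambda>z. g (R z) * R z powr (-q))"
  have contR: "continuous_on {F a..F b} R" unfolding R_def
    by (intro continuous_intros) (use zpos in force)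
  have "continuous_on {F a..F b} G" unfolding G_def
    by (intro continuous_intros continuous_on_compose2[OF cont contR] contR) (use Rrange Rpos in force)+
  moreover have "F a < F x" "F x < F b" using ab Fless by auto
  ultimately obtain d c l m where lm: "F a \<le> l" "l \<le> F x" "F x \<le> m" "m \<le> F b"
    and dom: "\<And>z. z \<in> {F a..F b} \<Longrightarrow> G z \<le> d + c * z"
    and eq: "G l = d + c * l" "G m = d + c * m" and alt: "l < F x \<and> F x < m \<or> l = F x \<and> m = F x"
    using concave_envelope_chord[of "F a" "F b" G "F x"] by metis
  have tr: "(d + c * F y) * y powr q = c * y powr p + d * y powr q" if "0 < y" for y
    using that by (simp add: F_def e_def algebra_simps flip: powr_add)
  have G: "G (F y) * y powr q = g y" if "0 < y" for y
    using that RF[OF that] by (simp add: G_def powr_minus)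
  have l0: "R l > 0" "R m > 0" using lm by (auto intro!: Rpos)
  have Fl: "F (R l) = l" "F (R m) = m" using lm by (auto intro!: FR zpos)
  show thesis
  proof (rule that[of "R l" "R m" c d])
    show "a \<le> R l" "R m \<le> b" using Rrange[of l] Rrange[of m] lm by auto
    show "R l \<le> x" using Fless[of x "R l"] Fl lm ab by force
    show "x \<le> R m" using Fless[of "R m" x] Fl lm ab l0 by force
    show "g (R l) = c * R l powr p + d * R l powr q" using eq tr[of "R l"] G[of "R l"] l0 Fl by simp
    show "g (R m) = c * R m powr p + d * R m powr q" using eq tr[of "R m"] G[of "R m"] l0 Fl by simp
    show "R l < x \<and> x < R m \<or> R l = x \<and> R m = x"
      using alt RF[of x] Fmono[of x "R l"] Fmono[of "R m" x] Fl l0 ab by force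
    fix z assume z: "z \<in> {a..b}"
    hence "G (F z) \<le> d + c * F z" using ab by (intro dom) (auto intro!: Fmono)
    hence "G (F z) * z powr q \<le> (d + c * F z) * z powr q" by (intro mult_right_mono) auto
    thus "g z \<le> c * z powr p + d * z powr q" using G[of z] tr[of z] z ab by simp
  qed
qed

text \<open>Cramer's rule. The determinant \<open>D\<close> is nonzero because the quotient of the
  two powers, \<open>s powr (p - q)\<close>, is strictly increasing.\<close>

lemma power_interpolation:
  fixes a b p q u v :: real
  assumes "0 < a" "a < b" "q < p"
  obtains c d where "c * a powr p + d * a powr q = u" "c * b powr p + d * b powr q = v"
proof -
  define D where "D = a powr p * b powr q - b powr p * a powr q"
  have "a powr (p - q) < b powr (p - q)" using assms by (intro powr_less_mono2) auto
  hence "a powr p * b powr q < b powr p * a powr q"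
    using assms by (simp add: powr_diff field_simps)
  hence D: "D \<noteq> 0" by (simp add: D_def)
  define c where "c = (u * b powr q - v * a powr q) / D"
  define d where "d = (v * a powr p - u * b powr p) / D"
  have "(c * a powr p + d * a powr q) * D = u * D" "(c * b powr p + d * b powr q) * D = v * D"
    using D unfolding c_def d_def
    by (simp_all add: distrib_right) (simp_all add: D_def algebra_simps)
  thus thesis using D that[of c d] by auto
qed

section \<open>Exponential martingales and optional stopping\<close>

text \<open>Completing the square: the exponential weight shifts the mean to
  \<open>\<theta> * s^2\<close> and leaves a constant factor.\<close>

lemma normal_mgf:
  fixes s \<theta> :: real
  assumes "s > 0"
  shows "integrable lborel (\<lambda>x. normal_density 0 s x * exp (\<theta> * x))"
    and "(\<integral>x. normal_density 0 s x * exp (\<theta> * x) \<partial>lborel) = exp (\<theta>\<^sup>2 * s\<^sup>2 / 2)"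
proof -
  have eq: "normal_density 0 s x * exp (\<theta> * x) = exp (\<theta>\<^sup>2 * s\<^sup>2 / 2) * normal_density (\<theta> * s\<^sup>2) s x" for x
  proof -
    have "- (x - 0)\<^sup>2 / (2 * s\<^sup>2) + \<theta> * x = \<theta>\<^sup>2 * s\<^sup>2 / 2 + (- (x - \<theta> * s\<^sup>2)\<^sup>2 / (2 * s\<^sup>2))"
      using assms by (simp add: field_simps power2_eq_square)
    thus ?thesis unfolding normal_density_def
      by (simp add: mult.assoc flip: exp_add)
  qed
  show "integrable lborel (\<lambda>x. normal_density 0 s x * exp (\<theta> * x))"
    unfolding eq using assms by simp
  show "(\<integral>x. normal_density 0 s x * exp (\<theta> * x) \<partial>lborel) = exp (\<theta>\<^sup>2 * s\<^sup>2 / 2)"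
    unfolding eq using assms by simp
qed

text \<open>A uniform second moment replaces a dominating function. Fatou gives one inequality. For
  the other, truncation at \<open>c\<close> lowers each expectation by at most \<open>C / c\<close>,
  because \<open>X - min X c\<close> is at most \<open>X^2 / c\<close>, and the truncated variables
  converge by dominated convergence.\<close>

lemma (in prob_space) expectation_limit_L2_bounded:
  fixes X :: "nat \<Rightarrow> 'a \<Rightarrow> real" and Y :: "'a \<Rightarrow> real"
  assumes lim: "\<And>\<omega>. \<omega> \<in> space M \<Longrightarrow> (\<lambda>k. X k \<omega>) \<longlonglongrightarrow> Y \<omega>"
    and nonneg: "\<And>k \<omega>. 0 \<le> X k \<omega>"
    and int: "\<And>k. integrable M (X k)" and ex: "\<And>k. expectation (X k) = e"
    and int2: "\<And>k. integrable M (\<lambda>\<omega>. (X k \<omega>)\<^sup>2)" and ex2: "\<And>k. expectation (\<lambda>\<omega>. (X k \<omega>)\<^sup>2) \<le> C"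
  shows "integrable M Y" and "expectation Y = e"
proof -
  have [measurable]: "X k \<in> borel_measurable M" for k using int by auto
  have Ym [measurable]: "Y \<in> borel_measurable M"
    by (rule borel_measurable_LIMSEQ_real[OF lim]) auto
  have Ynn: "0 \<le> Y \<omega>" if "\<omega> \<in> space M" for \<omega>
    using nonneg by (intro LIMSEQ_le_const[OF lim[OF that]]) auto
  have e0: "0 \<le> e" using ex[of 0] nonneg by (metis Bochner_Integration.integral_nonneg)
  have "(\<integral>\<^sup>+\<omega>. ennreal (Y \<omega>) \<partial>M) = (\<integral>\<^sup>+\<omega>. liminf (\<lambda>k. ennreal (X k \<omega>)) \<partial>M)"
  proof (rule nn_integral_cong)
    fix \<omega> assume "\<omega> \<in> space M"
    hence "(\<lambda>k. ennreal (X k \<omega>)) \<longlonglongrightarrow> ennreal (Y \<omega>)" by (intro tendsto_ennrealI lim)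
    thus "ennreal (Y \<omega>) = liminf (\<lambda>k. ennreal (X k \<omega>))" by (intro lim_imp_Liminf[symmetric]) auto
  qed
  also have "\<dots> \<le> liminf (\<lambda>k. \<integral>\<^sup>+\<omega>. ennreal (X k \<omega>) \<partial>M)"
    by (intro nn_integral_liminf) auto
  also have "\<dots> = ennreal e"
    using int ex nonneg by (simp add: nn_integral_eq_integral Liminf_const)
  finally have fatou: "(\<integral>\<^sup>+\<omega>. ennreal (Y \<omega>) \<partial>M) \<le> ennreal e" .
  show Yint: "integrable M Y"
    using fatou Ynn by (intro integrableI_nonneg) (auto simp: less_top[symmetric] top_unique intro!: AE_I2 le_less_trans[OF fatou])
  have "ennreal (expectation Y) \<le> ennreal e"
    using fatou Yint Ynn by (subst (asm) nn_integral_eq_integral) (auto intro!: AE_I2)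
  hence upper: "expectation Y \<le> e" using e0 by simp
  have lower: "e - C / c \<le> expectation Y" if c: "c > 0" for c
  proof -
    have lm: "(\<lambda>k. expectation (\<lambda>\<omega>. min (X k \<omega>) c)) \<longlonglongrightarrow> expectation (\<lambda>\<omega>. min (Y \<omega>) c)"
      using c nonneg by (intro integral_dominated_convergence[where w="\<lambda>_. c"])
        (auto intro!: AE_I2 tendsto_min lim simp: abs_of_nonneg)
    have "e - C / c \<le> expectation (\<lambda>\<omega>. min (X k \<omega>) c)" for k
    proof -
      have "X k \<omega> - (X k \<omega>)\<^sup>2 / c \<le> min (X k \<omega>) c" for \<omega>
      proof (cases "X k \<omega> \<le> c")
        case False
        hence "X k \<omega> * c \<le> (X k \<omega>)\<^sup>2" using c by (simp add: power2_eq_square)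
        hence "X k \<omega> \<le> (X k \<omega>)\<^sup>2 / c" using c by (simp add: field_simps)
        thus ?thesis using False c by simp
      qed (use c in simp)
      hence "expectation (\<lambda>\<omega>. X k \<omega> - (X k \<omega>)\<^sup>2 / c) \<le> expectation (\<lambda>\<omega>. min (X k \<omega>) c)"
        using int int2 c nonneg by (intro integral_mono integrable_diff integrable_min) auto
      also have "expectation (\<lambda>\<omega>. X k \<omega> - (X k \<omega>)\<^sup>2 / c) = e - expectation (\<lambda>\<omega>. (X k \<omega>)\<^sup>2) / c"
        using int int2 ex by simp
      finally show ?thesis using ex2[of k] c by (smt (verit) divide_right_mono)
    qed
    hence "e - C / c \<le> expectation (\<lambda>\<omega>. min (Y \<omega>) c)"
      by (intro LIMSEQ_le_const[OF lm]) auto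
    also have "\<dots> \<le> expectation Y" using Yint by (intro integral_mono integrable_min) auto
    finally show ?thesis .
  qed
  have "e \<le> expectation Y"
  proof (rule LIMSEQ_le_const2)
    show "(\<lambda>n. e - C / real (Suc n)) \<longlonglongrightarrow> e"
      using tendsto_diff[OF tendsto_const[of e] tendsto_mult_right_zero[OF LIMSEQ_Suc[OF lim_inverse_n], of C]]
      by (simp add: field_simps)
  qed (use lower in auto)
  thus "expectation Y = e" using upper by simp
qed

section \<open>Brownian motion, its filtration, and independence of the past\<close>

locale brownian =
  fixes M :: "'a measure" and W :: "real \<Rightarrow> 'a \<Rightarrow> real"
  assumes bm: "brownian_motion M W"

sublocale brownian \<subseteq> prob_space M
  using bm by (simp add: brownian_motion_def)

context brownian
begin

abbreviation "aug \<equiv> bm_filt_aug M W"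
abbreviation "filt \<equiv> bm_filtration M W"

lemma W_meas [measurable]: "W t \<in> borel_measurable M"
  and W_0: "\<omega> \<in> space M \<Longrightarrow> W 0 \<omega> = 0"
  and W_cont: "\<omega> \<in> space M \<Longrightarrow> continuous_on {0..} (\<lambda>t. W t \<omega>)"
  and W_incr: "0 \<le> s \<Longrightarrow> s < t \<Longrightarrow>
        distributed M lborel (\<lambda>\<omega>. W t \<omega> - W s \<omega>) (normal_density 0 (sqrt (t - s)))"
  and W_indep: "sorted ts \<Longrightarrow> (\<And>t. t \<in> set ts \<Longrightarrow> 0 \<le> t) \<Longrightarrow>
        indep_vars (\<lambda>_. borel) (\<lambda>i \<omega>. W (ts ! Suc i) \<omega> - W (ts ! i) \<omega>) {..<length ts - 1}"
  using bm by (auto simp: brownian_motion_def)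

abbreviation (input) "aug_gen t \<equiv> {W s -` B \<inter> space M | s B. 0 \<le> s \<and> s \<le> t \<and> B \<in> sets borel} \<union> null_sets M"

lemma aug_gen_events: "aug_gen t \<subseteq> sets M"
  by (auto intro: measurable_sets)

lemma sets_aug: "sets (aug t) = sigma_sets (space M) (aug_gen t)"
  unfolding bm_filt_aug_def
  by (intro sets_measure_of order_trans[OF aug_gen_events sets.space_closed])

lemma space_aug [simp]: "space (aug t) = space M"
  unfolding bm_filt_aug_def
  by (intro space_measure_of order_trans[OF aug_gen_events sets.space_closed])

lemma aug_mono: "s \<le> t \<Longrightarrow> sets (aug s) \<subseteq> sets (aug t)"
  unfolding sets_aug by (intro sigma_sets_mono' Un_mono order_refl Collect_mono) (metis order_trans)

lemma aug_events: "sets (aug t) \<subseteq> sets M"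
  unfolding sets_aug using aug_gen_events by (intro sets.sigma_sets_subset) auto

lemma null_sets_aug: "N \<in> null_sets M \<Longrightarrow> N \<in> sets (aug t)"
  unfolding sets_aug by (auto intro: sigma_sets.Basic)

lemma W_meas_aug: "0 \<le> s \<Longrightarrow> s \<le> t \<Longrightarrow> W s \<in> borel_measurable (aug t)"
  by (rule measurableI) (auto simp: sets_aug intro!: sigma_sets.Basic)

lemma filt_gen: "{A. \<forall>u>t. A \<in> sets (aug u)} \<subseteq> Pow (space M)"
  using sets.sets_into_space[of _ "aug (t + 1)"] by (auto dest!: spec[of _ "t + 1"])

lemma space_filt [simp]: "space (filt t) = space M"
  unfolding bm_filtration_def by (intro space_measure_of filt_gen)

lemma filt_subset_aug: "t < u \<Longrightarrow> sets (filt t) \<subseteq> sets (aug u)"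
  unfolding bm_filtration_def
  by (subst sets_measure_of[OF filt_gen], subst space_aug[of u, symmetric], rule sets.sigma_sets_subset) auto

lemma in_filtI: "(\<And>u. t < u \<Longrightarrow> A \<in> sets (aug u)) \<Longrightarrow> A \<in> sets (filt t)"
  unfolding bm_filtration_def
  by (subst sets_measure_of[OF filt_gen]) (auto intro: sigma_sets.Basic)

text \<open>Independence is given only for increments along a finite grid of times. Adding
  \<open>0\<close> and \<open>u\<close> to \<open>J\<close> makes every \<open>W j\<close> a
  telescoping sum of grid increments starting from \<open>W 0 = 0\<close>, and makes the increment
  from \<open>u\<close> to \<open>v\<close> the last one of the grid extended by
  \<open>v\<close>.\<close>

lemma finite_past_indep_increment:
  assumes J: "finite J" "J \<subseteq> {0..u}" and uv: "0 \<le> u" "u < v"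
    and B: "\<And>j. j \<in> J \<Longrightarrow> B j \<in> sets borel" and D: "D \<in> sets borel"
  shows "prob ((space M \<inter> (\<Inter>j\<in>J. W j -` B j)) \<inter> ((\<lambda>\<omega>. W v \<omega> - W u \<omega>) -` D \<inter> space M)) =
    prob (space M \<inter> (\<Inter>j\<in>J. W j -` B j)) * prob ((\<lambda>\<omega>. W v \<omega> - W u \<omega>) -` D \<inter> space M)"
proof -
  define us where "us = sorted_list_of_set (J \<union> {0,u})"
  define ts where "ts = us @ [v]"
  define n where "n = length us"
  have us: "sorted us" "set us = J \<union> {0,u}" unfolding us_def using J(1) set_sorted_list_of_set[of "J \<union> {0,u}"]
    by (auto simp del: sorted_list_of_set_insert_remove set_sorted_list_of_set sorted_list_of_set.sorted_key_list_of_set_insert_remove sorted_list_of_set.set_sorted_key_list_of_set intro: sorted_list_of_set.sorted_sorted_key_list_of_set)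
  have n0: "n > 0" using us(2) by (cases us) (auto simp: n_def)
  have us0: "us ! 0 = 0"
  proof -
    obtain k where k: "k < n" "us ! k = 0" using us(2) by (metis UnCI insertI1 in_set_conv_nth n_def)
    have "us ! 0 \<le> us ! k" using us(1) k by (intro sorted_nth_mono) (auto simp: n_def)
    moreover have "us ! 0 \<in> J \<union> {0,u}" using n0 us(2) nth_mem[of 0 us] by (simp add: n_def)
    ultimately show ?thesis using k J uv by (auto dest: subsetD)
  qed
  have usn: "us ! (n - 1) = u"
  proof -
    obtain k where k: "k < n" "us ! k = u" using us(2) by (metis UnCI insertI1 insertI2 in_set_conv_nth n_def)
    have "us ! k \<le> us ! (n - 1)" using us(1) k by (intro sorted_nth_mono) (auto simp: n_def)
    moreover have "us ! (n - 1) \<in> J \<union> {0,u}" using n0 us(2) nth_mem[of "n - 1" us] by (simp add: n_def)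
    ultimately show ?thesis using k J uv by auto
  qed
  have tsn: "ts ! n = v" and tsk: "ts ! k = us ! k" if "k < n" for k
    using that by (auto simp: ts_def n_def nth_append)
  have "sorted ts" using us J uv by (auto simp: ts_def sorted_append)
  moreover have "0 \<le> t" if "t \<in> set ts" for t using that us J uv by (auto simp: ts_def)
  moreover have lts: "length ts - 1 = n" by (simp add: ts_def n_def)
  define X where "X = (\<lambda>i \<omega>. W (ts ! Suc i) \<omega> - W (ts ! i) \<omega>)"
  define E where "E = (\<lambda>i. {X i -` A \<inter> space M | A. A \<in> sets borel})"
  ultimately have "indep_vars (\<lambda>_. borel) X {..<n}"
    using W_indep[of ts] by (simp only: X_def lts)
  hence "indep_sets E {..<n}" by (simp add: indep_vars_def2 E_def)
  \<comment> \<open>The grid has \<open>n\<close> increments. Those of index below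
    \<open>n - 1\<close> end at time \<open>u\<close> or earlier; the one of index
    \<open>n - 1\<close> leads from \<open>u\<close> to \<open>v\<close>.\<close>
  moreover define I where "I = (\<lambda>b. if b then {..<n - 1} else {n - 1})"
  moreover have "(\<Union>b\<in>UNIV. I b) = {..<n}" using n0 by (auto simp: I_def UNIV_bool)
  ultimately have "indep_sets E (\<Union>b\<in>UNIV. I b)" by simp
  moreover have "Int_stable (E i)" for i
    unfolding Int_stable_def E_def
  proof safe
    fix A A' :: "real set" assume "A \<in> sets borel" "A' \<in> sets borel"
    thus "\<exists>C. (X i -` A \<inter> space M) \<inter> (X i -` A' \<inter> space M) = X i -` C \<inter> space M \<and> C \<in> sets borel"
      by (intro exI[of _ "A \<inter> A'"]) auto
  qed
  moreover have "disjoint_family_on I UNIV" by (auto simp: disjoint_family_on_def I_def)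
  ultimately have ind: "indep_sets (\<lambda>b. sigma_sets (space M) (\<Union>i\<in>I b. E i)) UNIV"
    by (rule indep_sets_collect_sigma)
  define N where "N = sigma (space M) (\<Union>i\<in>I True. E i)"
  have ESp: "(\<Union>i\<in>I b. E i) \<subseteq> Pow (space M)" for b by (auto simp: E_def)
  have spN [simp]: "space N = space M" and setsN: "sets N = sigma_sets (space M) (\<Union>i\<in>I True. E i)"
    unfolding N_def using ESp[of True] by (auto intro: space_measure_of sets_measure_of)
  have XN: "X i \<in> borel_measurable N" if "i < n - 1" for i
    using that by (intro measurableI) (auto simp: setsN E_def I_def intro!: sigma_sets.Basic)
  have WN: "W (us ! k) \<in> borel_measurable N" if "k \<le> n - 1" for k
    using that
  proof (induction k)
    case 0
    have "W (us ! 0) \<in> borel_measurable N \<longleftrightarrow> (\<lambda>_. 0 :: real) \<in> borel_measurable N"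
      unfolding us0 by (intro measurable_cong) (simp add: W_0)
    thus ?case by simp
  next
    case (Suc k)
    have "W (us ! Suc k) = (\<lambda>\<omega>. W (us ! k) \<omega> + X k \<omega>)"
      using Suc.prems by (simp add: X_def tsk)
    thus ?case using Suc XN[of k] by simp
  qed
  have WJ: "W j -` B j \<inter> space M \<in> sets N" if "j \<in> J" for j
  proof -
    have "j \<in> set us" using us(2) that by simp
    then obtain k where k: "k < n" "us ! k = j" unfolding in_set_conv_nth n_def by blast
    have "W j \<in> borel_measurable N" using WN[of k] k by simp
    from measurable_sets[OF this B[OF that]] show ?thesis by simp
  qed
  have "{\<omega> \<in> space N. \<forall>j\<in>J. \<omega> \<in> W j -` B j \<inter> space M} \<in> sets N"
    by (intro sets.sets_Collect_finite_All J) (use WJ sets.sets_into_space[OF WJ] in \<open>auto simp: Int_def conj_ac\<close>)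
  also have "{\<omega> \<in> space N. \<forall>j\<in>J. \<omega> \<in> W j -` B j \<inter> space M} = space M \<inter> (\<Inter>j\<in>J. W j -` B j)" by auto
  finally have P: "space M \<inter> (\<Inter>j\<in>J. W j -` B j) \<in> sigma_sets (space M) (\<Union>i\<in>I True. E i)"
    by (simp add: setsN)
  have "X (n - 1) = (\<lambda>\<omega>. W v \<omega> - W u \<omega>)"
    using n0 tsn tsk[of "n - 1"] usn by (simp add: X_def)
  hence Q: "(\<lambda>\<omega>. W v \<omega> - W u \<omega>) -` D \<inter> space M \<in> sigma_sets (space M) (\<Union>i\<in>I False. E i)"
    using D by (intro sigma_sets.Basic) (auto simp: I_def E_def)
  show ?thesis
    using indep_setsD[OF ind, of UNIV "case_bool (space M \<inter> (\<Inter>j\<in>J. W j -` B j)) ((\<lambda>\<omega>. W v \<omega> - W u \<omega>) -` D \<inter> space M)"] P Q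
    by (simp add: UNIV_bool ac_simps)
qed

text \<open>A \<pi>-system argument. Cylinder events together with the null sets are stable under
  intersection and generate every event of \<open>aug u\<close>; a null set satisfies the product
  formula with any event.\<close>

lemma past_indep_increment:
  assumes uv: "0 \<le> u" "u < v"
  shows "indep_set (sets (aug u))
    (sigma_sets (space M) {(\<lambda>\<omega>. W v \<omega> - W u \<omega>) -` D \<inter> space M | D. D \<in> sets borel})"
proof -
  define P where "P = {space M \<inter> (\<Inter>j\<in>J. W j -` B j) | J B. finite J \<and> J \<subseteq> {0..u} \<and> (\<forall>j\<in>J. B j \<in> sets borel)}"
  define Q where "Q = {(\<lambda>\<omega>. W v \<omega> - W u \<omega>) -` D \<inter> space M | D. D \<in> sets borel}"
  have Pev: "P \<subseteq> events"
  proof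
    fix A assume "A \<in> P"
    then obtain J B where A: "A = space M \<inter> (\<Inter>j\<in>J. W j -` B j)" "finite J" "\<forall>j\<in>J. B j \<in> sets borel"
      unfolding P_def by blast
    have "{\<omega> \<in> space M. \<forall>j\<in>J. \<omega> \<in> W j -` B j} \<in> events"
      by (intro sets.sets_Collect_finite_All A) (use A measurable_sets[OF W_meas] in \<open>auto simp: Int_def conj_commute\<close>)
    also have "{\<omega> \<in> space M. \<forall>j\<in>J. \<omega> \<in> W j -` B j} = A" using A by auto
    finally show "A \<in> events" .
  qed
  have Qev: "Q \<subseteq> events" by (auto simp: Q_def)
  have Pint: "A \<inter> A' \<in> P" if AA: "A \<in> P" "A' \<in> P" for A A'
  proof -
    obtain J B where A: "A = space M \<inter> (\<Inter>j\<in>J. W j -` B j)" "finite J" "J \<subseteq> {0..u}" "\<forall>j\<in>J. B j \<in> sets borel"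
      using AA unfolding P_def by blast
    obtain J' B' where A': "A' = space M \<inter> (\<Inter>j\<in>J'. W j -` B' j)" "finite J'" "J' \<subseteq> {0..u}" "\<forall>j\<in>J'. B' j \<in> sets borel"
      using AA unfolding P_def by blast
    define B'' where "B'' = (\<lambda>j. (if j \<in> J then B j else UNIV) \<inter> (if j \<in> J' then B' j else UNIV))"
    have "A \<inter> A' = space M \<inter> (\<Inter>j\<in>J \<union> J'. W j -` B'' j)"
    proof -
      have "\<omega> \<in> A \<inter> A' \<longleftrightarrow> \<omega> \<in> space M \<inter> (\<Inter>j\<in>J \<union> J'. W j -` B'' j)" for \<omega>
      proof -
        have "\<omega> \<in> A \<inter> A' \<longleftrightarrow> \<omega> \<in> space M \<and> (\<forall>j\<in>J. W j \<omega> \<in> B j) \<and> (\<forall>j\<in>J'. W j \<omega> \<in> B' j)"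
          unfolding A(1) A'(1) by simp blast
        also have "\<dots> \<longleftrightarrow> \<omega> \<in> space M \<and> (\<forall>j\<in>J \<union> J'. W j \<omega> \<in> B'' j)"
          unfolding B''_def by (simp, blast)
        finally show ?thesis by simp
      qed
      thus ?thesis by blast
    qed
    moreover have "\<forall>j\<in>J \<union> J'. B'' j \<in> sets borel" using A A' by (auto simp: B''_def)
    moreover have "finite (J \<union> J')" "J \<union> J' \<subseteq> {0..u}" using A A' by auto
    ultimately show ?thesis unfolding P_def by (intro CollectI exI conjI)
  qed
  have null_Int: "A \<inter> A' \<in> null_sets M" if "A \<in> null_sets M" "A' \<in> events" for A A'
    using null_set_Int2[OF that(1,2)] by (simp add: Int_commute)
  have null_Int': "A' \<inter> A \<in> null_sets M" if "A \<in> null_sets M" "A' \<in> events" for A A'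
    using null_Int[OF that] by (simp add: Int_commute)
  have "indep_set (P \<union> null_sets M) Q"
  proof (rule indep_setI)
    fix A D assume AD: "A \<in> P \<union> null_sets M" "D \<in> Q"
    show "prob (A \<inter> D) = prob A * prob D"
    proof (cases "A \<in> null_sets M")
      case True
      hence "A \<inter> D \<in> null_sets M" using AD Qev by (intro null_Int) auto
      thus ?thesis using True by (auto simp: null_sets_def measure_def)
    next
      case False
      thus ?thesis using AD finite_past_indep_increment[OF _ _ uv] by (auto simp: P_def Q_def)
    qed
  qed (use Pev Qev in auto)
  moreover have "Int_stable (P \<union> null_sets M)"
    unfolding Int_stable_def using Pint Pev null_Int null_Int' by blast
  moreover have "Int_stable Q"
    unfolding Int_stable_def Q_def
  proof safe
    fix A A' :: "real set" assume "A \<in> sets borel" "A' \<in> sets borel"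
    thus "\<exists>C. ((\<lambda>\<omega>. W v \<omega> - W u \<omega>) -` A \<inter> space M) \<inter> ((\<lambda>\<omega>. W v \<omega> - W u \<omega>) -` A' \<inter> space M)
        = (\<lambda>\<omega>. W v \<omega> - W u \<omega>) -` C \<inter> space M \<and> C \<in> sets borel"
      by (intro exI[of _ "A \<inter> A'"]) auto
  qed
  ultimately have "indep_set (sigma_sets (space M) (P \<union> null_sets M)) (sigma_sets (space M) Q)"
    by (rule indep_set_sigma_sets)
  moreover have "sets (aug u) \<subseteq> sigma_sets (space M) (P \<union> null_sets M)"
    unfolding sets_aug
  proof (rule sigma_sets_mono')
    have "W s -` B \<inter> space M \<in> P" if "0 \<le> s" "s \<le> u" "B \<in> sets borel" for s and B :: "real set"
      unfolding P_def using that by (intro CollectI exI[of _ "{s}"] exI[of _ "\<lambda>_. B"]) auto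
    thus "aug_gen u \<subseteq> P \<union> null_sets M" by blast
  qed
  ultimately show ?thesis unfolding indep_sets2_eq Q_def by blast
qed

section \<open>The exponential martingales of Brownian motion\<close>

definition Z :: "real \<Rightarrow> real \<Rightarrow> 'a \<Rightarrow> real" where
  "Z \<theta> t \<omega> = exp (\<theta> * W t \<omega> - \<theta>\<^sup>2 * t / 2)"

lemma Z_meas [measurable]: "Z \<theta> t \<in> borel_measurable M"
  unfolding Z_def[abs_def] by measurable

lemma Z_pos [simp]: "0 < Z \<theta> t \<omega>" and Z_nonneg [simp]: "0 \<le> Z \<theta> t \<omega>"
  by (auto simp: Z_def)

lemma increment_mgf:
  assumes "0 \<le> u" "u < v"
  shows "integrable M (\<lambda>\<omega>. exp (\<theta> * (W v \<omega> - W u \<omega>)))"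
    and "expectation (\<lambda>\<omega>. exp (\<theta> * (W v \<omega> - W u \<omega>))) = exp (\<theta>\<^sup>2 * (v - u) / 2)"
proof -
  have s: "sqrt (v - u) > 0" "(sqrt (v - u))\<^sup>2 = v - u" using assms by auto
  note d = W_incr[OF assms]
  show "integrable M (\<lambda>\<omega>. exp (\<theta> * (W v \<omega> - W u \<omega>)))"
    using distributed_integrable[OF d, of "\<lambda>x. exp (\<theta> * x)"] normal_mgf(1)[OF s(1)] by simp
  show "expectation (\<lambda>\<omega>. exp (\<theta> * (W v \<omega> - W u \<omega>))) = exp (\<theta>\<^sup>2 * (v - u) / 2)"
    using distributed_integral[OF d, of "\<lambda>x. exp (\<theta> * x)"] normal_mgf(2)[OF s(1), of \<theta>] s by simp
qed

lemma Z_integrable: "0 \<le> t \<Longrightarrow> integrable M (Z \<theta> t)"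
  and Z_expectation: "0 \<le> t \<Longrightarrow> expectation (Z \<theta> t) = 1"
proof -
  assume t: "0 \<le> t"
  have "integrable M (Z \<theta> t) \<and> expectation (Z \<theta> t) = 1"
  \<comment> \<open>The law of an increment is specified only for distinct times, so the degenerate
    time \<open>0\<close> is treated by hand.\<close>
  proof (cases "t = 0")
    case True
    have c: "Z \<theta> t \<omega> = 1" if "\<omega> \<in> space M" for \<omega> using that True by (simp add: Z_def W_0)
    have "integrable M (Z \<theta> t) \<longleftrightarrow> integrable M (\<lambda>_. 1::real)"
      by (rule Bochner_Integration.integrable_cong[OF refl c])
    moreover have "expectation (Z \<theta> t) = expectation (\<lambda>_. 1)"
      by (rule Bochner_Integration.integral_cong[OF refl c])
    ultimately show ?thesis by (simp add: prob_space)
  next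
    case False
    hence t: "0 < t" using t by simp
    have c: "Z \<theta> t \<omega> = exp (- (\<theta>\<^sup>2 * t / 2)) * exp (\<theta> * (W t \<omega> - W 0 \<omega>))" if "\<omega> \<in> space M" for \<omega>
      using that by (simp add: Z_def W_0 algebra_simps flip: exp_add)
    have "integrable M (Z \<theta> t) \<longleftrightarrow> integrable M (\<lambda>\<omega>. exp (- (\<theta>\<^sup>2 * t / 2)) * exp (\<theta> * (W t \<omega> - W 0 \<omega>)))"
      by (rule Bochner_Integration.integrable_cong[OF refl c])
    moreover have "expectation (Z \<theta> t) = expectation (\<lambda>\<omega>. exp (- (\<theta>\<^sup>2 * t / 2)) * exp (\<theta> * (W t \<omega> - W 0 \<omega>)))"
      by (rule Bochner_Integration.integral_cong[OF refl c])
    ultimately show ?thesis using increment_mgf[of 0 t \<theta>] t by (simp add: exp_minus)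
  qed
  thus "integrable M (Z \<theta> t)" "expectation (Z \<theta> t) = 1" by auto
qed

text \<open>The quotient of \<open>Z\<close> at time \<open>v\<close> and at time \<open>u\<close>
  is a function of the increment from \<open>u\<close> to \<open>v\<close> alone; it is independent
  of \<open>aug u\<close> and has mean \<open>1\<close>.\<close>

lemma Z_martingale:
  assumes uv: "0 \<le> u" "u \<le> v" and A: "A \<in> sets (aug u)"
  shows "expectation (\<lambda>\<omega>. indicator A \<omega> * Z \<theta> v \<omega>) = expectation (\<lambda>\<omega>. indicator A \<omega> * Z \<theta> u \<omega>)"
proof (cases "u = v")
  case False
  hence lt: "u < v" using uv by simp
  define X where "X = (\<lambda>\<omega>. indicator A \<omega> * Z \<theta> u \<omega>)"
  define Y where "Y = (\<lambda>\<omega>. W v \<omega> - W u \<omega>)"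
  have AM: "A \<in> events" using A aug_events by auto
  have XG: "X \<in> borel_measurable (aug u)"
    unfolding X_def Z_def using A W_meas_aug[of u u] uv by measurable
  have XM: "X \<in> borel_measurable M" unfolding X_def using AM by measurable
  have "indep_var borel X borel Y"
    unfolding indep_var_eq
  proof (intro conjI)
    have "sigma_sets (space M) {X -` B \<inter> space M | B. B \<in> sets borel} \<subseteq> sets (aug u)"
      using measurable_sets[OF XG] by (subst space_aug[of u, symmetric], intro sets.sigma_sets_subset) auto
    thus "indep_set (sigma_sets (space M) {X -` B \<inter> space M |B. B \<in> sets borel})
       (sigma_sets (space M) {Y -` B \<inter> space M |B. B \<in> sets borel})"
      using past_indep_increment[OF uv(1) lt] unfolding indep_sets2_eq Y_def by blast
  qed (use XM in \<open>auto simp: Y_def\<close>)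
  hence ind: "indep_var borel (id \<circ> X) borel ((\<lambda>y. exp (\<theta> * y)) \<circ> Y)"
    by (rule indep_var_compose) auto
  have Xint: "integrable M X"
    unfolding X_def using integrable_mult_indicator[OF AM Z_integrable[OF uv(1), of \<theta>]] by simp
  have "expectation (\<lambda>\<omega>. indicator A \<omega> * Z \<theta> v \<omega>) = expectation (\<lambda>\<omega>. exp (- (\<theta>\<^sup>2 * (v - u) / 2)) * (X \<omega> * exp (\<theta> * Y \<omega>)))"
    by (intro Bochner_Integration.integral_cong)
      (auto simp: X_def Y_def Z_def indicator_def algebra_simps diff_divide_distrib simp flip: exp_add)
  also have "\<dots> = exp (- (\<theta>\<^sup>2 * (v - u) / 2)) * (expectation X * expectation (\<lambda>\<omega>. exp (\<theta> * Y \<omega>)))"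
    using indep_var_lebesgue_integral[OF ind] Xint increment_mgf(1)[OF uv(1) lt, of \<theta>]
    by (simp add: comp_def Y_def)
  also have "\<dots> = expectation X"
    using increment_mgf(2)[OF uv(1) lt, of \<theta>] by (simp add: Y_def flip: exp_add)
  finally show ?thesis by (simp add: X_def)
qed simp

text \<open>The first point of the grid of mesh \<open>1 / 2 ^ k\<close> strictly after
  \<open>t\<close>, even if \<open>t\<close> itself lies on the grid. The strict inequality pays for
  right-continuity: a stopping time of \<open>filt\<close> rounded up in this way is one for
  \<open>aug\<close>, where the martingale property is available.\<close>

definition dyad :: "nat \<Rightarrow> real \<Rightarrow> real" where
  "dyad k t = (of_int \<lfloor>2 ^ k * t\<rfloor> + 1) / 2 ^ k"

lemma dyad_gt: "t < dyad k t" and dyad_le: "dyad k t \<le> t + 1 / 2 ^ k"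
proof -
  have "2 ^ k * t < of_int \<lfloor>2 ^ k * t\<rfloor> + 1" "of_int \<lfloor>2 ^ k * t\<rfloor> \<le> 2 ^ k * t" by linarith+
  thus "t < dyad k t" "dyad k t \<le> t + 1 / 2 ^ k" by (auto simp: dyad_def field_simps)
qed

lemma dyad_lim: "(\<lambda>k. dyad k t) \<longlonglongrightarrow> t"
proof (rule tendsto_sandwich[OF _ _ tendsto_const])
  show "(\<lambda>k. t + 1 / 2 ^ k) \<longlonglongrightarrow> t"
    using tendsto_add[OF tendsto_const[of t] LIMSEQ_inverse_realpow_zero[of 2]]
    by (simp add: inverse_eq_divide)
qed (auto intro!: always_eventually dyad_le less_imp_le[OF dyad_gt])

lemma W_dyad_lim:
  assumes "\<omega> \<in> space M" "0 \<le> t"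
  shows "(\<lambda>k. W (dyad k t) \<omega>) \<longlonglongrightarrow> W t \<omega>"
proof -
  have "0 \<le> dyad k t" for k using assms(2) dyad_gt[of t k] by linarith
  thus ?thesis using assms
    by (intro continuous_on_tendsto_compose[OF W_cont dyad_lim]) auto
qed

text \<open>At a dyadic approximation of \<open>T\<close> only countably many times occur, so
  measurability at fixed times suffices there; path continuity carries it to the limit. Continuity
  holds on nonnegative times only, hence \<open>max 0\<close>. The map \<open>F\<close> lets the
  sample point be either coordinate of a product space.\<close>

lemma W_joint_meas:
  assumes [measurable]: "T \<in> borel_measurable N" "F \<in> measurable N M"
  shows "(\<lambda>x. W (max 0 (T x)) (F x)) \<in> borel_measurable N"
proof (rule borel_measurable_LIMSEQ_real)
  fix x assume "x \<in> space N"
  thus "(\<lambda>k. W (dyad k (max 0 (T x))) (F x)) \<longlonglongrightarrow> W (max 0 (T x)) (F x)"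
    using measurable_space[OF assms(2)] by (intro W_dyad_lim) auto
next
  fix k
  have "(\<lambda>x. (\<lambda>i::int. W ((of_int i + 1) / 2 ^ k) (F x)) \<lfloor>2 ^ k * max 0 (T x)\<rfloor>) \<in> borel_measurable N"
    by (rule measurable_compose_countable) measurable
  thus "(\<lambda>x. W (dyad k (max 0 (T x))) (F x)) \<in> borel_measurable N" by (simp add: dyad_def)
qed

text \<open>Right-continuity costs only an instant: each event that \<open>\<tau>\<close> is at most
  \<open>t - 1 / real (Suc n)\<close> already belongs to \<open>aug t\<close>, and these events
  exhaust \<open>\<tau> < t\<close>.\<close>

lemma stopping_less:
  assumes "stopping_time filt \<tau>"
  shows "{\<omega> \<in> space M. \<tau> \<omega> < t} \<in> sets (aug t)"
proof -
  have "{\<omega> \<in> space M. \<tau> \<omega> \<le> t - 1 / real (Suc n)} \<in> sets (aug t)" for n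
    using assms[unfolded stopping_time_def, rule_format, of "t - 1 / real (Suc n)"]
      filt_subset_aug[of "t - 1 / real (Suc n)" t]
    by (auto simp: pred_def)
  hence "(\<Union>n. {\<omega> \<in> space M. \<tau> \<omega> \<le> t - 1 / real (Suc n)}) \<in> sets (aug t)" by blast
  also have "(\<Union>n. {\<omega> \<in> space M. \<tau> \<omega> \<le> t - 1 / real (Suc n)}) = {\<omega> \<in> space M. \<tau> \<omega> < t}"
  proof safe
    fix \<omega> n assume "\<tau> \<omega> \<le> t - 1 / real (Suc n)"
    moreover have "0 < 1 / real (Suc n)" by simp
    ultimately show "\<tau> \<omega> < t" by linarith
  next
    fix \<omega> assume "\<omega> \<in> space M" "\<tau> \<omega> < t"
    then obtain n where "1 / real (Suc n) < t - \<tau> \<omega>" using nat_approx_posE[of "t - \<tau> \<omega>"] by auto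
    thus "\<omega> \<in> (\<Union>n. {\<omega> \<in> space M. \<tau> \<omega> \<le> t - 1 / real (Suc n)})"
      using \<open>\<omega> \<in> space M\<close> by (auto intro!: exI[of _ n])
  qed
  finally show ?thesis .
qed

lemma stopping_meas:
  assumes "stopping_time filt \<tau>"
  shows "\<tau> \<in> borel_measurable M"
  unfolding borel_measurable_iff_less
  using stopping_less[OF assms] aug_events by blast

text \<open>The rounded time takes finitely many values, and the event \<open>A j\<close> that it
  equals \<open>tj j\<close> is known at that time. The martingale property moves each piece to the
  common final time \<open>tj N\<close>, where the pieces recombine to \<open>Z\<close> at a fixed
  time.\<close>

lemma optional_stopping_dyadic:
  assumes st: "stopping_time filt \<tau>" and bd: "\<And>\<omega>. \<omega> \<in> space M \<Longrightarrow> 0 \<le> \<tau> \<omega> \<and> \<tau> \<omega> \<le> real T"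
  shows "integrable M (\<lambda>\<omega>. Z \<theta> (dyad k (\<tau> \<omega>)) \<omega>)"
    and "expectation (\<lambda>\<omega>. Z \<theta> (dyad k (\<tau> \<omega>)) \<omega>) = 1"
proof -
  \<comment> \<open>The \<open>+ 1\<close> accounts for \<open>\<tau> = T\<close>, which is rounded
    up to the grid point after \<open>T\<close>.\<close>
  define N where "N = 2 ^ k * T + 1"
  define A where "A = (\<lambda>j. {\<omega> \<in> space M. nat (\<lfloor>2 ^ k * \<tau> \<omega>\<rfloor> + 1) = j})"
  define tj where "tj = (\<lambda>j. real j / 2 ^ k)"
  have Aeq: "A j = {\<omega> \<in> space M. \<tau> \<omega> < tj j} - {\<omega> \<in> space M. \<tau> \<omega> < tj (j - 1)}" if "j \<ge> 1" for j
  proof -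
    have "nat (\<lfloor>2 ^ k * \<tau> \<omega>\<rfloor> + 1) = j \<longleftrightarrow> \<tau> \<omega> < tj j \<and> \<not> \<tau> \<omega> < tj (j - 1)" if "\<omega> \<in> space M" for \<omega>
    proof -
      have "nat (\<lfloor>2 ^ k * \<tau> \<omega>\<rfloor> + 1) = j \<longleftrightarrow> \<lfloor>2 ^ k * \<tau> \<omega>\<rfloor> = int j - 1"
        using bd[OF that] by auto
      also have "\<dots> \<longleftrightarrow> real (j - 1) \<le> 2 ^ k * \<tau> \<omega> \<and> 2 ^ k * \<tau> \<omega> < real j"
        unfolding floor_eq_iff using \<open>j \<ge> 1\<close> by (auto simp: of_nat_diff)
      also have "\<dots> \<longleftrightarrow> \<tau> \<omega> < tj j \<and> \<not> \<tau> \<omega> < tj (j - 1)"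
        by (auto simp: tj_def field_simps not_less)
      finally show ?thesis .
    qed
    thus ?thesis by (auto simp: A_def)
  qed
  have Aaug: "A j \<in> sets (aug (tj j))" if "j \<ge> 1" for j
    unfolding Aeq[OF that]
    using aug_mono[of "tj (j - 1)" "tj j"] stopping_less[OF st]
    by (intro sets.Diff) (auto simp: tj_def divide_right_mono)
  have AM: "A j \<in> events" if "j \<ge> 1" for j using Aaug[OF that] aug_events by auto
  have part: "\<exists>j\<in>{1..N}. \<omega> \<in> A j" if "\<omega> \<in> space M" for \<omega>
  proof -
    have "2 ^ k * \<tau> \<omega> \<le> 2 ^ k * real T" using bd[OF that] by simp
    hence "\<lfloor>2 ^ k * \<tau> \<omega>\<rfloor> \<le> \<lfloor>2 ^ k * real T\<rfloor>" by (rule floor_mono)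
    also have "2 ^ k * real T = real_of_int (2 ^ k * int T)" by simp
    hence "\<lfloor>2 ^ k * real T\<rfloor> = 2 ^ k * int T" by linarith
    finally have "nat (\<lfloor>2 ^ k * \<tau> \<omega>\<rfloor> + 1) \<le> N" unfolding N_def by (simp add: nat_le_iff)
    moreover have "0 \<le> \<lfloor>2 ^ k * \<tau> \<omega>\<rfloor>" using bd[OF that] by simp
    moreover have "1 \<le> nat (\<lfloor>2 ^ k * \<tau> \<omega>\<rfloor> + 1)" using \<open>0 \<le> \<lfloor>2 ^ k * \<tau> \<omega>\<rfloor>\<close> by linarith
    ultimately have "nat (\<lfloor>2 ^ k * \<tau> \<omega>\<rfloor> + 1) \<in> {1..N}" unfolding atLeastAtMost_iff by blast
    thus ?thesis by (rule rev_bexI) (simp add: A_def that)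
  qed
  have disj: "\<omega> \<notin> A i" if "\<omega> \<in> A j" "i \<noteq> j" for \<omega> i j using that by (auto simp: A_def)
  have split: "g (if \<omega> \<in> space M then nat (\<lfloor>2 ^ k * \<tau> \<omega>\<rfloor> + 1) else 0) = (\<Sum>j\<in>{1..N}. indicator (A j) \<omega> * g j)"
    if om: "\<omega> \<in> space M" for \<omega> and g :: "nat \<Rightarrow> real"
  proof -
    obtain j where j: "j \<in> {1..N}" "\<omega> \<in> A j" using part[OF om] by blast
    have "(\<Sum>i\<in>{1..N}. indicator (A i) \<omega> * g i) = (\<Sum>i\<in>{j}. indicator (A i) \<omega> * g i)"
      using j(1) disj[OF j(2)] by (intro sum.mono_neutral_right) (auto simp: indicator_def)
    also have "\<dots> = g j" using j by simp
    finally show ?thesis using j(2) om by (simp only: A_def mem_Collect_eq if_True)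
  qed
  have Zsplit: "Z \<theta> (dyad k (\<tau> \<omega>)) \<omega> = (\<Sum>j\<in>{1..N}. indicator (A j) \<omega> * Z \<theta> (tj j) \<omega>)" if "\<omega> \<in> space M" for \<omega>
  proof -
    have "0 \<le> \<lfloor>2 ^ k * \<tau> \<omega>\<rfloor>" using bd[OF that] by simp
    hence "tj (nat (\<lfloor>2 ^ k * \<tau> \<omega>\<rfloor> + 1)) = dyad k (\<tau> \<omega>)"
      by (simp add: tj_def dyad_def)
    thus ?thesis using split[OF that, of "\<lambda>j. Z \<theta> (tj j) \<omega>"] that by simp
  qed
  have one: "1 = (\<Sum>j\<in>{1..N}. indicator (A j) \<omega> :: real)" if "\<omega> \<in> space M" for \<omega>
    using split[OF that, of "\<lambda>_. 1"] by simp
  have int: "integrable M (\<lambda>\<omega>. indicator (A j) \<omega> * Z \<theta> t \<omega>)" if "j \<ge> 1" "t \<ge> 0" for j t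
    using integrable_mult_indicator[OF AM[OF that(1)] Z_integrable[OF that(2), of \<theta>]] by simp
  have tj0: "tj j \<ge> 0" for j by (simp add: tj_def)
  have "integrable M (\<lambda>\<omega>. \<Sum>j\<in>{1..N}. indicator (A j) \<omega> * Z \<theta> (tj j) \<omega>)"
    using int tj0 by (intro Bochner_Integration.integrable_sum) auto
  moreover have "integrable M (\<lambda>\<omega>. Z \<theta> (dyad k (\<tau> \<omega>)) \<omega>) \<longleftrightarrow>
      integrable M (\<lambda>\<omega>. \<Sum>j\<in>{1..N}. indicator (A j) \<omega> * Z \<theta> (tj j) \<omega>)"
    by (intro Bochner_Integration.integrable_cong Zsplit refl)
  ultimately show "integrable M (\<lambda>\<omega>. Z \<theta> (dyad k (\<tau> \<omega>)) \<omega>)" by blast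
  have "expectation (\<lambda>\<omega>. Z \<theta> (dyad k (\<tau> \<omega>)) \<omega>) = expectation (\<lambda>\<omega>. \<Sum>j\<in>{1..N}. indicator (A j) \<omega> * Z \<theta> (tj j) \<omega>)"
    by (intro Bochner_Integration.integral_cong Zsplit refl)
  also have "\<dots> = (\<Sum>j\<in>{1..N}. expectation (\<lambda>\<omega>. indicator (A j) \<omega> * Z \<theta> (tj j) \<omega>))"
    using int tj0 by (intro Bochner_Integration.integral_sum) auto
  also have "\<dots> = (\<Sum>j\<in>{1..N}. expectation (\<lambda>\<omega>. indicator (A j) \<omega> * Z \<theta> (tj N) \<omega>))"
    using Aaug tj0 by (intro sum.cong refl Z_martingale[symmetric]) (auto simp: tj_def divide_right_mono)
  also have "\<dots> = expectation (\<lambda>\<omega>. \<Sum>j\<in>{1..N}. indicator (A j) \<omega> * Z \<theta> (tj N) \<omega>)"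
    using int tj0 by (intro Bochner_Integration.integral_sum[symmetric]) auto
  also have "\<dots> = expectation (Z \<theta> (tj N))"
    by (intro Bochner_Integration.integral_cong refl) (simp add: one[symmetric] del: One_nat_def flip: sum_distrib_right)
  also have "\<dots> = 1" using tj0 by (rule Z_expectation)
  finally show "expectation (\<lambda>\<omega>. Z \<theta> (dyad k (\<tau> \<omega>)) \<omega>) = 1" .
qed

lemma Z_square: "(Z \<theta> t \<omega>)\<^sup>2 = exp (\<theta>\<^sup>2 * t) * Z (2 * \<theta>) t \<omega>"
  by (simp add: Z_def power2_eq_square algebra_simps flip: exp_add)

text \<open>The limit along dyadic times rests on a second moment bound. The square of
  \<open>Z\<close> with parameter \<open>\<theta>\<close> is, up to a factor bounded on bounded
  times, \<open>Z\<close> with parameter \<open>2 * \<theta>\<close>, whose mean at the rounded time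
  is again \<open>1\<close>.\<close>

lemma optional_stopping:
  assumes st: "stopping_time filt \<tau>" and bd: "\<And>\<omega>. \<omega> \<in> space M \<Longrightarrow> 0 \<le> \<tau> \<omega> \<and> \<tau> \<omega> \<le> T"
  shows "integrable M (\<lambda>\<omega>. Z \<theta> (\<tau> \<omega>) \<omega>)" and "expectation (\<lambda>\<omega>. Z \<theta> (\<tau> \<omega>) \<omega>) = 1"
proof -
  obtain T' :: nat where "T \<le> real T'" using real_arch_simple by blast
  hence bd': "0 \<le> \<tau> \<omega> \<and> \<tau> \<omega> \<le> real T'" if "\<omega> \<in> space M" for \<omega> using bd[OF that] by linarith
  define X where "X = (\<lambda>k \<omega>. Z \<theta> (dyad k (\<tau> \<omega>)) \<omega>)"
  define C where "C = exp (\<theta>\<^sup>2 * (real T' + 1))"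
  have [measurable]: "X k \<in> borel_measurable M" for k
    unfolding X_def using optional_stopping_dyadic(1)[OF st bd', of \<theta> k] by auto
  have X2: "(X k \<omega>)\<^sup>2 \<le> C * Z (2 * \<theta>) (dyad k (\<tau> \<omega>)) \<omega>" if "\<omega> \<in> space M" for k \<omega>
  proof -
    have "(1::real) / 2 ^ k \<le> 1" by simp
    hence "dyad k (\<tau> \<omega>) \<le> real T' + 1"
      using dyad_le[of k "\<tau> \<omega>"] bd'[OF that] by linarith
    hence "exp (\<theta>\<^sup>2 * dyad k (\<tau> \<omega>)) \<le> C" by (simp add: C_def mult_left_mono)
    thus ?thesis unfolding X_def Z_square by (intro mult_right_mono) auto
  qed
  have int2: "integrable M (\<lambda>\<omega>. (X k \<omega>)\<^sup>2)" for k
  proof (rule Bochner_Integration.integrable_bound)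
    show "integrable M (\<lambda>\<omega>. C * Z (2 * \<theta>) (dyad k (\<tau> \<omega>)) \<omega>)"
      using optional_stopping_dyadic(1)[OF st bd', of "2 * \<theta>" k] by simp
  qed (use X2 in \<open>auto intro!: AE_I2 simp: C_def\<close>)
  have ex2: "expectation (\<lambda>\<omega>. (X k \<omega>)\<^sup>2) \<le> C" for k
  proof -
    have "expectation (\<lambda>\<omega>. (X k \<omega>)\<^sup>2) \<le> expectation (\<lambda>\<omega>. C * Z (2 * \<theta>) (dyad k (\<tau> \<omega>)) \<omega>)"
      using optional_stopping_dyadic(1)[OF st bd', of "2 * \<theta>" k] X2
      by (intro integral_mono int2) auto
    also have "\<dots> = C" using optional_stopping_dyadic(2)[OF st bd', of "2 * \<theta>" k] by simp
    finally show ?thesis .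
  qed
  have lim: "(\<lambda>k. X k \<omega>) \<longlonglongrightarrow> Z \<theta> (\<tau> \<omega>) \<omega>" if "\<omega> \<in> space M" for \<omega>
    unfolding X_def Z_def using bd[OF that] by (intro tendsto_intros W_dyad_lim dyad_lim that) auto
  have "0 \<le> X k \<omega>" for k \<omega> by (simp add: X_def)
  moreover have "integrable M (X k)" "expectation (X k) = 1" for k
    unfolding X_def using optional_stopping_dyadic[OF st bd'] by auto
  ultimately show "integrable M (\<lambda>\<omega>. Z \<theta> (\<tau> \<omega>) \<omega>)" "expectation (\<lambda>\<omega>. Z \<theta> (\<tau> \<omega>) \<omega>) = 1"
    using expectation_limit_L2_bounded[OF lim _ _ _ int2 ex2, of 1] by auto
qed

end

section \<open>Dynkin's formula for exponentials\<close>

context brownian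
begin

lemma stopping_value_meas:
  assumes "\<tau> \<in> borel_measurable M" "\<And>\<omega>. \<omega> \<in> space M \<Longrightarrow> 0 \<le> \<tau> \<omega>"
  shows "(\<lambda>\<omega>. W (\<tau> \<omega>) \<omega>) \<in> borel_measurable M"
proof -
  have "(\<lambda>\<omega>. W (max 0 (\<tau> \<omega>)) \<omega>) \<in> borel_measurable M"
    using W_joint_meas[OF assms(1) measurable_ident] by simp
  moreover have "(\<lambda>\<omega>. W (max 0 (\<tau> \<omega>)) \<omega>) \<in> borel_measurable M \<longleftrightarrow> (\<lambda>\<omega>. W (\<tau> \<omega>) \<omega>) \<in> borel_measurable M"
    using assms(2) by (intro measurable_cong) (simp add: max_def)
  ultimately show ?thesis by blast
qed

lemma stopping_min:
  assumes "stopping_time filt \<tau>"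
  shows "stopping_time filt (\<lambda>\<omega>. min (\<tau> \<omega>) c)"
  using assms by (intro stopping_time_min stopping_time_const)

text \<open>\<open>Z\<close> has mean \<open>1\<close> both at \<open>min \<tau> u\<close> and at
  \<open>\<tau>\<close>. The two values agree where \<open>\<tau> < u\<close>, so equality of the
  means is exactly the assertion about the remaining event.\<close>

lemma Z_after:
  assumes st: "stopping_time filt \<tau>" and bd: "\<And>\<omega>. \<omega> \<in> space M \<Longrightarrow> 0 \<le> \<tau> \<omega> \<and> \<tau> \<omega> \<le> T"
    and u: "0 \<le> u"
  shows "expectation (\<lambda>\<omega>. indicator {..\<tau> \<omega>} u * Z \<theta> u \<omega>) = expectation (\<lambda>\<omega>. indicator {..\<tau> \<omega>} u * Z \<theta> (\<tau> \<omega>) \<omega>)"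
    and "integrable M (\<lambda>\<omega>. indicator {..\<tau> \<omega>} u * Z \<theta> u \<omega>)"
    and "integrable M (\<lambda>\<omega>. indicator {..\<tau> \<omega>} u * Z \<theta> (\<tau> \<omega>) \<omega>)"
proof -
  have [measurable]: "\<tau> \<in> borel_measurable M" by (rule stopping_meas[OF st])
  note Zt = optional_stopping[OF st bd, of \<theta>]
  have st': "stopping_time filt (\<lambda>\<omega>. min (\<tau> \<omega>) u)" by (rule stopping_min[OF st])
  have bd': "0 \<le> min (\<tau> \<omega>) u \<and> min (\<tau> \<omega>) u \<le> u" if "\<omega> \<in> space M" for \<omega> using bd[OF that] u by auto
  note Zm = optional_stopping[OF st' bd', of \<theta>]
  have A: "{\<omega> \<in> space M. u \<le> \<tau> \<omega>} \<in> events" by measurable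
  have ind: "indicator {..\<tau> \<omega>} u = (indicator {\<omega> \<in> space M. u \<le> \<tau> \<omega>} \<omega> :: real)" if "\<omega> \<in> space M" for \<omega>
    using that by (auto simp: indicator_def)
  show i1: "integrable M (\<lambda>\<omega>. indicator {..\<tau> \<omega>} u * Z \<theta> u \<omega>)"
    using integrable_mult_indicator[OF A Z_integrable[OF u, of \<theta>]]
    by (subst Bochner_Integration.integrable_cong[OF refl, of _ _ "\<lambda>\<omega>. indicator {\<omega> \<in> space M. u \<le> \<tau> \<omega>} \<omega> * Z \<theta> u \<omega>"]) (auto simp: ind)
  show i2: "integrable M (\<lambda>\<omega>. indicator {..\<tau> \<omega>} u * Z \<theta> (\<tau> \<omega>) \<omega>)"
    using integrable_mult_indicator[OF A Zt(1)]
    by (subst Bochner_Integration.integrable_cong[OF refl, of _ _ "\<lambda>\<omega>. indicator {\<omega> \<in> space M. u \<le> \<tau> \<omega>} \<omega> * Z \<theta> (\<tau> \<omega>) \<omega>"]) (auto simp: ind)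
  have "0 = expectation (\<lambda>\<omega>. Z \<theta> (min (\<tau> \<omega>) u) \<omega>) - expectation (\<lambda>\<omega>. Z \<theta> (\<tau> \<omega>) \<omega>)"
    using Zt Zm by simp
  also have "\<dots> = expectation (\<lambda>\<omega>. Z \<theta> (min (\<tau> \<omega>) u) \<omega> - Z \<theta> (\<tau> \<omega>) \<omega>)"
    using Zt Zm by simp
  also have "\<dots> = expectation (\<lambda>\<omega>. indicator {..\<tau> \<omega>} u * Z \<theta> u \<omega> - indicator {..\<tau> \<omega>} u * Z \<theta> (\<tau> \<omega>) \<omega>)"
    by (intro Bochner_Integration.integral_cong) (auto simp: indicator_def min_def)
  also have "\<dots> = expectation (\<lambda>\<omega>. indicator {..\<tau> \<omega>} u * Z \<theta> u \<omega>) - expectation (\<lambda>\<omega>. indicator {..\<tau> \<omega>} u * Z \<theta> (\<tau> \<omega>) \<omega>)"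
    by (rule Bochner_Integration.integral_diff[OF i1 i2])
  finally show "expectation (\<lambda>\<omega>. indicator {..\<tau> \<omega>} u * Z \<theta> u \<omega>) = expectation (\<lambda>\<omega>. indicator {..\<tau> \<omega>} u * Z \<theta> (\<tau> \<omega>) \<omega>)"
    by simp
qed

text \<open>The product form includes \<open>q = 0\<close>.\<close>

lemma exp_integral:
  fixes q t :: real
  assumes "0 \<le> t"
  shows "q * (LINT u:{0..t}|lborel. exp (q * u)) = exp (q * t) - 1"
proof -
  have "(LBINT u. (q * exp (q * u)) * indicator {0..t} u) = exp (q * t) - exp (q * 0)"
    by (rule integral_FTC_Icc_real[OF assms]) (auto intro!: derivative_eq_intros continuous_intros)
  also have "(LBINT u. (q * exp (q * u)) * indicator {0..t} u) = (LBINT u. q * (indicator {0..t} u * exp (q * u)))"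
    by (intro Bochner_Integration.integral_cong) (auto simp: algebra_simps)
  finally show ?thesis by (simp add: set_lebesgue_integral_def)
qed

text \<open>Fubini turns the running cost into an integral over \<open>u\<close> of the expectations of \<open>Z\<close> at
  time \<open>u\<close> on the event \<open>u \<le> \<tau>\<close>, where optional stopping replaces \<open>Z\<close> at time \<open>u\<close> by \<open>Z\<close> at
  time \<open>\<tau>\<close>. No martingale property of the time integral is needed.\<close>

lemma dynkin_exponential:
  assumes st: "stopping_time filt \<tau>" and bd: "\<And>\<omega>. \<omega> \<in> space M \<Longrightarrow> 0 \<le> \<tau> \<omega> \<and> \<tau> \<omega> \<le> T"
  shows "integrable M (\<lambda>\<omega>. exp (q * \<tau> \<omega>) * Z \<theta> (\<tau> \<omega>) \<omega>)"
    and "integrable M (\<lambda>\<omega>. LINT u:{0..\<tau> \<omega>}|lborel. exp (q * u) * Z \<theta> u \<omega>)"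
    and "q * expectation (\<lambda>\<omega>. LINT u:{0..\<tau> \<omega>}|lborel. exp (q * u) * Z \<theta> u \<omega>)
      = expectation (\<lambda>\<omega>. exp (q * \<tau> \<omega>) * Z \<theta> (\<tau> \<omega>) \<omega>) - 1"
proof -
  have [measurable]: "\<tau> \<in> borel_measurable M" by (rule stopping_meas[OF st])
  have Ztm [measurable]: "(\<lambda>\<omega>. Z \<theta> (\<tau> \<omega>) \<omega>) \<in> borel_measurable M"
    using optional_stopping(1)[OF st bd, of \<theta>] by blast
  \<comment> \<open>\<open>F\<close> carries \<open>Z\<close> at the running time \<open>u\<close>,
    \<open>H\<close> carries it at \<open>\<tau>\<close>. Replacing \<open>u\<close> by
    \<open>max 0 u\<close> changes nothing where the indicator is nonzero and makes \<open>F\<close>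
    jointly measurable.\<close>
  define F where "F = (\<lambda>u \<omega>. indicator {0..\<tau> \<omega>} u * (exp (q * u) * Z \<theta> (max 0 u) \<omega>))"
  define H where "H = (\<lambda>u \<omega>. indicator {0..\<tau> \<omega>} u * (exp (q * u) * Z \<theta> (\<tau> \<omega>) \<omega>))"
  define g where "g = (\<lambda>t. LINT u:{0..t}|lborel. exp (q * u))"
  have Wj [measurable]: "(\<lambda>z. W (max 0 (fst z)) (snd z)) \<in> borel_measurable (lborel \<Otimes>\<^sub>M M)"
    by (rule W_joint_meas) auto
  have Fm [measurable]: "(\<lambda>(u,\<omega>). F u \<omega>) \<in> borel_measurable (lborel \<Otimes>\<^sub>M M)"
  proof -
    have "(\<lambda>(u,\<omega>). F u \<omega>) = (\<lambda>z. (if 0 \<le> fst z \<and> fst z \<le> \<tau> (snd z) then 1 else 0) *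
        (exp (q * fst z) * exp (\<theta> * W (max 0 (fst z)) (snd z) - \<theta>\<^sup>2 * max 0 (fst z) / 2)))"
      by (auto simp: F_def Z_def fun_eq_iff indicator_def)
    also have "\<dots> \<in> borel_measurable (lborel \<Otimes>\<^sub>M M)" by measurable
    finally show ?thesis .
  qed
  have Hm [measurable]: "(\<lambda>(u,\<omega>). H u \<omega>) \<in> borel_measurable (lborel \<Otimes>\<^sub>M M)"
  proof -
    have "(\<lambda>(u,\<omega>). H u \<omega>) = (\<lambda>z. (if 0 \<le> fst z \<and> fst z \<le> \<tau> (snd z) then 1 else 0) *
        (exp (q * fst z) * Z \<theta> (\<tau> (snd z)) (snd z)))"
      by (auto simp: H_def fun_eq_iff indicator_def)
    also have "\<dots> \<in> borel_measurable (lborel \<Otimes>\<^sub>M M)"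
      using measurable_compose[OF measurable_snd Ztm, of lborel] by measurable
    finally show ?thesis .
  qed
  interpret P: pair_sigma_finite lborel M ..
  have FH: "(\<integral>\<^sup>+\<omega>. ennreal (F u \<omega>) \<partial>M) = (\<integral>\<^sup>+\<omega>. ennreal (H u \<omega>) \<partial>M)" for u
  proof (cases "0 \<le> u")
    case True
    note A = Z_after[OF st bd True, of \<theta>]
    have eqF: "F u \<omega> = exp (q * u) * (indicator {..\<tau> \<omega>} u * Z \<theta> u \<omega>)"
      and eqH: "H u \<omega> = exp (q * u) * (indicator {..\<tau> \<omega>} u * Z \<theta> (\<tau> \<omega>) \<omega>)" for \<omega>
      using True by (auto simp: F_def H_def indicator_def)
    have "(\<integral>\<^sup>+\<omega>. ennreal (F u \<omega>) \<partial>M) = ennreal (expectation (F u))"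
      unfolding eqF using A(2) by (intro nn_integral_eq_integral) auto
    also have "expectation (F u) = expectation (H u)"
      unfolding eqF eqH using A(1) by simp
    also have "ennreal (expectation (H u)) = (\<integral>\<^sup>+\<omega>. ennreal (H u \<omega>) \<partial>M)"
      unfolding eqH using A(3) by (intro nn_integral_eq_integral[symmetric]) auto
    finally show ?thesis .
  qed (simp add: F_def H_def)
  have gint: "set_integrable lborel {0..t} (\<lambda>u. exp (q * u))" for t
    by (intro borel_integrable_atLeastAtMost' continuous_intros)
  have g0: "0 \<le> g t" for t unfolding g_def set_lebesgue_integral_def
    by (intro Bochner_Integration.integral_nonneg) auto
  have gH: "(\<integral>\<^sup>+u. ennreal (H u \<omega>) \<partial>lborel) = ennreal (g (\<tau> \<omega>) * Z \<theta> (\<tau> \<omega>) \<omega>)" for \<omega>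
  proof -
    have Heq: "H u \<omega> = (indicator {0..\<tau> \<omega>} u *\<^sub>R exp (q * u)) * Z \<theta> (\<tau> \<omega>) \<omega>" for u
      by (simp add: H_def)
    have "integrable lborel (\<lambda>u. (indicator {0..\<tau> \<omega>} u *\<^sub>R exp (q * u)) * Z \<theta> (\<tau> \<omega>) \<omega>)"
      using gint[of "\<tau> \<omega>"] unfolding set_integrable_def by (rule integrable_mult_left)
    hence "(\<integral>\<^sup>+u. ennreal (H u \<omega>) \<partial>lborel) = ennreal (LBINT u. H u \<omega>)"
      unfolding Heq by (intro nn_integral_eq_integral) auto
    also have "(LBINT u. H u \<omega>) = g (\<tau> \<omega>) * Z \<theta> (\<tau> \<omega>) \<omega>"
      unfolding Heq g_def set_lebesgue_integral_def
      using gint[of "\<tau> \<omega>"] unfolding set_integrable_def by (intro Bochner_Integration.integral_mult_left)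
    finally show ?thesis .
  qed
  have Fint: "set_integrable lborel {0..\<tau> \<omega>} (\<lambda>u. exp (q * u) * Z \<theta> u \<omega>)" if "\<omega> \<in> space M" for \<omega>
  proof (rule borel_integrable_atLeastAtMost')
    have c: "continuous_on {0..\<tau> \<omega>} (\<lambda>u. W u \<omega>)"
      by (rule continuous_on_subset[OF W_cont[OF that]]) auto
    show "continuous_on {0..\<tau> \<omega>} (\<lambda>u. exp (q * u) * Z \<theta> u \<omega>)"
      unfolding Z_def by (intro continuous_intros c) auto
  qed
  have Feq: "indicator {0..\<tau> \<omega>} u *\<^sub>R (exp (q * u) * Z \<theta> u \<omega>) = F u \<omega>" for u \<omega>
    by (auto simp: F_def indicator_def)
  have gF: "(\<integral>\<^sup>+u. ennreal (F u \<omega>) \<partial>lborel) = ennreal (LINT u:{0..\<tau> \<omega>}|lborel. exp (q * u) * Z \<theta> u \<omega>)" if "\<omega> \<in> space M" for \<omega>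
    using Fint[OF that] unfolding set_lebesgue_integral_def set_integrable_def Feq
    by (intro nn_integral_eq_integral) (auto simp: F_def)
  have gq: "q * g (\<tau> \<omega>) = exp (q * \<tau> \<omega>) - 1" if "\<omega> \<in> space M" for \<omega>
    unfolding g_def using bd[OF that] by (intro exp_integral) auto
  have eZ: "integrable M (\<lambda>\<omega>. f \<omega> * Z \<theta> (\<tau> \<omega>) \<omega>)"
    if "f \<in> borel_measurable M" "\<And>\<omega>. \<omega> \<in> space M \<Longrightarrow> \<bar>f \<omega>\<bar> \<le> C" for f :: "'a \<Rightarrow> real" and C
  proof (rule Bochner_Integration.integrable_bound)
    show "integrable M (\<lambda>\<omega>. C * Z \<theta> (\<tau> \<omega>) \<omega>)"
      using optional_stopping(1)[OF st bd, of \<theta>] by simp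
    show "AE \<omega> in M. norm (f \<omega> * Z \<theta> (\<tau> \<omega>) \<omega>) \<le> norm (C * Z \<theta> (\<tau> \<omega>) \<omega>)"
      using that(2) by (intro AE_I2) (fastforce simp: abs_mult intro!: mult_right_mono)
  qed (use that in measurable)
  have expbd: "\<bar>exp (q * \<tau> \<omega>)\<bar> \<le> exp (\<bar>q\<bar> * T)" if "\<omega> \<in> space M" for \<omega>
  proof -
    have "q * \<tau> \<omega> \<le> \<bar>q\<bar> * \<tau> \<omega>" using bd[OF that] by (intro mult_right_mono) auto
    also have "\<dots> \<le> \<bar>q\<bar> * T" using bd[OF that] by (intro mult_left_mono) auto
    finally show ?thesis by simp
  qed
  show eint: "integrable M (\<lambda>\<omega>. exp (q * \<tau> \<omega>) * Z \<theta> (\<tau> \<omega>) \<omega>)"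
    by (rule eZ[OF _ expbd]) auto
  have gm [measurable]: "(\<lambda>\<omega>. g (\<tau> \<omega>)) \<in> borel_measurable M"
  proof -
    have "(\<lambda>\<omega>. g (\<tau> \<omega>)) = (\<lambda>\<omega>. LBINT u. (if 0 \<le> u \<and> u \<le> \<tau> \<omega> then exp (q * u) else 0))"
      by (auto simp: g_def set_lebesgue_integral_def indicator_def intro!: ext Bochner_Integration.integral_cong)
    also have "\<dots> \<in> borel_measurable M"
      by (rule lborel.borel_measurable_lebesgue_integral) measurable
    finally show ?thesis .
  qed
  have gbd: "\<bar>g (\<tau> \<omega>)\<bar> \<le> g T" if "\<omega> \<in> space M" for \<omega>
  proof -
    have "g (\<tau> \<omega>) \<le> g T"
      unfolding g_def set_lebesgue_integral_def using bd[OF that]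
      by (intro integral_mono gint[unfolded set_integrable_def]) (auto simp: indicator_def)
    thus ?thesis using g0 by simp
  qed
  have gZint: "integrable M (\<lambda>\<omega>. g (\<tau> \<omega>) * Z \<theta> (\<tau> \<omega>) \<omega>)"
    by (rule eZ[OF gm gbd])
  \<comment> \<open>The exchange is made for nonnegative integrals, so integrability of the running
    cost comes out of the computation instead of entering it.\<close>
  have "(\<integral>\<^sup>+\<omega>. ennreal (LINT u:{0..\<tau> \<omega>}|lborel. exp (q * u) * Z \<theta> u \<omega>) \<partial>M) = (\<integral>\<^sup>+\<omega>. (\<integral>\<^sup>+u. ennreal (F u \<omega>) \<partial>lborel) \<partial>M)"
    by (intro nn_integral_cong gF[symmetric])
  also have "\<dots> = (\<integral>\<^sup>+u. (\<integral>\<^sup>+\<omega>. ennreal (F u \<omega>) \<partial>M) \<partial>lborel)"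
    using Fm by (intro P.Fubini') measurable
  also have "\<dots> = (\<integral>\<^sup>+u. (\<integral>\<^sup>+\<omega>. ennreal (H u \<omega>) \<partial>M) \<partial>lborel)" by (simp only: FH)
  also have "\<dots> = (\<integral>\<^sup>+\<omega>. (\<integral>\<^sup>+u. ennreal (H u \<omega>) \<partial>lborel) \<partial>M)"
    using Hm by (intro P.Fubini'[symmetric]) measurable
  also have "\<dots> = (\<integral>\<^sup>+\<omega>. ennreal (g (\<tau> \<omega>) * Z \<theta> (\<tau> \<omega>) \<omega>) \<partial>M)" by (simp only: gH)
  also have "\<dots> = ennreal (expectation (\<lambda>\<omega>. g (\<tau> \<omega>) * Z \<theta> (\<tau> \<omega>) \<omega>))"
    using gZint g0 by (intro nn_integral_eq_integral) auto
  finally have nn: "(\<integral>\<^sup>+\<omega>. ennreal (LINT u:{0..\<tau> \<omega>}|lborel. exp (q * u) * Z \<theta> u \<omega>) \<partial>M)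
    = ennreal (expectation (\<lambda>\<omega>. g (\<tau> \<omega>) * Z \<theta> (\<tau> \<omega>) \<omega>))" .
  have Im: "(\<lambda>\<omega>. LINT u:{0..\<tau> \<omega>}|lborel. exp (q * u) * Z \<theta> u \<omega>) \<in> borel_measurable M"
    unfolding set_lebesgue_integral_def Feq
    by (rule lborel.borel_measurable_lebesgue_integral)
      (use measurable_pair_swap[OF Fm] in \<open>simp add: case_prod_beta\<close>)
  have I0: "0 \<le> (LINT u:{0..\<tau> \<omega>}|lborel. exp (q * u) * Z \<theta> u \<omega>)" for \<omega>
    unfolding set_lebesgue_integral_def by (intro Bochner_Integration.integral_nonneg) auto
  have E0: "0 \<le> expectation (\<lambda>\<omega>. g (\<tau> \<omega>) * Z \<theta> (\<tau> \<omega>) \<omega>)"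
    using g0 by (intro Bochner_Integration.integral_nonneg) auto
  show Iint: "integrable M (\<lambda>\<omega>. LINT u:{0..\<tau> \<omega>}|lborel. exp (q * u) * Z \<theta> u \<omega>)"
    using nn I0 Im by (intro integrableI_nonneg) auto
  have "expectation (\<lambda>\<omega>. LINT u:{0..\<tau> \<omega>}|lborel. exp (q * u) * Z \<theta> u \<omega>) = expectation (\<lambda>\<omega>. g (\<tau> \<omega>) * Z \<theta> (\<tau> \<omega>) \<omega>)"
    using nn E0 I0 Iint by (subst (asm) nn_integral_eq_integral) auto
  hence "q * expectation (\<lambda>\<omega>. LINT u:{0..\<tau> \<omega>}|lborel. exp (q * u) * Z \<theta> u \<omega>) = expectation (\<lambda>\<omega>. q * (g (\<tau> \<omega>) * Z \<theta> (\<tau> \<omega>) \<omega>))"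
    by simp
  also have "\<dots> = expectation (\<lambda>\<omega>. exp (q * \<tau> \<omega>) * Z \<theta> (\<tau> \<omega>) \<omega> - Z \<theta> (\<tau> \<omega>) \<omega>)"
    by (intro Bochner_Integration.integral_cong refl) (simp add: gq left_diff_distrib flip: mult.assoc)
  also have "\<dots> = expectation (\<lambda>\<omega>. exp (q * \<tau> \<omega>) * Z \<theta> (\<tau> \<omega>) \<omega>) - 1"
    using eint optional_stopping[OF st bd, of \<theta>] by simp
  finally show "q * expectation (\<lambda>\<omega>. LINT u:{0..\<tau> \<omega>}|lborel. exp (q * u) * Z \<theta> u \<omega>)
      = expectation (\<lambda>\<omega>. exp (q * \<tau> \<omega>) * Z \<theta> (\<tau> \<omega>) \<omega>) - 1" .
qed

end

section \<open>Geometric Brownian motion and exit times\<close>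

locale gbm_interval = brownian +
  fixes r \<sigma> a b :: real
  assumes r: "0 < r" and \<sigma>: "0 < \<sigma>" and a: "0 < a" and ab: "a < b"
begin

abbreviation "S \<equiv> gbm W r \<sigma>"
abbreviation "adm \<equiv> adm_stops M W r \<sigma> a b"
abbreviation "run y g \<tau> \<omega> \<equiv> LINT u:{0..\<tau> \<omega>}|lborel. exp (- 2 * r * u) * g (S y u \<omega>)"

text \<open>The characteristic polynomial of the generator:
  \<open>(L - 2r) s^k = Q k * s^k\<close>.\<close>

definition Q :: "real \<Rightarrow> real" where
  "Q k = \<sigma>\<^sup>2 / 2 * k * (k - 1) + r * k - 2 * r"

lemma S_0: "\<omega> \<in> space M \<Longrightarrow> S y 0 \<omega> = y"
  by (simp add: gbm_def W_0)

lemma S_cont: "\<omega> \<in> space M \<Longrightarrow> continuous_on {0..} (\<lambda>t. S y t \<omega>)"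
  unfolding gbm_def by (intro continuous_intros W_cont)

text \<open>The martingale \<open>Z\<close> with parameter \<open>k * \<sigma>\<close> absorbs the
  random part of the exponent; \<open>Q k\<close> is the growth rate that is left after
  discounting.\<close>

lemma S_power:
  assumes "0 < y"
  shows "exp (- 2 * r * u) * S y u \<omega> powr k = y powr k * (exp (Q k * u) * Z (k * \<sigma>) u \<omega>)"
proof -
  have "S y u \<omega> powr k = y powr k * exp (k * ((r - \<sigma>\<^sup>2 / 2) * u + \<sigma> * W u \<omega>))"
    using assms by (simp add: gbm_def powr_mult) (simp add: powr_def)
  thus ?thesis
    by (simp add: Z_def Q_def field_simps power2_eq_square flip: exp_add)
qed

lemma S_stop_meas:
  assumes "\<tau> \<in> borel_measurable M" "\<And>\<omega>. \<omega> \<in> space M \<Longrightarrow> 0 \<le> \<tau> \<omega>"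
  shows "(\<lambda>\<omega>. S y (\<tau> \<omega>) \<omega>) \<in> borel_measurable M"
  unfolding gbm_def using stopping_value_meas[OF assms] assms(1) by measurable

lemma run_meas:
  assumes [measurable]: "\<tau> \<in> borel_measurable M" "g \<in> borel_measurable borel"
  shows "run y g \<tau> \<in> borel_measurable M"
proof -
  have Wj [measurable]: "(\<lambda>z. W (max 0 (snd z)) (fst z)) \<in> borel_measurable (M \<Otimes>\<^sub>M lborel)"
    by (rule W_joint_meas) auto
  have "run y g \<tau> = (\<lambda>\<omega>. LBINT u. if 0 \<le> u \<and> u \<le> \<tau> \<omega>
      then exp (- 2 * r * u) * g (y * exp ((r - \<sigma>\<^sup>2 / 2) * u + \<sigma> * W (max 0 u) \<omega>)) else 0)"
    unfolding set_lebesgue_integral_def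
    by (intro ext Bochner_Integration.integral_cong) (auto simp: indicator_def gbm_def)
  also have "\<dots> \<in> borel_measurable M"
    by (rule lborel.borel_measurable_lebesgue_integral) measurable
  finally show ?thesis .
qed

lemma run_inner_integrable:
  assumes om: "\<omega> \<in> space M" and [measurable]: "g \<in> borel_measurable borel"
    and B: "\<And>u. u \<in> {0..t} \<Longrightarrow> \<bar>g (S y u \<omega>)\<bar> \<le> B"
  shows "set_integrable lborel {0..t} (\<lambda>u. exp (- 2 * r * u) * g (S y u \<omega>))"
proof -
  have [measurable]: "(\<lambda>u. W (max 0 u) \<omega>) \<in> borel_measurable lborel"
    using om by (intro W_joint_meas) auto
  have "integrable lborel (\<lambda>u. if 0 \<le> u \<and> u \<le> t
      then exp (- 2 * r * u) * g (y * exp ((r - \<sigma>\<^sup>2 / 2) * u + \<sigma> * W (max 0 u) \<omega>)) else 0)"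
  proof (rule Bochner_Integration.integrable_bound)
    show "integrable lborel (\<lambda>u. B * indicator {0..t} u)"
      by (intro integrable_mult_right integrable_real_indicator) (auto simp: emeasure_lborel_Icc_eq)
    show "AE u in lborel. norm (if 0 \<le> u \<and> u \<le> t
      then exp (- 2 * r * u) * g (y * exp ((r - \<sigma>\<^sup>2 / 2) * u + \<sigma> * W (max 0 u) \<omega>)) else 0)
      \<le> norm (B * indicator {0..t} u)"
    proof (intro AE_I2)
      fix u
      have "exp (- 2 * r * u) * \<bar>g (S y u \<omega>)\<bar> \<le> 1 * B" if "0 \<le> u" "u \<le> t"
        using that B[of u] r by (intro mult_mono) auto
      thus "norm (if 0 \<le> u \<and> u \<le> t
        then exp (- 2 * r * u) * g (y * exp ((r - \<sigma>\<^sup>2 / 2) * u + \<sigma> * W (max 0 u) \<omega>)) else 0)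
        \<le> norm (B * indicator {0..t} u)"
        by (auto simp: indicator_def gbm_def abs_mult)
    qed
  qed measurable
  thus ?thesis unfolding set_integrable_def
    by (rule Bochner_Integration.integrable_cong[THEN iffD1, rotated 2]) (auto simp: gbm_def indicator_def)
qed

text \<open>Discounting makes the bound independent of the horizon \<open>t\<close>, as required for
  dominated convergence along unbounded stopping times.\<close>

lemma run_bound:
  assumes B: "\<And>u. u \<in> {0..t} \<Longrightarrow> \<bar>h u\<bar> \<le> B" and t: "0 \<le> t"
  shows "\<bar>LINT u:{0..t}|lborel. exp (- 2 * r * u) * h u\<bar> \<le> B / (2 * r)"
proof (cases "set_integrable lborel {0..t} (\<lambda>u. exp (- 2 * r * u) * h u)")
  case True
  have B0: "0 \<le> B" using B[of 0] t by auto
  have ei: "set_integrable lborel {0..t} (\<lambda>u. exp (- 2 * r * u) * B)"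
    by (intro borel_integrable_atLeastAtMost' continuous_intros)
  have "\<bar>LINT u:{0..t}|lborel. exp (- 2 * r * u) * h u\<bar> \<le> (LINT u:{0..t}|lborel. exp (- 2 * r * u) * B)"
    unfolding set_lebesgue_integral_def
    by (rule integral_abs_bound_integral[OF True[unfolded set_integrable_def] ei[unfolded set_integrable_def]])
      (use B in \<open>auto simp: indicator_def abs_mult\<close>)
  also have "\<dots> = (LINT u:{0..t}|lborel. exp (- 2 * r * u)) * B"
    by (rule set_integral_mult_left)
  also have "(LINT u:{0..t}|lborel. exp (- 2 * r * u)) = (1 - exp (- 2 * r * t)) / (2 * r)"
    using exp_integral[OF t, of "- 2 * r"] r by (simp add: field_simps)
  also have "\<dots> * B \<le> 1 / (2 * r) * B"
    using B0 r by (intro mult_right_mono divide_right_mono) auto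
  finally show ?thesis by simp
next
  \<comment> \<open>The integral of a non-integrable function is \<open>0\<close> by convention,
    which respects the bound because \<open>B\<close> is nonnegative.\<close>
  case False
  hence "(LINT u:{0..t}|lborel. exp (- 2 * r * u) * h u) = 0"
    unfolding set_integrable_def set_lebesgue_integral_def by (rule not_integrable_integral_eq)
  thus ?thesis using B[of 0] t r by auto
qed

text \<open>By compactness, a path that stays in the open interval during \<open>{0..t}\<close>
  keeps a distance \<open>1 / real (Suc n)\<close> from both ends. By continuity, these closed
  conditions have to be checked at countably many times only.\<close>

lemma inside_aug:
  assumes "0 \<le> t"
  shows "{\<omega> \<in> space M. \<forall>s\<in>{0..t}. S y s \<omega> \<in> {l<..<m}} \<in> sets (aug t)"
proof -
  \<comment> \<open>Dyadic times clipped to \<open>{0..t}\<close>, so that the values of the path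
    there are known at time \<open>t\<close>.\<close>
  define D where "D = (\<lambda>p::int \<times> nat. max 0 (min ((of_int (fst p) + 1) / 2 ^ snd p) t))"
  have D: "0 \<le> D p" "D p \<le> t" for p using assms by (auto simp: D_def)
  have [measurable]: "S y (D p) \<in> borel_measurable (aug t)" for p
    unfolding gbm_def using W_meas_aug[OF D] by measurable
  have "{\<omega> \<in> space (aug t). \<exists>n::nat. \<forall>p. l + 1 / real (Suc n) \<le> S y (D p) \<omega> \<and> S y (D p) \<omega> \<le> m - 1 / real (Suc n)} \<in> sets (aug t)"
    by measurable
  also have "{\<omega> \<in> space (aug t). \<exists>n::nat. \<forall>p. l + 1 / real (Suc n) \<le> S y (D p) \<omega> \<and> S y (D p) \<omega> \<le> m - 1 / real (Suc n)}
    = {\<omega> \<in> space M. \<forall>s\<in>{0..t}. S y s \<omega> \<in> {l<..<m}}"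
  proof (intro Collect_cong conj_cong)
    fix \<omega> assume "\<omega> \<in> space M"
    hence c: "continuous_on {0..t} (\<lambda>s. S y s \<omega>)" by (intro continuous_on_subset[OF S_cont]) auto
    show "(\<exists>n::nat. \<forall>p. l + 1 / real (Suc n) \<le> S y (D p) \<omega> \<and> S y (D p) \<omega> \<le> m - 1 / real (Suc n))
      \<longleftrightarrow> (\<forall>s\<in>{0..t}. S y s \<omega> \<in> {l<..<m})"
    proof safe
      fix n s assume n: "\<forall>p. l + 1 / real (Suc n) \<le> S y (D p) \<omega> \<and> S y (D p) \<omega> \<le> m - 1 / real (Suc n)"
        and s: "s \<in> {0..t}"
      have "(\<lambda>k. max 0 (min (dyad k s) t)) \<longlonglongrightarrow> max 0 (min s t)"
        by (intro tendsto_max tendsto_min tendsto_const dyad_lim)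
      hence "(\<lambda>k. D (\<lfloor>2 ^ k * s\<rfloor>, k)) \<longlonglongrightarrow> s" using s by (simp add: D_def dyad_def)
      hence lim: "(\<lambda>k. S y (D (\<lfloor>2 ^ k * s\<rfloor>, k)) \<omega>) \<longlonglongrightarrow> S y s \<omega>"
        using s D by (intro continuous_on_tendsto_compose[OF c]) auto
      have "l + 1 / real (Suc n) \<le> S y s \<omega>" "S y s \<omega> \<le> m - 1 / real (Suc n)"
        using n by (auto intro!: LIMSEQ_le_const[OF lim] LIMSEQ_le_const2[OF lim])
      moreover have "0 < 1 / real (Suc n)" by simp
      ultimately show "S y s \<omega> \<in> {l<..<m}" unfolding greaterThanLessThan_iff by linarith
    next
      assume all: "\<forall>s\<in>{0..t}. S y s \<omega> \<in> {l<..<m}"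
      obtain s1 where s1: "s1 \<in> {0..t}" "\<And>s. s \<in> {0..t} \<Longrightarrow> S y s1 \<omega> \<le> S y s \<omega>"
        using continuous_attains_inf[OF _ _ c] assms by auto
      obtain s2 where s2: "s2 \<in> {0..t}" "\<And>s. s \<in> {0..t} \<Longrightarrow> S y s \<omega> \<le> S y s2 \<omega>"
        using continuous_attains_sup[OF _ _ c] assms by auto
      have "0 < min (S y s1 \<omega> - l) (m - S y s2 \<omega>)" using all s1 s2 by auto
      then obtain n where n: "1 / real (Suc n) < min (S y s1 \<omega> - l) (m - S y s2 \<omega>)"
        using nat_approx_posE by blast
      show "\<exists>n::nat. \<forall>p. l + 1 / real (Suc n) \<le> S y (D p) \<omega> \<and> S y (D p) \<omega> \<le> m - 1 / real (Suc n)"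
      proof (intro exI allI)
        fix p
        have "S y s1 \<omega> \<le> S y (D p) \<omega>" "S y (D p) \<omega> \<le> S y s2 \<omega>" using D[of p] s1 s2 by auto
        thus "l + 1 / real (Suc n) \<le> S y (D p) \<omega> \<and> S y (D p) \<omega> \<le> m - 1 / real (Suc n)"
          using n by (auto simp: min_less_iff_conj)
      qed
    qed
  qed simp
  finally show ?thesis .
qed

text \<open>On this event \<open>W t\<close> lies in an interval whose length
  \<open>ln (m / l) / \<sigma>\<close> does not depend on \<open>t\<close>, while the normal density
  of variance \<open>t\<close> is at most \<open>1 / sqrt (2 * pi * t)\<close>.\<close>

lemma prob_inside_le:
  assumes y: "0 < y" and lm: "0 < l" "l < m" and t: "0 < t"
  shows "prob {\<omega> \<in> space M. S y t \<omega> \<in> {l<..<m}} \<le> ln (m / l) / \<sigma> / sqrt (2 * pi * t)"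
proof -
  define \<alpha> where "\<alpha> = (ln (l / y) - (r - \<sigma>\<^sup>2 / 2) * t) / \<sigma>"
  define \<beta> where "\<beta> = (ln (m / y) - (r - \<sigma>\<^sup>2 / 2) * t) / \<sigma>"
  have diff: "\<beta> - \<alpha> = ln (m / l) / \<sigma>"
    using y lm by (simp add: \<alpha>_def \<beta>_def ln_div diff_divide_distrib)
  have ab': "\<alpha> \<le> \<beta>" using diff lm \<sigma> by (smt (verit) divide_nonneg_pos ln_ge_zero le_divide_eq_1)
  note d = W_incr[of 0 t, simplified, OF t]
  have sub: "{\<omega> \<in> space M. S y t \<omega> \<in> {l<..<m}} \<subseteq> (\<lambda>\<omega>. W t \<omega> - W 0 \<omega>) -` {\<alpha>..\<beta>} \<inter> space M"
  proof (rule subsetI)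
    fix \<omega> assume "\<omega> \<in> {\<omega> \<in> space M. S y t \<omega> \<in> {l<..<m}}"
    hence om: "\<omega> \<in> space M" and S: "S y t \<omega> \<in> {l<..<m}" by auto
    have "exp ((r - \<sigma>\<^sup>2 / 2) * t + \<sigma> * W t \<omega>) = S y t \<omega> / y" using y by (simp add: gbm_def)
    hence eq: "(r - \<sigma>\<^sup>2 / 2) * t + \<sigma> * W t \<omega> = ln (S y t \<omega> / y)" by (metis ln_exp)
    have "ln (l / y) \<le> ln (S y t \<omega> / y)" "ln (S y t \<omega> / y) \<le> ln (m / y)"
      using S y lm by (auto simp: divide_right_mono)
    hence "W t \<omega> - W 0 \<omega> \<in> {\<alpha>..\<beta>}" unfolding eq[symmetric] \<alpha>_def \<beta>_def
      using \<sigma> by (simp add: W_0[OF om] field_simps)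
    thus "\<omega> \<in> (\<lambda>\<omega>. W t \<omega> - W 0 \<omega>) -` {\<alpha>..\<beta>} \<inter> space M" using om by simp
  qed
  have "ennreal (prob {\<omega> \<in> space M. S y t \<omega> \<in> {l<..<m}}) \<le> emeasure M ((\<lambda>\<omega>. W t \<omega> - W 0 \<omega>) -` {\<alpha>..\<beta>} \<inter> space M)"
    unfolding emeasure_eq_measure[symmetric] by (intro emeasure_mono sub) measurable
  also have "\<dots> = (\<integral>\<^sup>+x. ennreal (normal_density 0 (sqrt t) x) * indicator {\<alpha>..\<beta>} x \<partial>lborel)"
    by (rule distributed_emeasure[OF d]) simp
  also have "\<dots> \<le> (\<integral>\<^sup>+x. ennreal (1 / sqrt (2 * pi * t)) * indicator {\<alpha>..\<beta>} x \<partial>lborel)"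
  proof (intro nn_integral_mono mult_right_mono ennreal_leI)
    fix x :: real
    have "1 / sqrt (2 * pi * t) * exp (- x\<^sup>2 / (2 * t)) \<le> 1 / sqrt (2 * pi * t) * 1"
      using t by (intro mult_left_mono) auto
    thus "normal_density 0 (sqrt t) x \<le> 1 / sqrt (2 * pi * t)"
      using t by (simp add: normal_density_def)
  qed simp
  also have "\<dots> = ennreal (1 / sqrt (2 * pi * t) * (\<beta> - \<alpha>))"
    using ab' t by (simp add: nn_integral_cmult_indicator flip: ennreal_mult)
  finally show ?thesis using t ab' unfolding diff[symmetric] by (simp add: ennreal_le_iff)
qed

text \<open>A path that never leaves is inside at every fixed \<open>t > 0\<close>, and the
  probability of that tends to zero like \<open>1 / sqrt t\<close>.\<close>

lemma never_exit_null:
  assumes y: "0 < y" and lm: "0 < l" "l < m"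
  shows "{\<omega> \<in> space M. \<forall>t\<ge>0. S y t \<omega> \<in> {l<..<m}} \<in> null_sets M" (is "?N \<in> _")
proof -
  have eq: "?N = (\<Inter>n::nat. {\<omega> \<in> space M. \<forall>s\<in>{0..real n}. S y s \<omega> \<in> {l<..<m}})"
  proof (intro equalityI subsetI)
    fix \<omega> assume om: "\<omega> \<in> (\<Inter>n::nat. {\<omega> \<in> space M. \<forall>s\<in>{0..real n}. S y s \<omega> \<in> {l<..<m}})"
    have "S y t \<omega> \<in> {l<..<m}" if "t \<ge> 0" for t
    proof -
      obtain n where "t \<le> real n" using real_arch_simple by blast
      thus ?thesis using om that by force
    qed
    thus "\<omega> \<in> ?N" using om by auto
  qed auto
  have ev: "?N \<in> events" unfolding eq
    by (intro sets.countable_INT' image_subsetI subsetD[OF aug_events inside_aug]) auto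
  have "prob ?N \<le> 0"
  proof (rule LIMSEQ_le_const)
    have "(\<lambda>n. sqrt (inverse (real (Suc n)))) \<longlonglongrightarrow> sqrt 0"
      by (intro tendsto_intros LIMSEQ_inverse_real_of_nat)
    hence "(\<lambda>n. ln (m / l) / \<sigma> / sqrt (2 * pi) * sqrt (inverse (real (Suc n)))) \<longlonglongrightarrow> ln (m / l) / \<sigma> / sqrt (2 * pi) * 0"
      by (intro tendsto_intros) simp
    moreover have "ln (m / l) / \<sigma> / sqrt (2 * pi * real (Suc n)) =
        ln (m / l) / \<sigma> / sqrt (2 * pi) * sqrt (inverse (real (Suc n)))" for n
      unfolding real_sqrt_mult[of "2 * pi"] real_sqrt_inverse by (simp only: divide_inverse inverse_mult_distrib mult_ac)
    ultimately show "(\<lambda>n. ln (m / l) / \<sigma> / sqrt (2 * pi * real (Suc n))) \<longlonglongrightarrow> 0" by simp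
    show "\<exists>N. \<forall>n\<ge>N. prob ?N \<le> ln (m / l) / \<sigma> / sqrt (2 * pi * real (Suc n))"
    proof (intro exI allI impI)
      fix n
      have "prob ?N \<le> prob {\<omega> \<in> space M. S y (real (Suc n)) \<omega> \<in> {l<..<m}}"
        unfolding gbm_def by (intro finite_measure_mono) auto
      also have "\<dots> \<le> ln (m / l) / \<sigma> / sqrt (2 * pi * real (Suc n))"
        by (rule prob_inside_le[OF y lm]) simp
      finally show "prob ?N \<le> ln (m / l) / \<sigma> / sqrt (2 * pi * real (Suc n))" .
    qed
  qed
  hence "prob ?N = 0" using measure_nonneg[of M ?N] by linarith
  thus ?thesis using ev by (simp add: null_sets_def emeasure_eq_measure)
qed

lemma AE_exits:
  assumes "0 < y" "0 < l" "l < m"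
  shows "AE \<omega> in M. \<exists>t\<ge>0. S y t \<omega> \<notin> {l<..<m}"
  by (rule AE_I'[OF never_exit_null[OF assms]]) auto

text \<open>The set of times spent outside is closed, so its infimum is attained. The value there is
  outside the open interval and, as a limit of values inside, in the closed one. A start at an end
  point gives \<open>e = 0\<close>.\<close>

lemma exit_time_facts:
  assumes y: "y \<in> {l..m}" and om: "\<omega> \<in> space M" and ex: "\<exists>t\<ge>0. S y t \<omega> \<notin> {l<..<m}"
  defines "e \<equiv> exit_time W r \<sigma> l m y \<omega>"
  shows "0 \<le> e" and "S y e \<omega> \<in> {l,m}" and "\<And>u. 0 \<le> u \<Longrightarrow> u < e \<Longrightarrow> S y u \<omega> \<in> {l<..<m}"
    and "\<And>u. 0 \<le> u \<Longrightarrow> S y u \<omega> \<notin> {l<..<m} \<Longrightarrow> e \<le> u"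
proof -
  define E where "E = {t. 0 \<le> t \<and> S y t \<omega> \<notin> {l<..<m}}"
  have e: "e = Inf E" by (simp add: e_def exit_time_def E_def)
  have ne: "E \<noteq> {}" using ex by (auto simp: E_def)
  have bdd: "bdd_below E" by (rule bdd_belowI[of _ 0]) (auto simp: E_def)
  have "closed E"
  proof -
    have "closed ({0..} \<inter> (\<lambda>t. S y t \<omega>) -` (- {l<..<m}))"
      by (intro continuous_closed_preimage S_cont om) (auto intro: closed_Compl)
    also have "{0..} \<inter> (\<lambda>t. S y t \<omega>) -` (- {l<..<m}) = E" by (auto simp: E_def)
    finally show ?thesis .
  qed
  hence eE: "e \<in> E" unfolding e by (rule closed_contains_Inf[OF ne bdd])
  thus e0: "0 \<le> e" by (simp add: E_def)
  show low: "e \<le> u" if "0 \<le> u" "S y u \<omega> \<notin> {l<..<m}" for u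
    unfolding e using that by (intro cInf_lower bdd) (simp add: E_def)
  show ins: "S y u \<omega> \<in> {l<..<m}" if "0 \<le> u" "u < e" for u
    using low[of u] that by fastforce
  have "S y e \<omega> \<in> {l..m}"
  proof (cases "e = 0")
    case True thus ?thesis using y S_0[OF om] by simp
  next
    case False
    hence ep: "0 < e" using e0 by simp
    have "(\<lambda>n. e - e / real (Suc n)) \<longlonglongrightarrow> e - 0"
      using tendsto_mult_right_zero[OF LIMSEQ_Suc[OF lim_inverse_n], of e]
      by (intro tendsto_intros) (simp add: divide_inverse)
    hence lim: "(\<lambda>n. S y (e - e / real (Suc n)) \<omega>) \<longlonglongrightarrow> S y e \<omega>"
      using ep by (intro continuous_on_tendsto_compose[OF S_cont[OF om]]) (auto simp: field_simps)
    have "S y (e - e / real (Suc n)) \<omega> \<in> {l<..<m}" for n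
      using ep by (intro ins) (auto simp: field_simps)
    hence "l \<le> S y (e - e / real (Suc n)) \<omega>" "S y (e - e / real (Suc n)) \<omega> \<le> m" for n
      by (auto intro: less_imp_le)
    thus ?thesis by (auto intro: LIMSEQ_le_const[OF lim] LIMSEQ_le_const2[OF lim])
  qed
  thus "S y e \<omega> \<in> {l,m}" using eE by (auto simp: E_def)
qed

text \<open>On the null event that the path never leaves \<open>{l<..<m}\<close>, \<open>exit_time\<close> is \<open>Inf {}\<close>, an
  unspecified and possibly negative number; admissible stopping times must be nonnegative everywhere.\<close>

definition exit_stop :: "real \<Rightarrow> real \<Rightarrow> real \<Rightarrow> 'a \<Rightarrow> real" where
  "exit_stop l m y \<omega> = (if \<exists>t\<ge>0. S y t \<omega> \<notin> {l<..<m} then exit_time W r \<sigma> l m y \<omega> else 0)"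

lemma exit_stop_nonneg: "y \<in> {l..m} \<Longrightarrow> \<omega> \<in> space M \<Longrightarrow> 0 \<le> exit_stop l m y \<omega>"
  using exit_time_facts(1) by (auto simp: exit_stop_def)

text \<open>For nonnegative \<open>t\<close>, the paths stopped by time \<open>t\<close> are those
  that have left by then and the null set \<open>N\<close> of paths that never leave, on which the
  time was set to \<open>0\<close>. The augmentation puts \<open>N\<close> into the filtration at
  every time.\<close>

lemma exit_stop_stopping:
  assumes y: "y \<in> {l..m}" and lm: "0 < l" "l < m"
  shows "stopping_time filt (exit_stop l m y)"
  unfolding stopping_time_def
proof
  fix t
  define N where "N = {\<omega> \<in> space M. \<forall>t\<ge>0. S y t \<omega> \<in> {l<..<m}}"
  define I where "I = {\<omega> \<in> space M. \<forall>s\<in>{0..t}. S y s \<omega> \<in> {l<..<m}}"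
  have "{\<omega> \<in> space M. exit_stop l m y \<omega> \<le> t} \<in> sets (filt t)"
  proof (cases "0 \<le> t")
    case True
    have "{\<omega> \<in> space M. exit_stop l m y \<omega> \<le> t} = N \<union> (space M - I)"
    proof (intro equalityI subsetI)
      fix \<omega> assume om: "\<omega> \<in> {\<omega> \<in> space M. exit_stop l m y \<omega> \<le> t}"
      show "\<omega> \<in> N \<union> (space M - I)"
      proof (cases "\<omega> \<in> N")
        case False
        hence ex: "\<exists>t\<ge>0. S y t \<omega> \<notin> {l<..<m}" using om by (auto simp: N_def)
        note f = exit_time_facts[OF y _ ex]
        have "S y (exit_stop l m y \<omega>) \<omega> \<notin> {l<..<m}" "0 \<le> exit_stop l m y \<omega>"
          using f(1,2) om ex by (auto simp: exit_stop_def)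
        thus ?thesis using om unfolding I_def by (auto intro!: bexI[of _ "exit_stop l m y \<omega>"])
      qed simp
    next
      fix \<omega> assume om: "\<omega> \<in> N \<union> (space M - I)"
      show "\<omega> \<in> {\<omega> \<in> space M. exit_stop l m y \<omega> \<le> t}"
      proof (cases "\<omega> \<in> N")
        case True thus ?thesis using \<open>0 \<le> t\<close> by (auto simp: N_def exit_stop_def)
      next
        case False
        hence oS: "\<omega> \<in> space M" using om by auto
        then obtain s where s: "0 \<le> s" "s \<le> t" "S y s \<omega> \<notin> {l<..<m}" using om False by (auto simp: I_def)
        hence ex: "\<exists>t\<ge>0. S y t \<omega> \<notin> {l<..<m}" by blast
        show ?thesis using exit_time_facts(4)[OF y oS ex s(1,3)] s(2) oS ex by (simp add: exit_stop_def)
      qed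
    qed
    moreover have "N \<union> (space M - I) \<in> sets (filt t)"
    proof (rule in_filtI)
      fix u assume u: "t < u"
      have "I \<in> sets (aug u)" unfolding I_def
        using inside_aug[OF True] aug_mono[of t u] u by auto
      moreover have "N \<in> null_sets M" unfolding N_def using y lm by (intro never_exit_null) auto
      ultimately show "N \<union> (space M - I) \<in> sets (aug u)"
        using sets.compl_sets[of I "aug u"] null_sets_aug by (intro sets.Un) auto
    qed
    ultimately show ?thesis by simp
  next
    case False
    hence "{\<omega> \<in> space M. exit_stop l m y \<omega> \<le> t} = {}"
      using exit_stop_nonneg[OF y] by force
    thus ?thesis by (simp only: sets.empty_sets)
  qed
  thus "Measurable.pred (filt t) (\<lambda>\<omega>. exit_stop l m y \<omega> \<le> t)" by (simp add: pred_def)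
qed

lemma exit_stop_adm:
  assumes lm: "a \<le> l" "l < m" "m \<le> b" and y: "y \<in> {l..m}"
  shows "exit_stop l m y \<in> adm y"
proof -
  have y0: "0 < y" using y lm a by auto
  have "AE \<omega> in M. exit_stop l m y \<omega> \<le> exit_time W r \<sigma> a b y \<omega>"
    using AE_exits[OF y0 a ab] AE_space
  proof eventually_elim
    case (elim \<omega>)
    hence om: "\<omega> \<in> space M" and ex: "\<exists>t\<ge>0. S y t \<omega> \<notin> {a<..<b}" by auto
    have y': "y \<in> {a..b}" using y lm by auto
    note f = exit_time_facts[OF y' om ex]
    have out: "S y (exit_time W r \<sigma> a b y \<omega>) \<omega> \<notin> {l<..<m}" using f(2) lm by auto
    hence ex': "\<exists>t\<ge>0. S y t \<omega> \<notin> {l<..<m}" using f(1) by blast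
    show ?case using exit_time_facts(4)[OF y om ex' f(1) out] ex' by (simp add: exit_stop_def)
  qed
  thus ?thesis
    using exit_stop_stopping[OF y] exit_stop_nonneg[OF y] lm a by (auto simp: adm_stops_def)
qed

lemma zero_adm:
  assumes "y \<in> {a..b}"
  shows "(\<lambda>_. 0) \<in> adm y"
proof -
  have y0: "0 < y" using assms a by auto
  have "AE \<omega> in M. 0 \<le> exit_time W r \<sigma> a b y \<omega>"
    using AE_exits[OF y0 a ab] AE_space
    by eventually_elim (use assms a ab exit_time_facts(1) in auto)
  thus ?thesis by (auto simp: adm_stops_def stopping_time_const)
qed

lemma admD:
  assumes "\<tau> \<in> adm y"
  shows "stopping_time filt \<tau>" "\<And>\<omega>. \<omega> \<in> space M \<Longrightarrow> 0 \<le> \<tau> \<omega>" "\<tau> \<in> borel_measurable M"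
  using assms stopping_meas by (auto simp: adm_stops_def)

lemma adm_range:
  assumes "\<tau> \<in> adm y" "y \<in> {a..b}"
  shows "AE \<omega> in M. \<forall>u\<in>{0..\<tau> \<omega>}. S y u \<omega> \<in> {a..b}"
proof -
  have "AE \<omega> in M. \<tau> \<omega> \<le> exit_time W r \<sigma> a b y \<omega>" using assms by (simp add: adm_stops_def)
  moreover have "AE \<omega> in M. \<exists>t\<ge>0. S y t \<omega> \<notin> {a<..<b}" using assms a ab by (intro AE_exits) auto
  ultimately show ?thesis using AE_space
  proof eventually_elim
    case (elim \<omega>)
    note f = exit_time_facts[OF assms(2) elim(3,2)]
    show ?case
    proof
      fix u assume u: "u \<in> {0..\<tau> \<omega>}"
      hence "u < exit_time W r \<sigma> a b y \<omega> \<or> u = exit_time W r \<sigma> a b y \<omega>" using elim by auto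
      thus "S y u \<omega> \<in> {a..b}" using f(2) f(3)[of u] u ab by auto
    qed
  qed
qed

lemma AE_run_bound:
  assumes \<tau>: "\<tau> \<in> adm y" "y \<in> {a..b}" and B: "\<And>s. s \<in> {a..b} \<Longrightarrow> \<bar>g s\<bar> \<le> B"
  shows "AE \<omega> in M. norm (run y g \<tau> \<omega>) \<le> B / (2 * r)"
  using adm_range[OF \<tau>] AE_space
proof eventually_elim
  case (elim \<omega>)
  show ?case unfolding real_norm_def
    by (rule run_bound) (use elim admD(2)[OF \<tau>(1)] B in auto)
qed

lemma run_integrable:
  assumes \<tau>: "\<tau> \<in> adm y" "y \<in> {a..b}" and g: "g \<in> borel_measurable borel"
    and B: "\<And>s. s \<in> {a..b} \<Longrightarrow> \<bar>g s\<bar> \<le> B"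
  shows "integrable M (run y g \<tau>)"
proof (rule integrable_const_bound)
  show "AE \<omega> in M. norm (run y g \<tau> \<omega>) \<le> B / (2 * r)"
    by (rule AE_run_bound[OF \<tau> B])
qed (intro run_meas admD[OF \<tau>(1)] g)

lemma payoff_meas:
  assumes \<tau>: "\<tau> \<in> adm y" and [measurable]: "v \<in> borel_measurable borel"
  shows "(\<lambda>\<omega>. exp (- 2 * r * \<tau> \<omega>) * v (S y (\<tau> \<omega>) \<omega>)) \<in> borel_measurable M"
  using S_stop_meas[OF admD(3,2)[OF \<tau>], of y] admD(3)[OF \<tau>] by measurable

lemma payoff_integrable:
  assumes \<tau>: "\<tau> \<in> adm y" "y \<in> {a..b}" and v: "v \<in> borel_measurable borel"
    and B: "\<And>s. s \<in> {a..b} \<Longrightarrow> \<bar>v s\<bar> \<le> B"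
  shows "integrable M (\<lambda>\<omega>. exp (- 2 * r * \<tau> \<omega>) * v (S y (\<tau> \<omega>) \<omega>))"
proof (rule integrable_const_bound)
  show "AE \<omega> in M. norm (exp (- 2 * r * \<tau> \<omega>) * v (S y (\<tau> \<omega>) \<omega>)) \<le> 1 * B"
    using adm_range[OF \<tau>] AE_space
  proof eventually_elim
    case (elim \<omega>)
    have t: "0 \<le> \<tau> \<omega>" using admD(2)[OF \<tau>(1)] elim by auto
    hence "S y (\<tau> \<omega>) \<omega> \<in> {a..b}" using elim by auto
    thus ?case unfolding norm_mult using t r B by (intro mult_mono) auto
  qed
qed (intro payoff_meas \<tau> v)

lemma powr_bound:
  assumes "s \<in> {a..b}"
  shows "\<bar>s powr k\<bar> \<le> max (a powr k) (b powr k)"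
proof (cases "k \<ge> 0")
  case True
  have "s powr k \<le> b powr k" using True assms a by (intro powr_mono2) auto
  thus ?thesis by simp
next
  case False
  have "s powr k \<le> a powr k" using False assms a by (intro powr_mono2') auto
  thus ?thesis by simp
qed

text \<open>The exponential formula applies to the bounded times \<open>min \<tau> n\<close>. Almost
  every path stays in \<open>{a..b}\<close> up to \<open>\<tau>\<close>, where the power is bounded,
  and this dominates both sides as \<open>n\<close> grows.\<close>

lemma dynkin:
  assumes \<tau>: "\<tau> \<in> adm y" "y \<in> {a..b}"
  shows "Q k * disc_run M W r \<sigma> y (\<lambda>s. s powr k) \<tau>
    = expectation (\<lambda>\<omega>. exp (- 2 * r * \<tau> \<omega>) * S y (\<tau> \<omega>) \<omega> powr k) - y powr k"
proof -
  have y: "0 < y" using \<tau>(2) a by simp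
  define B where "B = max (a powr k) (b powr k)"
  define \<tau>n where "\<tau>n = (\<lambda>n \<omega>. min (\<tau> \<omega>) (real n))"
  define g where "g = (\<lambda>s::real. s powr k)"
  have gm: "g \<in> borel_measurable borel" by (simp add: g_def)
  have adm_n: "\<tau>n n \<in> adm y" for n
    using \<tau>(1) by (auto simp: adm_stops_def \<tau>n_def min_le_iff_disj intro: stopping_min elim!: eventually_mono)
  have B: "\<bar>g s\<bar> \<le> B" if "s \<in> {a..b}" for s unfolding g_def B_def by (rule powr_bound[OF that])
  have step: "Q k * expectation (run y g (\<tau>n n))
    = expectation (\<lambda>\<omega>. exp (- 2 * r * \<tau>n n \<omega>) * g (S y (\<tau>n n \<omega>) \<omega>)) - y powr k" for n
  proof -
    have bd: "0 \<le> \<tau>n n \<omega> \<and> \<tau>n n \<omega> \<le> real n" if "\<omega> \<in> space M" for \<omega>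
      using admD(2)[OF \<tau>(1) that] by (auto simp: \<tau>n_def)
    note D = dynkin_exponential[OF admD(1)[OF adm_n] bd, of "Q k" "k * \<sigma>"]
    have "run y g (\<tau>n n) \<omega> = y powr k * (LINT u:{0..\<tau>n n \<omega>}|lborel. exp (Q k * u) * Z (k * \<sigma>) u \<omega>)" for \<omega>
      unfolding g_def S_power[OF y] by (rule set_integral_mult_right)
    hence "Q k * expectation (run y g (\<tau>n n)) =
        y powr k * (Q k * expectation (\<lambda>\<omega>. LINT u:{0..\<tau>n n \<omega>}|lborel. exp (Q k * u) * Z (k * \<sigma>) u \<omega>))"
      by simp
    also have "\<dots> = y powr k * expectation (\<lambda>\<omega>. exp (Q k * \<tau>n n \<omega>) * Z (k * \<sigma>) (\<tau>n n \<omega>) \<omega>) - y powr k"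
      using arg_cong[OF D(3), of "\<lambda>z. y powr k * z"] by (simp only: right_diff_distrib mult_1_right)
    also have "y powr k * expectation (\<lambda>\<omega>. exp (Q k * \<tau>n n \<omega>) * Z (k * \<sigma>) (\<tau>n n \<omega>) \<omega>)
        = expectation (\<lambda>\<omega>. y powr k * (exp (Q k * \<tau>n n \<omega>) * Z (k * \<sigma>) (\<tau>n n \<omega>) \<omega>))" by simp
    also have "(\<lambda>\<omega>. y powr k * (exp (Q k * \<tau>n n \<omega>) * Z (k * \<sigma>) (\<tau>n n \<omega>) \<omega>)) =
        (\<lambda>\<omega>. exp (- 2 * r * \<tau>n n \<omega>) * g (S y (\<tau>n n \<omega>) \<omega>))"
      unfolding g_def S_power[OF y] ..
    finally show ?thesis .
  qed
  \<comment> \<open>As \<open>\<tau>\<close> is finite, the truncated times are eventually equal to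
    it on each path, so any expression that depends only on the value of the time converges.\<close>
  have ev: "\<forall>\<^sub>F n in sequentially. \<tau>n n \<omega> = \<tau> \<omega>" for \<omega>
  proof -
    obtain N where "\<tau> \<omega> \<le> real N" using real_arch_simple by blast
    thus ?thesis by (intro eventually_sequentiallyI[of N]) (auto simp: \<tau>n_def min_def)
  qed
  have lim: "(\<lambda>n. F (\<tau>n n) \<omega>) \<longlonglongrightarrow> F \<tau> \<omega>" if "\<And>t t'. t \<omega> = t' \<omega> \<Longrightarrow> F t \<omega> = F t' \<omega>" for F :: "('a \<Rightarrow> real) \<Rightarrow> 'a \<Rightarrow> real" and \<omega>
    by (rule tendsto_eventually, rule eventually_mono[OF ev[of \<omega>]], rule that)
  have L1: "(\<lambda>n. expectation (run y g (\<tau>n n))) \<longlonglongrightarrow> expectation (run y g \<tau>)"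
  proof (rule integral_dominated_convergence[where w="\<lambda>_. B / (2 * r)"])
    show "AE \<omega> in M. norm (run y g (\<tau>n n) \<omega>) \<le> B / (2 * r)" for n
      by (rule AE_run_bound[OF adm_n \<tau>(2) B])
    show "AE \<omega> in M. (\<lambda>n. run y g (\<tau>n n) \<omega>) \<longlonglongrightarrow> run y g \<tau> \<omega>"
      by (intro AE_I2 lim) simp
  qed (intro run_meas gm admD(3)[OF adm_n] admD(3)[OF \<tau>(1)] integrable_const)+
  have L2: "(\<lambda>n. expectation (\<lambda>\<omega>. exp (- 2 * r * \<tau>n n \<omega>) * g (S y (\<tau>n n \<omega>) \<omega>))) \<longlonglongrightarrow>
    expectation (\<lambda>\<omega>. exp (- 2 * r * \<tau> \<omega>) * g (S y (\<tau> \<omega>) \<omega>))"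
  proof (rule integral_dominated_convergence[where w="\<lambda>_. 1 * B"])
    show "AE \<omega> in M. norm (exp (- 2 * r * \<tau>n n \<omega>) * g (S y (\<tau>n n \<omega>) \<omega>)) \<le> 1 * B" for n
      using adm_range[OF adm_n \<tau>(2), of n] AE_space
    proof eventually_elim
      case (elim \<omega>)
      have t: "0 \<le> \<tau>n n \<omega>" using admD(2)[OF adm_n] elim by auto
      hence "S y (\<tau>n n \<omega>) \<omega> \<in> {a..b}" using elim by auto
      thus ?case unfolding norm_mult using t r B by (intro mult_mono) auto
    qed
    show "AE \<omega> in M. (\<lambda>n. exp (- 2 * r * \<tau>n n \<omega>) * g (S y (\<tau>n n \<omega>) \<omega>)) \<longlonglongrightarrow> exp (- 2 * r * \<tau> \<omega>) * g (S y (\<tau> \<omega>) \<omega>)"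
      by (intro AE_I2 lim[of _ "\<lambda>t \<omega>. exp (- 2 * r * t \<omega>) * g (S y (t \<omega>) \<omega>)"]) simp
  qed (intro payoff_meas gm adm_n \<tau> integrable_const)+
  have "(\<lambda>n. Q k * expectation (run y g (\<tau>n n))) \<longlonglongrightarrow> Q k * expectation (run y g \<tau>)"
    by (intro tendsto_intros L1)
  moreover have "(\<lambda>n. Q k * expectation (run y g (\<tau>n n))) \<longlonglongrightarrow>
      expectation (\<lambda>\<omega>. exp (- 2 * r * \<tau> \<omega>) * g (S y (\<tau> \<omega>) \<omega>)) - y powr k"
    unfolding step by (intro tendsto_intros L2)
  ultimately have "Q k * expectation (run y g \<tau>) = expectation (\<lambda>\<omega>. exp (- 2 * r * \<tau> \<omega>) * g (S y (\<tau> \<omega>) \<omega>)) - y powr k"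
    by (rule LIMSEQ_unique)
  thus ?thesis by (simp add: disc_run_def g_def)
qed

end

section \<open>Discounted costs and payoffs\<close>

context gbm_interval
begin

text \<open>Stopped paths remain in \<open>{a..b}\<close> only almost surely, so measurability is
  demanded on the whole line; continuity on the compact interval supplies the bounds.\<close>

definition nice :: "(real \<Rightarrow> real) \<Rightarrow> bool" where
  "nice g \<longleftrightarrow> g \<in> borel_measurable borel \<and> continuous_on {a..b} g"

abbreviation payoff :: "real \<Rightarrow> (real \<Rightarrow> real) \<Rightarrow> ('a \<Rightarrow> real) \<Rightarrow> real" where
  "payoff y v \<tau> \<equiv> expectation (\<lambda>\<omega>. exp (- 2 * r * \<tau> \<omega>) * v (S y (\<tau> \<omega>) \<omega>))"

lemma nice_bound:
  assumes "nice g"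
  obtains B where "\<And>s. s \<in> {a..b} \<Longrightarrow> \<bar>g s\<bar> \<le> B"
proof -
  have "bounded (g ` {a..b})"
    using assms by (intro compact_imp_bounded compact_continuous_image) (auto simp: nice_def)
  then obtain B where "\<forall>s\<in>{a..b}. \<bar>g s\<bar> \<le> B" unfolding bounded_iff by auto
  hence "\<bar>g s\<bar> \<le> B" if "s \<in> {a..b}" for s using that by blast
  thus ?thesis by (rule that)
qed

lemma nice_lin: "nice g \<Longrightarrow> nice g' \<Longrightarrow> nice (\<lambda>s. \<alpha> * g s + \<beta> * g' s)"
  unfolding nice_def by (auto intro!: continuous_intros)

lemma nice_powr: "nice (\<lambda>s. s powr k)"
  unfolding nice_def using a by (auto intro!: continuous_intros)

context
  fixes y :: real and \<tau> :: "'a \<Rightarrow> real"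
  assumes \<tau>: "\<tau> \<in> adm y" "y \<in> {a..b}"
begin

lemma run_nice_integrable: "nice g \<Longrightarrow> integrable M (run y g \<tau>)"
proof -
  assume g: "nice g"
  obtain B where "\<And>s. s \<in> {a..b} \<Longrightarrow> \<bar>g s\<bar> \<le> B" by (rule nice_bound[OF g]) blast
  thus ?thesis using g by (intro run_integrable \<tau>) (auto simp: nice_def)
qed

lemma payoff_nice_integrable: "nice v \<Longrightarrow> integrable M (\<lambda>\<omega>. exp (- 2 * r * \<tau> \<omega>) * v (S y (\<tau> \<omega>) \<omega>))"
proof -
  assume v: "nice v"
  obtain B where "\<And>s. s \<in> {a..b} \<Longrightarrow> \<bar>v s\<bar> \<le> B" by (rule nice_bound[OF v]) blast
  thus ?thesis using v by (intro payoff_integrable \<tau>) (auto simp: nice_def)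
qed

lemma payoff_lin:
  assumes "nice v" "nice v'"
  shows "payoff y (\<lambda>s. \<alpha> * v s + \<beta> * v' s) \<tau> = \<alpha> * payoff y v \<tau> + \<beta> * payoff y v' \<tau>"
proof -
  have "payoff y (\<lambda>s. \<alpha> * v s + \<beta> * v' s) \<tau> = expectation (\<lambda>\<omega>. \<alpha> * (exp (- 2 * r * \<tau> \<omega>) * v (S y (\<tau> \<omega>) \<omega>)) +
      \<beta> * (exp (- 2 * r * \<tau> \<omega>) * v' (S y (\<tau> \<omega>) \<omega>)))"
    by (intro Bochner_Integration.integral_cong) (auto simp: algebra_simps)
  thus ?thesis using payoff_nice_integrable[OF assms(1)] payoff_nice_integrable[OF assms(2)] by simp
qed

lemma payoff_mono:
  assumes "nice v" "nice v'" "\<And>s. s \<in> {a..b} \<Longrightarrow> v s \<le> v' s"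
  shows "payoff y v \<tau> \<le> payoff y v' \<tau>"
proof (rule integral_mono_AE)
  show "AE \<omega> in M. exp (- 2 * r * \<tau> \<omega>) * v (S y (\<tau> \<omega>) \<omega>) \<le> exp (- 2 * r * \<tau> \<omega>) * v' (S y (\<tau> \<omega>) \<omega>)"
    using adm_range[OF \<tau>] AE_space
    by eventually_elim (use admD(2)[OF \<tau>(1)] assms(3) in \<open>auto intro!: mult_left_mono\<close>)
qed (intro payoff_nice_integrable assms)+

lemma run_lin:
  assumes g: "nice g" "nice g'"
  shows "disc_run M W r \<sigma> y (\<lambda>s. \<alpha> * g s + \<beta> * g' s) \<tau> =
    \<alpha> * disc_run M W r \<sigma> y g \<tau> + \<beta> * disc_run M W r \<sigma> y g' \<tau>"
proof -
  obtain B where B: "\<And>s. s \<in> {a..b} \<Longrightarrow> \<bar>g s\<bar> \<le> B" by (rule nice_bound[OF g(1)]) blast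
  obtain B' where B': "\<And>s. s \<in> {a..b} \<Longrightarrow> \<bar>g' s\<bar> \<le> B'" by (rule nice_bound[OF g(2)]) blast
  have "disc_run M W r \<sigma> y (\<lambda>s. \<alpha> * g s + \<beta> * g' s) \<tau> = expectation (\<lambda>\<omega>. \<alpha> * run y g \<tau> \<omega> + \<beta> * run y g' \<tau> \<omega>)"
    unfolding disc_run_def
  proof (rule integral_cong_AE)
    show "AE \<omega> in M. run y (\<lambda>s. \<alpha> * g s + \<beta> * g' s) \<tau> \<omega> = \<alpha> * run y g \<tau> \<omega> + \<beta> * run y g' \<tau> \<omega>"
      using adm_range[OF \<tau>] AE_space
    proof eventually_elim
      case (elim \<omega>)
      have i: "set_integrable lborel {0..\<tau> \<omega>} (\<lambda>u. exp (- 2 * r * u) * g (S y u \<omega>))"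
        using elim g B by (intro run_inner_integrable[where B=B]) (auto simp: nice_def)
      have i': "set_integrable lborel {0..\<tau> \<omega>} (\<lambda>u. exp (- 2 * r * u) * g' (S y u \<omega>))"
        using elim g B' by (intro run_inner_integrable[where B=B']) (auto simp: nice_def)
      have "run y (\<lambda>s. \<alpha> * g s + \<beta> * g' s) \<tau> \<omega> =
          (LINT u:{0..\<tau> \<omega>}|lborel. \<alpha> * (exp (- 2 * r * u) * g (S y u \<omega>)) + \<beta> * (exp (- 2 * r * u) * g' (S y u \<omega>)))"
        by (simp add: algebra_simps)
      also have "\<dots> = \<alpha> * run y g \<tau> \<omega> + \<beta> * run y g' \<tau> \<omega>"
        using set_integral_add(2)[OF set_integrable_mult_right[OF i, of \<alpha>] set_integrable_mult_right[OF i', of \<beta>]]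
        by (simp only: set_integral_mult_right)
      finally show ?case .
    qed
    have m: "run y g \<tau> \<in> borel_measurable M" "run y g' \<tau> \<in> borel_measurable M"
      "run y (\<lambda>s. \<alpha> * g s + \<beta> * g' s) \<tau> \<in> borel_measurable M"
      using g nice_lin[OF g, of \<alpha> \<beta>] by (auto simp only: nice_def intro!: run_meas admD(3)[OF \<tau>(1)])
    show "run y (\<lambda>s. \<alpha> * g s + \<beta> * g' s) \<tau> \<in> borel_measurable M" by (rule m)
    show "(\<lambda>\<omega>. \<alpha> * run y g \<tau> \<omega> + \<beta> * run y g' \<tau> \<omega>) \<in> borel_measurable M"
      by (intro borel_measurable_add borel_measurable_times borel_measurable_const m)
  qed
  also have "\<dots> = \<alpha> * expectation (run y g \<tau>) + \<beta> * expectation (run y g' \<tau>)"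
    using run_nice_integrable[OF g(1)] run_nice_integrable[OF g(2)] by simp
  finally show ?thesis by (simp add: disc_run_def)
qed

lemma run_mono:
  assumes g: "nice g" "nice g'" "\<And>s. s \<in> {a..b} \<Longrightarrow> g s \<le> g' s"
  shows "disc_run M W r \<sigma> y g \<tau> \<le> disc_run M W r \<sigma> y g' \<tau>"
proof -
  have n: "nice (\<lambda>s. 1 * g' s + (-1) * g s)" by (intro nice_lin g)
  have "0 \<le> disc_run M W r \<sigma> y (\<lambda>s. 1 * g' s + (-1) * g s) \<tau>"
    unfolding disc_run_def
  proof (rule integral_nonneg_AE)
    show "AE \<omega> in M. 0 \<le> run y (\<lambda>s. 1 * g' s + (-1) * g s) \<tau> \<omega>"
      using adm_range[OF \<tau>] AE_space
      by eventually_elim (use g(3) in \<open>auto simp: set_lebesgue_integral_def indicator_def intro!: Bochner_Integration.integral_nonneg\<close>)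
  qed
  thus ?thesis unfolding run_lin[OF g(2,1)] by simp
qed

end

lemma run_zero: "disc_run M W r \<sigma> y g (\<lambda>_. 0) = 0"
proof -
  have "run y g (\<lambda>_. 0) = (\<lambda>_. 0)"
  proof
    fix \<omega>
    have "AE u in lborel. indicator {0..0::real} u *\<^sub>R (exp (- 2 * r * u) * g (S y u \<omega>)) = 0"
      using AE_lborel_singleton[of "0::real"] by eventually_elim simp
    thus "run y g (\<lambda>_. 0) \<omega> = 0" unfolding set_lebesgue_integral_def by (rule integral_eq_zero_AE)
  qed
  thus ?thesis by (simp add: disc_run_def)
qed

lemma payoff_zero: "payoff y v (\<lambda>_. 0) = v y"
proof -
  have "payoff y v (\<lambda>_. 0) = expectation (\<lambda>_. v y)"
    by (intro Bochner_Integration.integral_cong) (auto simp: S_0)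
  thus ?thesis by (simp add: prob_space)
qed

text \<open>From a start strictly inside, the exit time is positive and \<open>g\<close> is positive
  along the path before it. A vanishing inner integral would make the time interval before the exit
  a null set.\<close>

lemma run_pos:
  assumes lm: "a \<le> l" "m \<le> b" and y: "l < y" "y < m" and g: "nice g"
    and pos: "\<And>s. s \<in> {l<..<m} \<Longrightarrow> 0 < g s" and nonneg: "\<And>s. s \<in> {l..m} \<Longrightarrow> 0 \<le> g s"
  shows "0 < disc_run M W r \<sigma> y g (exit_stop l m y)"
proof -
  define \<tau> where "\<tau> = exit_stop l m y"
  have \<tau>: "\<tau> \<in> adm y" unfolding \<tau>_def using lm y by (intro exit_stop_adm) auto
  have y': "y \<in> {a..b}" "y \<in> {l..m}" "0 < y" "0 < l" "l < m" using lm y a by auto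
  obtain B where B: "\<And>s. s \<in> {a..b} \<Longrightarrow> \<bar>g s\<bar> \<le> B" by (rule nice_bound[OF g]) blast
  have runpos: "AE \<omega> in M. 0 < run y g \<tau> \<omega>"
    using AE_exits[OF y'(3,4,5)] AE_space
  proof eventually_elim
    case (elim \<omega>)
    note f = exit_time_facts[OF y'(2) elim(2,1)]
    have e: "\<tau> \<omega> = exit_time W r \<sigma> l m y \<omega>" using elim by (simp add: \<tau>_def exit_stop_def)
    note f = f[folded e]
    have e0: "0 < \<tau> \<omega>"
    proof (rule ccontr)
      assume "\<not> 0 < \<tau> \<omega>"
      hence "\<tau> \<omega> = 0" using f(1) by simp
      thus False using f(2) S_0[OF elim(2)] y by auto
    qed
    have range: "S y u \<omega> \<in> {l..m}" if "u \<in> {0..\<tau> \<omega>}" for u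
      using f(2) f(3)[of u] that y by (cases "u = \<tau> \<omega>") auto
    define h where "h = (\<lambda>u. indicator {0..\<tau> \<omega>} u *\<^sub>R (exp (- 2 * r * u) * g (S y u \<omega>)))"
    have hint: "integrable lborel h"
      unfolding h_def set_integrable_def[symmetric]
    proof (rule run_inner_integrable[OF elim(2)])
      show "g \<in> borel_measurable borel" using g by (simp add: nice_def)
      fix u assume "u \<in> {0..\<tau> \<omega>}"
      from range[OF this] show "\<bar>g (S y u \<omega>)\<bar> \<le> B" using lm by (intro B) auto
    qed
    have hnn: "0 \<le> h u" for u using range[of u] nonneg by (auto simp: h_def indicator_def)
    have "integral\<^sup>L lborel h \<noteq> 0"
    proof
      assume "integral\<^sup>L lborel h = 0"
      hence "AE u in lborel. h u = 0"
        using integral_nonneg_eq_0_iff_AE[OF hint] hnn by auto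
      hence "AE u in lborel. u \<notin> {0<..<\<tau> \<omega>}"
      proof eventually_elim
        case (elim u)
        have "0 < h u" if "u \<in> {0<..<\<tau> \<omega>}"
          using that pos[OF f(3)[of u]] by (simp add: h_def)
        thus ?case using elim by auto
      qed
      hence "emeasure lborel {0<..<\<tau> \<omega>} = 0"
        by (subst (asm) AE_iff_measurable[of "{0<..<\<tau> \<omega>}"]) auto
      thus False using e0 by simp
    qed
    moreover have "0 \<le> integral\<^sup>L lborel h" using hnn by (intro Bochner_Integration.integral_nonneg) auto
    moreover have "run y g \<tau> \<omega> = integral\<^sup>L lborel h" by (simp add: h_def set_lebesgue_integral_def)
    ultimately show ?case by simp
  qed
  have int: "integrable M (run y g \<tau>)" by (rule run_nice_integrable[OF \<tau> y'(1) g])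
  have nn: "AE \<omega> in M. 0 \<le> run y g \<tau> \<omega>" using runpos by eventually_elim simp
  have "expectation (run y g \<tau>) \<noteq> 0"
  proof
    assume "expectation (run y g \<tau>) = 0"
    hence "AE \<omega> in M. run y g \<tau> \<omega> = 0" using integral_nonneg_eq_0_iff_AE[OF int nn] by simp
    with runpos have "AE \<omega> in M. False" by eventually_elim simp
    thus False by simp
  qed
  moreover have "0 \<le> expectation (run y g \<tau>)" by (rule integral_nonneg_AE[OF nn])
  ultimately show ?thesis by (simp add: disc_run_def \<tau>_def)
qed

text \<open>The constant \<open>c\<close> stands for the unspecified value of \<open>Inf {}\<close>.\<close>

lemma run_exit_cong:
  assumes lm: "0 < l" "l < m" and y: "y \<in> {l..m}" and g: "g \<in> borel_measurable borel"
    and T: "\<And>\<omega>. \<omega> \<in> space M \<Longrightarrow> T \<omega> = (if \<exists>t\<ge>0. S y t \<omega> \<notin> {l<..<m} then exit_stop l m y \<omega> else c)"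
  shows "disc_run M W r \<sigma> y g T = disc_run M W r \<sigma> y g (exit_stop l m y)"
  unfolding disc_run_def
proof (rule integral_cong_AE)
  have y0: "0 < y" using y lm by auto
  define N where "N = {\<omega> \<in> space M. \<forall>t\<ge>0. S y t \<omega> \<in> {l<..<m}}"
  have [measurable]: "N \<in> events" unfolding N_def using never_exit_null[OF y0 lm] by auto
  have em [measurable]: "exit_stop l m y \<in> borel_measurable M"
    by (rule stopping_meas[OF exit_stop_stopping[OF y lm]])
  have "T \<in> borel_measurable M \<longleftrightarrow> (\<lambda>\<omega>. if \<omega> \<in> N then c else exit_stop l m y \<omega>) \<in> borel_measurable M"
    by (intro measurable_cong) (auto simp: T N_def)
  hence "T \<in> borel_measurable M" by simp
  thus "run y g T \<in> borel_measurable M" by (rule run_meas[OF _ g])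
  show "run y g (exit_stop l m y) \<in> borel_measurable M" by (rule run_meas[OF em g])
  show "AE \<omega> in M. run y g T \<omega> = run y g (exit_stop l m y) \<omega>"
    using AE_exits[OF y0 lm] AE_space by eventually_elim (simp add: T)
qed

lemma payoff_exit:
  assumes lm: "a \<le> l" "l < m" "m \<le> b" and y: "y \<in> {l..m}" and v: "nice v" "nice v'"
    and eq: "v l = v' l" "v m = v' m"
  shows "payoff y v (exit_stop l m y) = payoff y v' (exit_stop l m y)"
proof (rule integral_cong_AE)
  have adm: "exit_stop l m y \<in> adm y" by (rule exit_stop_adm[OF lm y])
  have y0: "0 < y" "0 < l" using y lm a by auto
  show "AE \<omega> in M. exp (- 2 * r * exit_stop l m y \<omega>) * v (S y (exit_stop l m y \<omega>) \<omega>) =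
      exp (- 2 * r * exit_stop l m y \<omega>) * v' (S y (exit_stop l m y \<omega>) \<omega>)"
    using AE_exits[OF y0 lm(2)] AE_space
  proof eventually_elim
    case (elim \<omega>)
    have "S y (exit_stop l m y \<omega>) \<omega> \<in> {l,m}"
      using exit_time_facts(2)[OF y elim(2,1)] elim by (simp add: exit_stop_def)
    thus ?case using eq by auto
  qed
qed (use v in \<open>auto simp only: nice_def intro!: payoff_meas exit_stop_adm lm y\<close>)

text \<open>For a \<open>C\<^sup>2\<close> function \<open>w\<close>, \<open>dynkin_pair g w\<close> means that \<open>(L - 2r) w = - g\<close>.\<close>

definition dynkin_pair :: "(real \<Rightarrow> real) \<Rightarrow> (real \<Rightarrow> real) \<Rightarrow> bool" where
  "dynkin_pair g w \<longleftrightarrow> nice g \<and> nice w \<and>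
    (\<forall>y\<in>{a..b}. \<forall>\<tau>\<in>adm y. disc_run M W r \<sigma> y g \<tau> = w y - payoff y w \<tau>)"

lemma dynkin_pairD:
  assumes "dynkin_pair g w"
  shows "nice g" "nice w" "y \<in> {a..b} \<Longrightarrow> \<tau> \<in> adm y \<Longrightarrow> disc_run M W r \<sigma> y g \<tau> = w y - payoff y w \<tau>"
  using assms by (auto simp: dynkin_pair_def)

lemma dynkin_pair_lin:
  assumes "dynkin_pair g w" "dynkin_pair g' w'"
  shows "dynkin_pair (\<lambda>s. \<alpha> * g s + \<beta> * g' s) (\<lambda>s. \<alpha> * w s + \<beta> * w' s)"
  unfolding dynkin_pair_def
proof (intro conjI ballI nice_lin)
  fix y \<tau> assume y: "y \<in> {a..b}" and \<tau>: "\<tau> \<in> adm y"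
  show "disc_run M W r \<sigma> y (\<lambda>s. \<alpha> * g s + \<beta> * g' s) \<tau> = (\<alpha> * w y + \<beta> * w' y) - payoff y (\<lambda>s. \<alpha> * w s + \<beta> * w' s) \<tau>"
    unfolding run_lin[OF \<tau> y dynkin_pairD(1)[OF assms(1)] dynkin_pairD(1)[OF assms(2)]]
      payoff_lin[OF \<tau> y dynkin_pairD(2)[OF assms(1)] dynkin_pairD(2)[OF assms(2)]]
      dynkin_pairD(3)[OF assms(1) y \<tau>] dynkin_pairD(3)[OF assms(2) y \<tau>]
    by (simp add: algebra_simps)
qed (use assms in \<open>auto simp: dynkin_pair_def\<close>)

lemma dynkin_pair_cong:
  assumes "dynkin_pair g w" "nice g'" "\<And>s. s \<in> {a..b} \<Longrightarrow> g' s = g s"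
  shows "dynkin_pair g' w"
proof -
  have "disc_run M W r \<sigma> y g' \<tau> = disc_run M W r \<sigma> y g \<tau>" if "y \<in> {a..b}" "\<tau> \<in> adm y" for y \<tau>
    using that assms by (intro antisym run_mono) (auto dest: dynkin_pairD)
  thus ?thesis using assms by (auto simp: dynkin_pair_def)
qed

text \<open>The summand \<open>0 * s powr k\<close> gives the function the shape of the linearity
  rules \<open>nice_lin\<close> and \<open>payoff_lin\<close>.\<close>

lemma dynkin_pair_powr:
  assumes "Q k \<noteq> 0"
  shows "dynkin_pair (\<lambda>s. s powr k) (\<lambda>s. (- 1 / Q k) * s powr k + 0 * s powr k)"
  unfolding dynkin_pair_def
proof (intro conjI ballI nice_lin nice_powr)
  fix y \<tau> assume y: "y \<in> {a..b}" and \<tau>: "\<tau> \<in> adm y"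
  show "disc_run M W r \<sigma> y (\<lambda>s. s powr k) \<tau> =
      ((- 1 / Q k) * y powr k + 0 * y powr k) - payoff y (\<lambda>s. (- 1 / Q k) * s powr k + 0 * s powr k) \<tau>"
    unfolding payoff_lin[OF \<tau> y nice_powr nice_powr]
    using dynkin[OF \<tau> y, of k] assms by (simp add: field_simps)
qed

text \<open>At a root of \<open>Q\<close> the discounted power has no drift, so its payoff is the
  same for all admissible times.\<close>

lemma dynkin_pair_zero:
  assumes "Q k = 0"
  shows "dynkin_pair (\<lambda>_. 0) (\<lambda>s. s powr k)"
  unfolding dynkin_pair_def
proof (intro conjI ballI nice_powr)
  show "nice (\<lambda>_. 0)" by (simp add: nice_def)
  fix y \<tau> assume y: "y \<in> {a..b}" and \<tau>: "\<tau> \<in> adm y"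
  have "disc_run M W r \<sigma> y (\<lambda>_. 0) \<tau> = 0" by (simp add: disc_run_def)
  thus "disc_run M W r \<sigma> y (\<lambda>_. 0) \<tau> = y powr k - payoff y (\<lambda>s. s powr k) \<tau>"
    using dynkin[OF \<tau> y, of k] assms by simp
qed

text \<open>Two sign changes: \<open>Q\<close> is negative at \<open>0\<close> and positive at
  \<open>2\<close> and at \<open>n\<close>, which is \<open>- 2 * dpar r \<sigma>\<close> and gives
  \<open>Q\<close> the value \<open>(2 * r)^2 / \<sigma>^2\<close>.\<close>

lemma Q_roots: obtains p q where "Q p = 0" "Q q = 0" "q < p"
proof -
  have Qc: "continuous_on X Q" for X unfolding Q_def[abs_def] by (intro continuous_intros)
  have 0: "Q 0 < 0" using r by (simp add: Q_def)
  have 2: "Q 2 > 0" using \<sigma> by (simp add: Q_def)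
  define n where "n = - (2 * (2 * r / \<sigma>\<^sup>2))"
  have n: "Q n > 0" "n < 0"
  proof -
    have "Q n = (2 * r)\<^sup>2 / \<sigma>\<^sup>2" using \<sigma> by (simp add: Q_def n_def power2_eq_square field_simps)
    thus "Q n > 0" using r \<sigma> by simp
    show "n < 0" using r \<sigma> by (simp add: n_def)
  qed
  obtain p where p: "0 \<le> p" "p \<le> 2" "Q p = 0" using IVT'[of Q 0 0 2] 0 2 Qc by auto
  obtain q where q: "n \<le> q" "q \<le> 0" "Q q = 0" using IVT2'[of Q 0 0 n] 0 n Qc by auto
  have "q \<noteq> 0" using 0 q by auto
  thus thesis using p q that[of p q] by auto
qed

lemma harmonic_payoff:
  assumes "Q p = 0" "Q q = 0" "y \<in> {a..b}" "\<tau> \<in> adm y"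
  shows "payoff y (\<lambda>s. c * s powr p + d * s powr q) \<tau> = c * y powr p + d * y powr q"
proof -
  have "dynkin_pair (\<lambda>s. c * 0 + d * 0) (\<lambda>s. c * s powr p + d * s powr q)"
    by (intro dynkin_pair_lin dynkin_pair_zero assms)
  from dynkin_pairD(3)[OF this assms(3,4)] show ?thesis by (simp add: disc_run_def)
qed

text \<open>Subtracting from \<open>w\<close> the combination of the two driftless powers with the
  same boundary values keeps the pairing. The difference vanishes at \<open>a\<close> and
  \<open>b\<close>, so its payoff at the exit drops out and it equals the running cost.\<close>

lemma dynkin_pair_exit:
  assumes "dynkin_pair g w"
  obtains \<gamma> where "dynkin_pair g \<gamma>" "\<gamma> a = 0" "\<gamma> b = 0"
    "\<And>y. y \<in> {a..b} \<Longrightarrow> disc_run M W r \<sigma> y g (exit_stop a b y) = \<gamma> y"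
    "\<And>y. y \<in> {a..b} \<Longrightarrow> disc_run M W r \<sigma> y g (exit_time W r \<sigma> a b y) = \<gamma> y"
proof -
  obtain p q where pq: "Q p = 0" "Q q = 0" "q < p" by (rule Q_roots)
  obtain c d where cd: "c * a powr p + d * a powr q = w a" "c * b powr p + d * b powr q = w b"
    by (rule power_interpolation[OF a ab pq(3)])
  define \<gamma> where "\<gamma> = (\<lambda>s. 1 * w s + (- 1) * (c * s powr p + d * s powr q))"
  have "dynkin_pair (\<lambda>s. 1 * g s + (- 1) * (c * 0 + d * 0)) \<gamma>"
    unfolding \<gamma>_def by (intro dynkin_pair_lin dynkin_pair_zero assms pq)
  hence D: "dynkin_pair g \<gamma>" by simp
  have g0: "\<gamma> a = 0" "\<gamma> b = 0" using cd by (auto simp: \<gamma>_def)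
  have ex: "disc_run M W r \<sigma> y g (exit_stop a b y) = \<gamma> y" if y: "y \<in> {a..b}" for y
  proof -
    have adm: "exit_stop a b y \<in> adm y" using y ab by (intro exit_stop_adm) auto
    have "payoff y \<gamma> (exit_stop a b y) = payoff y (\<lambda>_. 0) (exit_stop a b y)"
      using g0 y ab dynkin_pairD(2)[OF D] by (intro payoff_exit) (auto simp: nice_def)
    thus ?thesis using dynkin_pairD(3)[OF D y adm] by simp
  qed
  moreover have "disc_run M W r \<sigma> y g (exit_time W r \<sigma> a b y) = \<gamma> y" if y: "y \<in> {a..b}" for y
    unfolding ex[OF y, symmetric]
  proof (rule run_exit_cong[OF a ab y, where c="Inf {}"])
    show "g \<in> borel_measurable borel" using assms by (auto simp: dynkin_pair_def nice_def)
    fix \<omega>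
    show "exit_time W r \<sigma> a b y \<omega> = (if \<exists>t\<ge>0. S y t \<omega> \<notin> {a<..<b} then exit_stop a b y \<omega> else Inf {})"
    proof (cases "\<exists>t\<ge>0. S y t \<omega> \<notin> {a<..<b}")
      case False
      hence "{t. 0 \<le> t \<and> S y t \<omega> \<notin> {a<..<b}} = {}" by blast
      hence "exit_time W r \<sigma> a b y \<omega> = Inf {}" unfolding exit_time_def by (rule arg_cong)
      thus ?thesis unfolding if_not_P[OF False] .
    qed (simp add: exit_stop_def)
  qed
  ultimately show thesis by (rule that[OF D g0])
qed

end

section \<open>The hedging problem\<close>

text \<open>A minimum principle: after division by \<open>s powr q\<close> the function is either
  constant or strictly monotone in \<open>s\<close>, so its value at \<open>x\<close> cannot fall to
  the smaller end value unless both end values agree.\<close>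

lemma power_interpolation_pos:
  fixes l x m p q c d :: real
  assumes lx: "0 < l" "l < x" "x < m" and pq: "q < p"
    and nn: "0 \<le> c * l powr p + d * l powr q" "0 \<le> c * m powr p + d * m powr q"
    and pos: "0 < c * l powr p + d * l powr q \<or> 0 < c * m powr p + d * m powr q"
  shows "0 < c * x powr p + d * x powr q"
proof -
  define f where "f = (\<lambda>s. c * s powr (p - q) + d)"
  have eq: "c * s powr p + d * s powr q = f s * s powr q" if "0 < s" for s
    using that by (simp add: f_def algebra_simps flip: powr_add)
  have "l powr (p - q) < x powr (p - q)" "x powr (p - q) < m powr (p - q)"
    using lx pq by (auto intro!: powr_less_mono2)
  moreover have "0 \<le> f l" "0 \<le> f m" "0 < f l \<or> 0 < f m"
    using nn pos lx eq[of l] eq[of m] by (auto simp: zero_le_mult_iff zero_less_mult_iff)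
  ultimately have "0 < f x"
    unfolding f_def by (cases c "0::real" rule: linorder_cases) (smt (verit) mult_le_cancel_left mult_less_cancel_left)+
  thus ?thesis using eq[of x] lx by simp
qed

context gbm_interval
begin

text \<open>Formed with \<open>exit_time\<close>, as \<open>gam1\<close>, \<open>gam2\<close> and
  \<open>gam3\<close> are, so that it matches them on \<open>{a..b}\<close>. The value
  \<open>0\<close> elsewhere makes it a Borel function on the line.\<close>

definition exit_val :: "(real \<Rightarrow> real) \<Rightarrow> real \<Rightarrow> real" where
  "exit_val g y = (if y \<in> {a..b} then disc_run M W r \<sigma> y g (exit_time W r \<sigma> a b y) else 0)"

lemma exit_val:
  assumes "dynkin_pair g w"
  shows "dynkin_pair g (exit_val g)" and "exit_val g a = 0" and "exit_val g b = 0"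
    and "\<And>y. y \<in> {a..b} \<Longrightarrow> exit_val g y = disc_run M W r \<sigma> y g (exit_stop a b y)"
proof -
  obtain \<gamma> where D: "dynkin_pair g \<gamma>" and z: "\<gamma> a = 0" "\<gamma> b = 0"
    and e: "\<And>y. y \<in> {a..b} \<Longrightarrow> disc_run M W r \<sigma> y g (exit_stop a b y) = \<gamma> y"
      "\<And>y. y \<in> {a..b} \<Longrightarrow> disc_run M W r \<sigma> y g (exit_time W r \<sigma> a b y) = \<gamma> y"
    using dynkin_pair_exit[OF assms] by blast
  have v: "exit_val g y = \<gamma> y" if "y \<in> {a..b}" for y using that e by (simp add: exit_val_def)
  have "exit_val g = (\<lambda>y. if y \<in> {a..b} then \<gamma> y else 0)" using e by (auto simp: exit_val_def)
  moreover have "(\<lambda>y. if y \<in> {a..b} then \<gamma> y else 0) \<in> borel_measurable borel"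
    using dynkin_pairD(2)[OF D] by (intro measurable_If) (auto simp: nice_def)
  moreover have "continuous_on {a..b} (exit_val g)"
    using dynkin_pairD(2)[OF D] v by (subst continuous_on_cong[OF refl v]) (auto simp: nice_def)
  ultimately have n: "nice (exit_val g)" by (simp add: nice_def)
  have "payoff y (exit_val g) \<tau> = payoff y \<gamma> \<tau>" if "y \<in> {a..b}" "\<tau> \<in> adm y" for y \<tau>
    using that n v dynkin_pairD(2)[OF D] by (intro antisym payoff_mono) auto
  thus "dynkin_pair g (exit_val g)" using D n v by (auto simp: dynkin_pair_def)
  show "exit_val g a = 0" "exit_val g b = 0" using v z ab by auto
  show "exit_val g y = disc_run M W r \<sigma> y g (exit_stop a b y)" if "y \<in> {a..b}" for y
    using v e that by simp
qed

lemma dynkin_pair_multiple_powr: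
  assumes "Q k \<noteq> 0" "nice g" "\<And>s. s \<in> {a..b} \<Longrightarrow> g s = c * s powr k"
  shows "\<exists>w. dynkin_pair g w"
proof -
  have "dynkin_pair (\<lambda>s. c * s powr k + 0 * s powr k)
      (\<lambda>s. c * ((- 1 / Q k) * s powr k + 0 * s powr k) + 0 * ((- 1 / Q k) * s powr k + 0 * s powr k))"
    by (intro dynkin_pair_lin dynkin_pair_powr assms)
  from dynkin_pair_cong[OF this assms(2)] assms(3) show ?thesis by auto
qed

end

section \<open>The three running costs and the variance after rebalancing\<close>

locale put_hedge = gbm_interval +
  fixes K :: real
  assumes K: "0 < K" and aK: "ahat r \<sigma> K \<le> a"
begin

abbreviation "\<Delta> \<equiv> Pd r \<sigma> K"
abbreviation "mv \<equiv> Mvar M W r \<sigma> K a b"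
abbreviation "V \<equiv> Vfun M W r \<sigma> K a b"
abbreviation "cost1 \<equiv> \<lambda>s. \<sigma>\<^sup>2 * s\<^sup>2"
abbreviation "cost2 \<equiv> \<lambda>s. \<Delta> s * \<sigma>\<^sup>2 * s\<^sup>2"
abbreviation "cost3 \<equiv> \<lambda>s. (\<Delta> s)\<^sup>2 * \<sigma>\<^sup>2 * s\<^sup>2"
abbreviation "\<gamma>1 \<equiv> exit_val cost1"
abbreviation "\<gamma>2 \<equiv> exit_val cost2"
abbreviation "\<gamma>3 \<equiv> exit_val cost3"

lemma d_pos: "0 < dpar r \<sigma>"
  using r \<sigma> by (simp add: dpar_def)

lemma ahat_pos: "0 < ahat r \<sigma> K"
  using K d_pos by (simp add: ahat_def add_pos_pos)

text \<open>Because \<open>ahat r \<sigma> K\<close> is at most \<open>a\<close>, the maximum in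
  \<open>Pd\<close> is attained by the power. This is what turns all three running costs into
  multiples of powers.\<close>

lemma \<Delta>_eq:
  assumes "s \<in> {a..b}"
  shows "\<Delta> s = - (ahat r \<sigma> K powr (1 + dpar r \<sigma>) * s powr (- (1 + dpar r \<sigma>)))"
proof -
  have s: "0 < s" "ahat r \<sigma> K / s \<le> 1" "0 \<le> ahat r \<sigma> K / s" using assms a aK ahat_pos by auto
  have "(ahat r \<sigma> K / s) powr (1 + dpar r \<sigma>) \<le> 1 powr (1 + dpar r \<sigma>)"
    using s d_pos by (intro powr_mono2) auto
  hence "\<Delta> s = - ((ahat r \<sigma> K / s) powr (1 + dpar r \<sigma>))" by (simp add: Pd_def)
  also have "(ahat r \<sigma> K / s) powr (1 + dpar r \<sigma>) = ahat r \<sigma> K powr (1 + dpar r \<sigma>) * s powr (- (1 + dpar r \<sigma>))"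
    unfolding powr_minus using s ahat_pos by (subst powr_divide) (auto simp: divide_inverse)
  finally show ?thesis .
qed

lemma \<Delta>_less: "a \<le> s \<Longrightarrow> s < t \<Longrightarrow> t \<le> b \<Longrightarrow> \<Delta> s < \<Delta> t"
  using a ahat_pos d_pos by (simp add: \<Delta>_eq powr_less_mono2_neg)

lemma \<Delta>_le: "a \<le> s \<Longrightarrow> s \<le> t \<Longrightarrow> t \<le> b \<Longrightarrow> \<Delta> s \<le> \<Delta> t"
  using \<Delta>_less[of s t] by (cases "s = t") auto

lemma \<Delta>_abs: "\<bar>\<Delta> s\<bar> \<le> 1"
  by (auto simp: Pd_def abs_if max_def)

lemma nice_\<Delta>: "nice \<Delta>"
  unfolding nice_def
proof
  show "\<Delta> \<in> borel_measurable borel" unfolding Pd_def by measurable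
  have "continuous_on {a..b} (\<lambda>s. - (ahat r \<sigma> K powr (1 + dpar r \<sigma>) * s powr (- (1 + dpar r \<sigma>))))"
    using a by (intro continuous_intros) auto
  thus "continuous_on {a..b} \<Delta>" by (rule continuous_on_eq) (simp add: \<Delta>_eq)
qed

lemma nice_costs: "nice cost1" "nice cost2" "nice cost3"
  using nice_\<Delta> unfolding nice_def by (auto intro!: continuous_intros)

lemma Q_eq: "Q k = \<sigma>\<^sup>2 / 2 * (k * (k - 1) + dpar r \<sigma> * k - 2 * dpar r \<sigma>)"
proof -
  define d where "d = dpar r \<sigma>"
  have req: "r = \<sigma>\<^sup>2 / 2 * d" using \<sigma> by (simp add: d_def dpar_def)
  have "Q k = \<sigma>\<^sup>2 / 2 * k * (k - 1) + (\<sigma>\<^sup>2 / 2 * d) * k - 2 * (\<sigma>\<^sup>2 / 2 * d)"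
    unfolding Q_def by (simp only: req)
  also have "v * k * (k - 1) + (v * d) * k - 2 * (v * d) = v * (k * (k - 1) + d * k - 2 * d)" for v
    by (simp add: algebra_simps)
  finally show ?thesis by (simp only: d_def)
qed

text \<open>With \<open>d = dpar r \<sigma>\<close> the exponents are \<open>2\<close>,
  \<open>1 - d\<close> and \<open>- 2 * d\<close>, and none of them is a root of
  \<open>Q\<close>.\<close>

lemma cost_pairs: "\<exists>w. dynkin_pair cost1 w" "\<exists>w. dynkin_pair cost2 w" "\<exists>w. dynkin_pair cost3 w"
proof -
  let ?d = "dpar r \<sigma>" and ?A = "ahat r \<sigma> K powr (1 + dpar r \<sigma>)"
  have s: "0 < s" if "s \<in> {a..b}" for s using that a by simp
  have "cost1 s = \<sigma>\<^sup>2 * s powr 2" if "s \<in> {a..b}" for s using s[OF that] by simp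
  moreover have "Q 2 \<noteq> 0" using \<sigma> by (simp add: Q_def)
  ultimately show "\<exists>w. dynkin_pair cost1 w" by (intro dynkin_pair_multiple_powr[OF _ nice_costs(1)])
  have "Q (1 - ?d) = - (\<sigma>\<^sup>2 * ?d)" unfolding Q_eq by (simp add: field_simps)
  hence "Q (1 - ?d) \<noteq> 0" using d_pos \<sigma> by simp
  moreover have "cost2 s = (- ?A * \<sigma>\<^sup>2) * s powr (1 - ?d)" if "s \<in> {a..b}" for s
  proof -
    have "s powr (1 - ?d) = s powr (- (1 + ?d)) * s powr 2" unfolding powr_add[symmetric] by simp
    thus ?thesis using s[OF that] by (simp add: \<Delta>_eq[OF that])
  qed
  ultimately show "\<exists>w. dynkin_pair cost2 w" by (rule dynkin_pair_multiple_powr[OF _ nice_costs(2)])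
  have "Q (- 2 * ?d) = \<sigma>\<^sup>2 * ?d\<^sup>2" unfolding Q_eq by (simp add: field_simps power2_eq_square)
  hence "Q (- 2 * ?d) \<noteq> 0" using d_pos \<sigma> by simp
  moreover have "cost3 s = (?A\<^sup>2 * \<sigma>\<^sup>2) * s powr (- 2 * ?d)" if "s \<in> {a..b}" for s
  proof -
    have "s powr (- 2 * ?d) = s powr (- (1 + ?d)) * s powr (- (1 + ?d)) * s powr 2"
      unfolding powr_add[symmetric] by simp
    thus ?thesis using s[OF that] by (simp add: \<Delta>_eq[OF that] power2_eq_square)
  qed
  ultimately show "\<exists>w. dynkin_pair cost3 w" by (rule dynkin_pair_multiple_powr[OF _ nice_costs(3)])
qed

lemma P1: "dynkin_pair cost1 \<gamma>1" "\<gamma>1 a = 0" "\<gamma>1 b = 0"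
    "y \<in> {a..b} \<Longrightarrow> \<gamma>1 y = disc_run M W r \<sigma> y cost1 (exit_stop a b y)"
  and P2: "dynkin_pair cost2 \<gamma>2" "\<gamma>2 a = 0" "\<gamma>2 b = 0"
    "y \<in> {a..b} \<Longrightarrow> \<gamma>2 y = disc_run M W r \<sigma> y cost2 (exit_stop a b y)"
  and P3: "dynkin_pair cost3 \<gamma>3" "\<gamma>3 a = 0" "\<gamma>3 b = 0"
  using cost_pairs exit_val by blast+

lemma \<gamma>1_pos: "y \<in> {a<..<b} \<Longrightarrow> 0 < \<gamma>1 y"
  using P1(4)[of y] run_pos[of a b y cost1] nice_costs(1) \<sigma> a by auto

lemma \<gamma>1_nonneg: "y \<in> {a..b} \<Longrightarrow> 0 \<le> \<gamma>1 y"
  using \<gamma>1_pos[of y] P1(2,3) by (cases "y = a \<or> y = b") auto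

lemma \<gamma>2_bounds:
  assumes y: "y \<in> {a..b}" and c: "\<And>s. s \<in> {a..b} \<Longrightarrow> c1 \<le> \<Delta> s \<and> \<Delta> s \<le> c2"
  shows "c1 * \<gamma>1 y \<le> \<gamma>2 y" "\<gamma>2 y \<le> c2 * \<gamma>1 y"
proof -
  have adm: "exit_stop a b y \<in> adm y" using y ab by (intro exit_stop_adm) auto
  have m: "disc_run M W r \<sigma> y (\<lambda>s. c * cost1 s + 0 * cost1 s) (exit_stop a b y) = c * \<gamma>1 y" for c
    unfolding run_lin[OF adm y nice_costs(1,1)] P1(4)[OF y] by simp
  have "c1 * cost1 s + 0 * cost1 s \<le> cost2 s" "cost2 s \<le> c2 * cost1 s + 0 * cost1 s" if "s \<in> {a..b}" for s
    using c[OF that] by (auto simp: mult.assoc intro!: mult_right_mono)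
  hence "disc_run M W r \<sigma> y (\<lambda>s. c1 * cost1 s + 0 * cost1 s) (exit_stop a b y) \<le> \<gamma>2 y"
    "\<gamma>2 y \<le> disc_run M W r \<sigma> y (\<lambda>s. c2 * cost1 s + 0 * cost1 s) (exit_stop a b y)"
    unfolding P2(4)[OF y] by (intro run_mono[OF adm y] nice_lin nice_costs; blast)+
  thus "c1 * \<gamma>1 y \<le> \<gamma>2 y" "\<gamma>2 y \<le> c2 * \<gamma>1 y" unfolding m by auto
qed

lemma mv_eq: "mv y = (if a < y \<and> y < b then \<gamma>3 y - (\<gamma>2 y)\<^sup>2 / \<gamma>1 y else 0)"
  by (auto simp: Mvar_def gam1_def gam2_def gam3_def exit_val_def)

text \<open>At \<open>a\<close> and \<open>b\<close> the quotient is \<open>0 / 0\<close>, which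
  evaluates to \<open>0\<close> and so agrees with the prescribed boundary value of
  \<open>mv\<close>.\<close>

lemma mv_closed: "y \<in> {a..b} \<Longrightarrow> mv y = \<gamma>3 y - (\<gamma>2 y)\<^sup>2 / \<gamma>1 y"
  using P1(2,3) P2(2,3) P3(2,3) by (cases "y = a \<or> y = b") (auto simp: mv_eq)

text \<open>Continuity is delicate only at the ends, where the quotient degenerates. As
  \<open>\<Delta>\<close> is bounded by \<open>1\<close>, the modulus of \<open>\<gamma>2\<close> is
  at most \<open>\<gamma>1\<close>; the quotient is then at most \<open>\<gamma>1\<close>, which
  tends to \<open>0\<close>.\<close>

lemma nice_mv: "nice mv"
  unfolding nice_def
proof
  have m [measurable]: "\<gamma>1 \<in> borel_measurable borel" "\<gamma>2 \<in> borel_measurable borel" "\<gamma>3 \<in> borel_measurable borel"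
    using P1(1) P2(1) P3(1) by (auto simp: dynkin_pair_def nice_def)
  have c: "continuous_on {a..b} \<gamma>1" "continuous_on {a..b} \<gamma>2" "continuous_on {a..b} \<gamma>3"
    using P1(1) P2(1) P3(1) by (auto simp: dynkin_pair_def nice_def)
  show "mv \<in> borel_measurable borel" unfolding mv_eq[abs_def] by measurable
  have "continuous_on {a..b} (\<lambda>y. (\<gamma>2 y)\<^sup>2 / \<gamma>1 y)"
    unfolding continuous_on_def
  proof
    fix y assume y: "y \<in> {a..b}"
    have l: "(\<gamma>1 \<longlongrightarrow> \<gamma>1 y) (at y within {a..b})" "(\<gamma>2 \<longlongrightarrow> \<gamma>2 y) (at y within {a..b})"
      using c y by (auto simp: continuous_on_def)
    show "((\<lambda>y. (\<gamma>2 y)\<^sup>2 / \<gamma>1 y) \<longlongrightarrow> (\<gamma>2 y)\<^sup>2 / \<gamma>1 y) (at y within {a..b})"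
    proof (cases "\<gamma>1 y = 0")
      case False
      thus ?thesis by (intro tendsto_intros l)
    next
      case True
      have "((\<lambda>y. (\<gamma>2 y)\<^sup>2 / \<gamma>1 y) \<longlongrightarrow> 0) (at y within {a..b})"
      proof (rule Lim_null_comparison)
        have "norm ((\<gamma>2 z)\<^sup>2 / \<gamma>1 z) \<le> \<gamma>1 z" if z: "z \<in> {a..b}" for z
        proof -
          have "-1 \<le> \<Delta> s \<and> \<Delta> s \<le> 1" for s using \<Delta>_abs[of s] by auto
          hence "\<bar>\<gamma>2 z\<bar> \<le> \<bar>\<gamma>1 z\<bar>" using \<gamma>2_bounds[OF z, of "-1" 1] by auto
          hence "(\<gamma>2 z)\<^sup>2 \<le> (\<gamma>1 z)\<^sup>2" by (simp add: abs_le_square_iff)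
          thus ?thesis using \<gamma>1_nonneg[OF z] by (cases "\<gamma>1 z = 0") (auto simp: power2_eq_square field_simps)
        qed
        thus "\<forall>\<^sub>F z in at y within {a..b}. norm ((\<gamma>2 z)\<^sup>2 / \<gamma>1 z) \<le> \<gamma>1 z"
          by (auto simp: eventually_at_filter)
        show "(\<gamma>1 \<longlongrightarrow> 0) (at y within {a..b})" using l(1) True by simp
      qed
      thus ?thesis using True by simp
    qed
  qed
  hence "continuous_on {a..b} (\<lambda>y. \<gamma>3 y - (\<gamma>2 y)\<^sup>2 / \<gamma>1 y)" by (rule continuous_on_diff[OF c(3)])
  thus "continuous_on {a..b} mv" by (rule continuous_on_eq) (simp add: mv_closed)
qed

text \<open>The cost of holding \<open>h\<close> until the exit from \<open>(a, b)\<close> without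
  rebalancing, nested as a linear combination in the form that \<open>dynkin_pair_lin\<close>
  produces.\<close>

definition F :: "real \<Rightarrow> real \<Rightarrow> real" where
  "F h = (\<lambda>s. 1 * (h\<^sup>2 * \<gamma>1 s + (- 2 * h) * \<gamma>2 s) + 1 * \<gamma>3 s)"

text \<open>Not the function \<open>Gfun\<close>: this is what an immediate rebalancing saves
  compared with keeping \<open>h\<close> until the exit.\<close>

definition G :: "real \<Rightarrow> real \<Rightarrow> real" where
  "G h = (\<lambda>s. 1 * F h s + (- 1) * mv s)"

definition J :: "real \<Rightarrow> ('a \<Rightarrow> real) \<Rightarrow> real \<Rightarrow> real" where
  "J y \<tau> h = disc_run M W r \<sigma> y (\<lambda>s. ffun r \<sigma> K s h) \<tau> + payoff y mv \<tau>"

lemma V_def: "V y h = (INF \<tau>\<in>adm y. J y \<tau> h)"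
  by (simp add: Vfun_def J_def)

lemma ffun_eq: "ffun r \<sigma> K s h = 1 * (h\<^sup>2 * cost1 s + (- 2 * h) * cost2 s) + 1 * cost3 s"
  by (simp add: ffun_def power2_eq_square algebra_simps)

lemma F_pair: "dynkin_pair (\<lambda>s. ffun r \<sigma> K s h) (F h)"
  unfolding ffun_eq F_def by (intro dynkin_pair_lin P1(1) P2(1) P3(1))

lemma nice_F: "nice (F h)" and nice_G: "nice (G h)"
proof -
  show n: "nice (F h)" by (rule dynkin_pairD(2)[OF F_pair])
  show "nice (G h)" unfolding G_def by (rule nice_lin[OF n nice_mv])
qed

lemma J_eq: "y \<in> {a..b} \<Longrightarrow> \<tau> \<in> adm y \<Longrightarrow> J y \<tau> h = F h y - payoff y (G h) \<tau>"
  unfolding J_def G_def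
  by (simp only: payoff_lin[OF _ _ nice_F nice_mv] dynkin_pairD(3)[OF F_pair])

text \<open>\<open>mv y\<close> is the minimum over all real \<open>h\<close> of the quadratic
  \<open>F h y\<close>, so the difference is a completed square.\<close>

lemma G_square: "y \<in> {a<..<b} \<Longrightarrow> G h y = (\<gamma>2 y - h * \<gamma>1 y)\<^sup>2 / \<gamma>1 y"
  using \<gamma>1_pos[of y] by (simp add: G_def F_def mv_eq power2_eq_square field_simps)

lemma G_boundary: "G h a = 0" "G h b = 0"
  using P1(2,3) P2(2,3) P3(2,3) by (auto simp: G_def F_def mv_eq)

lemma G_nonneg: "y \<in> {a..b} \<Longrightarrow> 0 \<le> G h y"
  using G_square[of y h] G_boundary[of h] \<gamma>1_pos[of y] by (cases "y = a \<or> y = b") auto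

lemma J_zero: "y \<in> {a..b} \<Longrightarrow> J y (\<lambda>_. 0) h = mv y"
  unfolding J_def run_zero payoff_zero by simp

section \<open>Optimal stopping for a fixed holding\<close>

lemma harmonic_majorant:
  assumes x: "x \<in> {a<..<b}"
  obtains L l m where "nice L" "\<And>y \<tau>. y \<in> {a..b} \<Longrightarrow> \<tau> \<in> adm y \<Longrightarrow> payoff y L \<tau> = L y"
    "\<And>s. s \<in> {a..b} \<Longrightarrow> G h s \<le> L s" "a \<le> l" "l \<le> x" "x \<le> m" "m \<le> b"
    "G h l = L l" "G h m = L m" "l < x \<and> x < m \<or> l = x \<and> m = x"
proof -
  obtain p q where pq: "Q p = 0" "Q q = 0" "q < p" by (rule Q_roots)
  obtain c d l m where E: "a \<le> l" "l \<le> x" "x \<le> m" "m \<le> b"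
    "\<And>z. z \<in> {a..b} \<Longrightarrow> G h z \<le> c * z powr p + d * z powr q"
    "G h l = c * l powr p + d * l powr q" "G h m = c * m powr p + d * m powr q"
    "l < x \<and> x < m \<or> l = x \<and> m = x"
  proof (rule power_envelope[of a b "G h" x q p])
    show "continuous_on {a..b} (G h)" using nice_G[of h] by (simp add: nice_def)
  qed (use x a pq(3) in auto)
  show thesis
    by (rule that[of "\<lambda>s. c * s powr p + d * s powr q" l m])
      (use E harmonic_payoff[OF pq(1,2)] in \<open>auto intro: nice_lin nice_powr\<close>)
qed

lemma J_ge_majorant:
  assumes "nice L" "\<And>y \<tau>. y \<in> {a..b} \<Longrightarrow> \<tau> \<in> adm y \<Longrightarrow> payoff y L \<tau> = L y"
    "\<And>s. s \<in> {a..b} \<Longrightarrow> G h s \<le> L s" "y \<in> {a..b}" "\<tau> \<in> adm y"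
  shows "F h y - L y \<le> J y \<tau> h"
  using payoff_mono[OF assms(5,4) nice_G assms(1,3)] assms(2,4,5) by (simp add: J_eq)

lemma V_le:
  assumes "y \<in> {a..b}" "\<tau> \<in> adm y"
  shows "V y h \<le> J y \<tau> h"
proof -
  obtain L l m where L: "nice L" "\<And>y \<tau>. y \<in> {a..b} \<Longrightarrow> \<tau> \<in> adm y \<Longrightarrow> payoff y L \<tau> = L y"
    "\<And>s. s \<in> {a..b} \<Longrightarrow> G h s \<le> L s"
  \<comment> \<open>Any interior point would serve: the majorant only bounds the costs from below,
    without which the infimum of a set of reals says nothing about its elements.\<close>
  proof (rule harmonic_majorant[of "(a + b) / 2" h])
    show "(a + b) / 2 \<in> {a<..<b}" using ab by simp
  qed blast
  have "bdd_below ((\<lambda>\<tau>. J y \<tau> h) ` adm y)"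
    using J_ge_majorant[OF L assms(1)] by (intro bdd_belowI2[where m="F h y - L y"]) auto
  thus ?thesis unfolding V_def using assms by (intro cINF_lower)
qed

lemma V_le_mv: "y \<in> {a..b} \<Longrightarrow> V y h \<le> mv y"
  using V_le[OF _ zero_adm] J_zero by metis

lemma J_exit:
  assumes lm: "a \<le> l" "l < m" "m \<le> b" and y: "y \<in> {l..m}"
    and L: "nice L" "\<And>y \<tau>. y \<in> {a..b} \<Longrightarrow> \<tau> \<in> adm y \<Longrightarrow> payoff y L \<tau> = L y"
    and eq: "G h l = L l" "G h m = L m"
  shows "J y (exit_stop l m y) h = F h y - L y"
proof -
  have y': "y \<in> {a..b}" using y lm by auto
  note adm = exit_stop_adm[OF lm y]
  show ?thesis unfolding J_eq[OF y' adm] payoff_exit[OF lm y nice_G L(1) eq] L(2)[OF y' adm] ..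
qed

text \<open>At a contact point of \<open>G h\<close> and \<open>L\<close> stopping at once is
  optimal. The ends \<open>l\<close> and \<open>m\<close> are the contacts nearest to
  \<open>x\<close>, which itself is none by \<open>C\<close>. Strictly between them
  \<open>G h < L\<close>, so leaving the interval beats stopping at once.\<close>

lemma optimal_exit:
  assumes x: "x \<in> {a<..<b}" and C: "V x h < mv x"
  obtains l m where "a \<le> l" "l < x" "x < m" "m \<le> b" "V x h = J x (exit_stop l m x) h"
    "l \<in> Dset M W r \<sigma> K a b h" "m \<in> Dset M W r \<sigma> K a b h"
    "\<And>s. s \<in> {l<..<m} \<Longrightarrow> s \<notin> Dset M W r \<sigma> K a b h"
proof -
  obtain L l0 m0 where L: "nice L" "\<And>y \<tau>. y \<in> {a..b} \<Longrightarrow> \<tau> \<in> adm y \<Longrightarrow> payoff y L \<tau> = L y"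
    "\<And>s. s \<in> {a..b} \<Longrightarrow> G h s \<le> L s" and l0: "a \<le> l0" "l0 \<le> x" "x \<le> m0" "m0 \<le> b"
    "G h l0 = L l0" "G h m0 = L m0"
    by (rule harmonic_majorant[OF x, of h]) blast
  define T where "T = {s \<in> {a..b}. G h s = L s}"
  have V_ge: "F h y - L y \<le> V y h" if "y \<in> {a..b}" for y
    unfolding V_def using zero_adm[OF that] J_ge_majorant[OF L that] by (intro cINF_greatest) auto
  have touch: "V y h = mv y" if "y \<in> T" for y
  proof -
    have "F h y - L y = mv y" using that by (simp add: T_def G_def)
    thus ?thesis using V_ge[of y] V_le_mv[of y h] that by (auto simp: T_def)
  qed
  have xT: "x \<notin> T" using touch C by auto
  have "closed ({a..b} \<inter> (\<lambda>s. G h s - L s) -` {0})"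
    using nice_G[of h] L(1) by (intro continuous_closed_preimage continuous_intros) (auto simp: nice_def)
  moreover have "{a..b} \<inter> (\<lambda>s. G h s - L s) -` {0} = T" by (auto simp: T_def)
  ultimately have "closed T" by simp
  hence cl: "closed (T \<inter> {..x})" "closed (T \<inter> {x..})" by auto
  define l where "l = Sup (T \<inter> {..x})"
  define m where "m = Inf (T \<inter> {x..})"
  have bl: "bdd_above (T \<inter> {..x})" "bdd_below (T \<inter> {x..})" by auto
  have "l0 \<in> T" "m0 \<in> T" using l0 x by (auto simp: T_def)
  hence ne: "T \<inter> {..x} \<noteq> {}" "T \<inter> {x..} \<noteq> {}" using l0 by auto
  have lT: "l \<in> T \<inter> {..x}" unfolding l_def by (rule closed_contains_Sup[OF ne(1) bl(1) cl(1)])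
  have mT: "m \<in> T \<inter> {x..}" unfolding m_def by (rule closed_contains_Inf[OF ne(2) bl(2) cl(2)])
  have lm: "a \<le> l" "l < x" "x < m" "m \<le> b" using lT mT xT by (auto simp: T_def less_le)
  have between: "s \<notin> T" if "s \<in> {l<..<m}" for s
  proof
    assume s: "s \<in> T"
    show False
    proof (cases "s \<le> x")
      case True
      hence "s \<le> l" unfolding l_def using s bl by (intro cSup_upper) auto
      thus False using that by auto
    next
      case False
      hence "m \<le> s" unfolding m_def using s bl by (intro cInf_lower) auto
      thus False using that by auto
    qed
  qed
  have eq: "G h l = L l" "G h m = L m" using lT mT by (auto simp: T_def)
  have lm': "l < m" using lm by simp
  note Jx = J_exit[OF lm(1) lm' lm(4) _ L(1,2) eq]
  show thesis
  proof (rule that[OF lm])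
    have x': "x \<in> {l..m}" "x \<in> {a..b}" using lm by auto
    show "V x h = J x (exit_stop l m x) h"
      using Jx[OF x'(1)] V_ge[OF x'(2)] V_le[OF x'(2) exit_stop_adm[OF lm(1) lm' lm(4) x'(1)], of h] by simp
    show "l \<in> Dset M W r \<sigma> K a b h" "m \<in> Dset M W r \<sigma> K a b h"
      using touch lT mT by (auto simp: Dset_def T_def)
    fix s assume s: "s \<in> {l<..<m}"
    have s': "s \<in> {l..m}" "s \<in> {a..b}" using s lm by auto
    have "V s h \<le> F h s - L s"
      using Jx[OF s'(1)] V_le[OF s'(2) exit_stop_adm[OF lm(1) lm' lm(4) s'(1)], of h] by simp
    also have "\<dots> < mv s" using between[OF s] L(3)[OF s'(2)] s'(2) by (auto simp: T_def G_def)
    finally show "s \<notin> Dset M W r \<sigma> K a b h" by (simp add: Dset_def)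
  qed
qed

text \<open>A continuous path started in an interval that avoids \<open>D_h\<close> and has both
  ends in it meets \<open>D_h\<close> first at the exit. On paths that never leave, the hitting set
  is empty and the time is the constant \<open>Inf {}\<close>.\<close>

lemma run_opt_stop:
  assumes lm: "a \<le> l" "l < x" "x < m" "m \<le> b" and D: "l \<in> Dset M W r \<sigma> K a b h" "m \<in> Dset M W r \<sigma> K a b h"
    "\<And>s. s \<in> {l<..<m} \<Longrightarrow> s \<notin> Dset M W r \<sigma> K a b h" and g: "g \<in> borel_measurable borel"
  shows "disc_run M W r \<sigma> x g (opt_stop M W r \<sigma> K a b x h) = disc_run M W r \<sigma> x g (exit_stop l m x)"
proof (rule run_exit_cong[where c="Inf {}"])
  show l0: "0 < l" and lm': "l < m" and x: "x \<in> {l..m}" using lm a by auto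
  fix \<omega> assume om: "\<omega> \<in> space M"
  define E where "E = {t. 0 \<le> t \<and> S x t \<omega> \<in> Dset M W r \<sigma> K a b h}"
  have os: "opt_stop M W r \<sigma> K a b x h \<omega> = Inf E" by (simp add: opt_stop_def E_def)
  show "opt_stop M W r \<sigma> K a b x h \<omega> = (if \<exists>t\<ge>0. S x t \<omega> \<notin> {l<..<m} then exit_stop l m x \<omega> else Inf {})"
  proof (cases "\<exists>t\<ge>0. S x t \<omega> \<notin> {l<..<m}")
    case True
    note f = exit_time_facts[OF x om True]
    have "Inf E = exit_time W r \<sigma> l m x \<omega>"
    proof (rule cInf_eq_minimum)
      show "exit_time W r \<sigma> l m x \<omega> \<in> E" using f(1,2) D(1,2) by (auto simp: E_def)
      fix t assume "t \<in> E"
      thus "exit_time W r \<sigma> l m x \<omega> \<le> t" using f(4)[of t] D(3) by (auto simp: E_def)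
    qed
    thus ?thesis unfolding os if_P[OF True] using True by (simp add: exit_stop_def)
  next
    case False
    hence "E = {}" using D(3) by (auto simp: E_def)
    thus ?thesis unfolding os if_not_P[OF False] by (rule arg_cong)
  qed
qed (rule g)

text \<open>Otherwise \<open>\<gamma>2 - h * \<gamma>1\<close> vanishes inside, and Dynkin's formula
  makes the expected running cost with rate \<open>(\<Delta> s - h) * \<sigma>^2 * s^2\<close> zero
  up to the exit from every interior subinterval. But \<open>\<Delta>\<close> is strictly
  increasing, so this rate has a strict sign on some subinterval.\<close>

lemma \<Gamma>_not_constant:
  "\<exists>s\<in>{a<..<b}. \<gamma>2 s \<noteq> h * \<gamma>1 s"
proof (rule ccontr)
  assume \<Gamma>: "\<not> (\<exists>s\<in>{a<..<b}. \<gamma>2 s \<noteq> h * \<gamma>1 s)"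
  hence eq: "\<gamma>2 s = h * \<gamma>1 s" if "s \<in> {a<..<b}" for s
    using that \<Gamma> by blast
  define c where "c = (a + b) / 2"
  have c: "a < c" "c < b" using ab by (auto simp: c_def)
  \<comment> \<open>If \<open>h\<close> is at most the value of \<open>\<Delta>\<close> at the
    midpoint \<open>c\<close>, then \<open>\<Delta> s > h\<close> to the right of \<open>c\<close>;
    otherwise \<open>\<Delta> s < h\<close> to its left. \<open>\<beta>\<close> is the resulting
    sign, and \<open>l\<close>, \<open>m\<close> bound a subinterval on that side with ends inside
    \<open>(a, b)\<close>, where \<open>w\<close> is known to vanish.\<close>
  define \<beta> :: real where "\<beta> = (if h \<le> \<Delta> c then 1 else - 1)"
  define l where "l = (if h \<le> \<Delta> c then c else (a + c) / 2)"
  define m where "m = (if h \<le> \<Delta> c then (c + b) / 2 else c)"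
  have lm: "a < l" "l < m" "m < b" using c by (auto simp: l_def m_def)
  define g where "g = (\<lambda>s. \<beta> * cost2 s + (- \<beta> * h) * cost1 s)"
  define w where "w = (\<lambda>s. \<beta> * \<gamma>2 s + (- \<beta> * h) * \<gamma>1 s)"
  have gw: "dynkin_pair g w" unfolding g_def w_def by (intro dynkin_pair_lin P1(1) P2(1))
  have w0: "w s = 0" if "s \<in> {a<..<b}" for s using eq[OF that] by (simp add: w_def)
  define y where "y = (l + m) / 2"
  have y: "l < y" "y < m" using lm by (auto simp: y_def)
  have geq: "g s = (\<beta> * (\<Delta> s - h)) * (\<sigma>\<^sup>2 * s\<^sup>2)" for s by (simp add: g_def algebra_simps)
  have sgn: "0 < \<beta> * (\<Delta> s - h)" if "s \<in> {l<..<m}" for s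
    using that \<Delta>_less[of c s] \<Delta>_less[of s c] c lm by (auto simp: \<beta>_def l_def m_def split: if_splits)
  have sgn': "0 \<le> \<beta> * (\<Delta> s - h)" if "s \<in> {l..m}" for s
    using that \<Delta>_le[of c s] \<Delta>_le[of s c] c lm by (auto simp: \<beta>_def l_def m_def split: if_splits)
  have y': "y \<in> {l..m}" "y \<in> {a..b}" "y \<in> {a<..<b}" using y lm by auto
  have "0 < disc_run M W r \<sigma> y g (exit_stop l m y)"
  proof (rule run_pos[OF _ _ y dynkin_pairD(1)[OF gw]])
    show "0 < g s" if "s \<in> {l<..<m}" for s
      unfolding geq using that lm a \<sigma> by (intro mult_pos_pos[OF sgn[OF that]]) auto
    show "0 \<le> g s" if "s \<in> {l..m}" for s
      unfolding geq by (intro mult_nonneg_nonneg[OF sgn'[OF that]]) auto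
  qed (use lm in auto)
  also have "disc_run M W r \<sigma> y g (exit_stop l m y) = w y - payoff y w (exit_stop l m y)"
    using lm y' by (intro dynkin_pairD(3)[OF gw] exit_stop_adm) auto
  also have "payoff y w (exit_stop l m y) = payoff y (\<lambda>_. 0) (exit_stop l m y)"
    using lm y' w0 dynkin_pairD(2)[OF gw] by (intro payoff_exit) (auto simp: nice_def)
  finally show False using w0[OF y'(3)] by simp
qed

text \<open>With \<open>h = \<gamma>2 x / \<gamma>1 x\<close> the cost of holding \<open>h\<close> until the exit from \<open>{a<..<b}\<close> is already
  \<open>mv x\<close>. Rebalancing on leaving a smaller interval gains \<open>G h\<close> there, which is positive at a
  suitable end point because the ratio \<open>\<gamma>2 / \<gamma>1\<close> is not constant.\<close>

lemma rebalancing_gain: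
  assumes x: "x \<in> {a<..<b}"
  shows "\<exists>h\<in>{\<Delta> a..\<Delta> b}. V x h < mv x"
proof
  define h where "h = \<gamma>2 x / \<gamma>1 x"
  have g1: "0 < \<gamma>1 x" by (rule \<gamma>1_pos[OF x])
  have x': "x \<in> {a..b}" using x by auto
  have "\<Delta> a \<le> \<Delta> s \<and> \<Delta> s \<le> \<Delta> b" if "s \<in> {a..b}" for s using that by (auto intro: \<Delta>_le)
  thus "h \<in> {\<Delta> a..\<Delta> b}"
    using \<gamma>2_bounds[OF x', of "\<Delta> a" "\<Delta> b"] g1 by (auto simp: h_def field_simps)
  have hx: "\<gamma>2 x = h * \<gamma>1 x" using g1 by (simp add: h_def)
  obtain s where s: "s \<in> {a<..<b}" "\<gamma>2 s \<noteq> h * \<gamma>1 s" using \<Gamma>_not_constant by blast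
  have Gs: "0 < G h s" unfolding G_square[OF s(1)] using \<gamma>1_pos[OF s(1)] s(2) by simp
  \<comment> \<open>The point \<open>s\<close> with positive gain becomes one end; the other is the
    boundary point beyond \<open>x\<close>, where the gain is zero.\<close>
  define l where "l = (if s < x then s else a)"
  define m where "m = (if s < x then b else s)"
  have "s \<noteq> x" using s hx by auto
  hence lm: "a \<le> l" "l < x" "x < m" "m \<le> b" using s(1) x by (auto simp: l_def m_def)
  have pos: "0 < G h l \<or> 0 < G h m" using Gs by (auto simp: l_def m_def)
  have nn: "0 \<le> G h l" "0 \<le> G h m" using lm by (auto intro!: G_nonneg)
  obtain p q where pq: "Q p = 0" "Q q = 0" "q < p" by (rule Q_roots)
  have l0: "0 < l" "l < m" using lm a by auto
  obtain c d where cd: "c * l powr p + d * l powr q = G h l" "c * m powr p + d * m powr q = G h m"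
    by (rule power_interpolation[OF l0 pq(3)])
  \<comment> \<open>\<open>L x\<close> is the expected discounted gain collected on leaving
    \<open>(l, m)\<close>.\<close>
  define L where "L = (\<lambda>s. c * s powr p + d * s powr q)"
  have "0 < L x" unfolding L_def
    using pos nn l0 lm pq cd by (intro power_interpolation_pos[of l x m]) auto
  have xlm: "x \<in> {l..m}" using lm by auto
  have "J x (exit_stop l m x) h = F h x - L x"
  proof (rule J_exit[OF lm(1) l0(2) lm(4) xlm])
    show "nice L" unfolding L_def by (intro nice_lin nice_powr)
    show "payoff y L \<tau> = L y" if "y \<in> {a..b}" "\<tau> \<in> adm y" for y \<tau>
      unfolding L_def by (rule harmonic_payoff[OF pq(1,2) that])
  qed (auto simp: L_def cd)
  moreover have "F h x = mv x" using G_square[OF x, of h] hx by (simp add: G_def)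
  moreover have "V x h \<le> J x (exit_stop l m x) h"
    by (rule V_le[OF x' exit_stop_adm[OF lm(1) l0(2) lm(4) xlm]])
  ultimately show "V x h < mv x" using \<open>0 < L x\<close> by simp
qed

lemma minimiser_is_mean:
  assumes x: "x \<in> {a<..<b}" and hs: "hs \<in> {\<Delta> a..\<Delta> b}"
    and min: "\<And>h. h \<in> {\<Delta> a..\<Delta> b} \<Longrightarrow> V x hs \<le> V x h"
  shows "hs \<in> {\<Delta> a<..<\<Delta> b}" "x \<in> Cset M W r \<sigma> K a b hs" "hs = Gamhat M W r \<sigma> K a b hs x"
proof -
  have x': "x \<in> {a..b}" using x by auto
  have C: "V x hs < mv x" using rebalancing_gain[OF x] min by fastforce
  thus "x \<in> Cset M W r \<sigma> K a b hs" using x' by (simp add: Cset_def)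
  obtain l m where lm: "a \<le> l" "l < x" "x < m" "m \<le> b" and opt: "V x hs = J x (exit_stop l m x) hs"
    and D: "l \<in> Dset M W r \<sigma> K a b hs" "m \<in> Dset M W r \<sigma> K a b hs"
    "\<And>s. s \<in> {l<..<m} \<Longrightarrow> s \<notin> Dset M W r \<sigma> K a b hs"
    using optimal_exit[OF x C] by blast
  define \<tau> where "\<tau> = exit_stop l m x"
  have \<tau>: "\<tau> \<in> adm x" unfolding \<tau>_def using lm by (intro exit_stop_adm) auto
  define A where "A = disc_run M W r \<sigma> x cost1 \<tau>"
  define B where "B = disc_run M W r \<sigma> x cost2 \<tau>"
  \<comment> \<open>Here it matters that \<open>x\<close> lies strictly inside
    \<open>(l, m)\<close>, which rests on \<open>C\<close>.\<close>
  have A: "0 < A" unfolding A_def \<tau>_def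
    using lm a \<sigma> by (intro run_pos nice_costs) auto
  have lo: "\<Delta> a * A < B"
  proof -
    have "0 < disc_run M W r \<sigma> x (\<lambda>s. 1 * cost2 s + (- \<Delta> a) * cost1 s) \<tau>"
      unfolding \<tau>_def
    proof (rule run_pos[OF lm(1,4,2,3)])
      have eq: "1 * cost2 s + (- \<Delta> a) * cost1 s = (\<Delta> s - \<Delta> a) * (\<sigma>\<^sup>2 * s\<^sup>2)" for s
        by (simp add: algebra_simps)
      show "0 < 1 * cost2 s + (- \<Delta> a) * cost1 s" if "s \<in> {l<..<m}" for s
        unfolding eq using that lm a \<sigma> \<Delta>_less[of a s] by (intro mult_pos_pos) auto
      show "0 \<le> 1 * cost2 s + (- \<Delta> a) * cost1 s" if "s \<in> {l..m}" for s
        unfolding eq using that lm \<Delta>_le[of a s] by (intro mult_nonneg_nonneg) auto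
    qed (intro nice_lin nice_costs)
    thus ?thesis unfolding run_lin[OF \<tau> x' nice_costs(2,1)] by (simp add: A_def B_def)
  qed
  have hi: "B < \<Delta> b * A"
  proof -
    have "0 < disc_run M W r \<sigma> x (\<lambda>s. (- 1) * cost2 s + \<Delta> b * cost1 s) \<tau>"
      unfolding \<tau>_def
    proof (rule run_pos[OF lm(1,4,2,3)])
      have eq: "(- 1) * cost2 s + \<Delta> b * cost1 s = (\<Delta> b - \<Delta> s) * (\<sigma>\<^sup>2 * s\<^sup>2)" for s
        by (simp add: algebra_simps)
      show "0 < (- 1) * cost2 s + \<Delta> b * cost1 s" if "s \<in> {l<..<m}" for s
        unfolding eq using that lm a \<sigma> \<Delta>_less[of s b] by (intro mult_pos_pos) auto
      show "0 \<le> (- 1) * cost2 s + \<Delta> b * cost1 s" if "s \<in> {l..m}" for s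
        unfolding eq using that lm \<Delta>_le[of s b] by (intro mult_nonneg_nonneg) auto
    qed (intro nice_lin nice_costs)
    thus ?thesis unfolding run_lin[OF \<tau> x' nice_costs(2,1)] by (simp add: A_def B_def)
  qed
  have int: "B / A \<in> {\<Delta> a<..<\<Delta> b}" using lo hi A by (simp add: field_simps)
  define c where "c = disc_run M W r \<sigma> x cost3 \<tau> + payoff x mv \<tau>"
  have Jq: "J x \<tau> h = h\<^sup>2 * A - 2 * h * B + c" for h
    unfolding J_def ffun_eq run_lin[OF \<tau> x' nice_lin[OF nice_costs(1,2)] nice_costs(3)]
      run_lin[OF \<tau> x' nice_costs(1,2)] by (simp add: A_def B_def c_def)
  have "J x \<tau> hs \<le> V x (B / A)" using min[of "B / A"] int opt by (simp add: \<tau>_def)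
  also have "\<dots> \<le> J x \<tau> (B / A)" by (rule V_le[OF x' \<tau>])
  finally have "hs\<^sup>2 * A - 2 * hs * B \<le> (B / A)\<^sup>2 * A - 2 * (B / A) * B" unfolding Jq by simp
  moreover have "A * (hs - B / A)\<^sup>2 = hs\<^sup>2 * A - 2 * hs * B - ((B / A)\<^sup>2 * A - 2 * (B / A) * B)"
    using A by (simp add: power2_eq_square field_simps)
  ultimately have "A * (hs - B / A)\<^sup>2 \<le> 0" by simp
  hence hsBA: "hs = B / A" using A by (simp add: mult_le_0_iff)
  thus "hs \<in> {\<Delta> a<..<\<Delta> b}" using int by simp
  have "cost1 \<in> borel_measurable borel" "cost2 \<in> borel_measurable borel"
    using nice_costs(1,2) unfolding nice_def by blast+
  hence "Gamhat M W r \<sigma> K a b hs x = B / A"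
    unfolding Gamhat_def gamhat1_def gamhat2_def A_def B_def \<tau>_def
    by (simp only: run_opt_stop[OF lm D])
  thus "hs = Gamhat M W r \<sigma> K a b hs x" using hsBA by simp
qed

end

theorem mainTheorem16:
  fixes M :: "'a measure" and W :: "real \<Rightarrow> 'a \<Rightarrow> real"
    and r \<sigma> K a b x :: real
  assumes "brownian_motion M W"
    and "r > 0" and "\<sigma> > 0" and "K > 0"
    and "ahat r \<sigma> K \<le> a" and "a < b"
    and "assmZ M W r \<sigma> K a b"
    and "x \<in> {a<..<b}"
  shows "\<forall>hs \<in> {h \<in> {Pd r \<sigma> K a..Pd r \<sigma> K b}.
             \<forall>h' \<in> {Pd r \<sigma> K a..Pd r \<sigma> K b}. Vfun M W r \<sigma> K a b x h \<le> Vfun M W r \<sigma> K a b x h'}.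
           hs \<in> {Pd r \<sigma> K a<..<Pd r \<sigma> K b} \<and>
           x \<in> Cset M W r \<sigma> K a b hs \<and>
           hs = Gamhat M W r \<sigma> K a b hs x"
proof -
  \<comment> \<open>This supplies \<open>0 < a\<close>, which the locale demands and the hypotheses
    contain only through \<open>ahat r \<sigma> K \<le> a\<close>.\<close>
  have "0 < ahat r \<sigma> K" using assms(2-4) by (simp add: ahat_def dpar_def add_pos_pos)
  then interpret put_hedge M W r \<sigma> a b K
    using assms by unfold_locales auto
  show ?thesis using minimiser_is_mean[OF assms(8)] by blast
qed

end
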